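(* Consider the bilateral trade problem described in the context. For any welfare weights $\Lambda_B$ and $\Lambda_S$ (Borel measures on $[\underline v,\overline v]$ and $[\underline c,\overline c]$, respectively), there exists a markup-pooling mechanism that maximizes the expected welfare $$\int U_B(v)\,\Lambda_B(dv)+\int U_S(c)\,\Lambda_S(dc)$$ over all mechanisms satisfying the Buyer IC, Seller IC, Buyer IR and Seller IR constraints.
   Context: There is a single good. A buyer privately observes a value $v\in[\underline v,\overline v]$ drawn from a continuous distribution $G_B$; a seller privately observes a cost $c\in[\underline c,\overline c]$ drawn from a continuous distribution $G_S$; $v$ and $c$ are independent. A (direct, incentive-compatible) mechanism is a map $(p,t):[\underline v,\overline v]\times[\underline c,\overline c]\to[0,1]\times\mathbb R$, where $p$ is the probability of trade and $t$ is the expected payment from buyer to seller, satisfying: Buyer IC: $\mathbb E_c[p(v,c)v-t(v,c)]\ge\mathbb E_c[p(\hat v,c)v-t(\hat v,c)]$ for all $v,\hat v$; Seller IC: $\mathbb E_v[t(v,c)-p(v,c)c]\ge\mathbb E_v[t(v,\hat c)-p(v,\hat c)c]$ for all $c,\hat c$; Buyer IR: $\mathbb E_c[p(v,c)v-t(v,c)]\ge0$ for all $v$; Seller IR: $\mathbb E_v[t(v,c)-p(v,c)c]\ge0$ for all $c$. The interim utility functions of a mechanism are $U_B(v)=\mathbb E_c[p(v,c)v-t(v,c)]$ for the buyer and $U_S(c)=\mathbb E_v[t(v,c)-p(v,c)c]$ for the seller. A mechanism $(p,t)$ is a markup-pooling mechanism if there exist a nondecreasing function $\phi$ (of the cost),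 an interval $I=[c_L,c_H]$ and a constant $k\in[0,1]$ such that: if $c\notin I$, then trade happens if and only if $v\ge\phi(c)$; otherwise, let $\tilde c=c_L$ with probability $k$ and $\tilde c=c_H$ with probability $1-k$, and trade happens if and only if $v\ge\phi(\tilde c)$. *)

theory Defs
  imports "HOL-Probability.Probability"
begin

definition borel_measure_on :: "real \<Rightarrow> real \<Rightarrow> real measure \<Rightarrow> bool" where
  "borel_measure_on a b M \<longleftrightarrow> sets M = sets (restrict_space borel {a..b})"

text \<open>The distribution is a probability measure with underlying space \<open>{a..b}\<close>. Its CDF is
  required to be continuous on the whole real line, so there is no atom at \<open>a\<close> either. Neither a
  density nor full support is assumed.\<close>

definition continuous_distribution_on :: "real \<Rightarrow> real \<Rightarrow> real measure \<Rightarrow> bool" where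
  "continuous_distribution_on a b G \<longleftrightarrow>
     borel_measure_on a b G \<and> prob_space G \<and>
     continuous_on UNIV (\<lambda>x. measure G {y \<in> {a..b}. y \<le> x})"

definition buyer_utility ::
  "real measure \<Rightarrow> (real \<Rightarrow> real \<Rightarrow> real) \<Rightarrow> (real \<Rightarrow> real \<Rightarrow> real) \<Rightarrow> real \<Rightarrow> real" where
  "buyer_utility GS p t v = (\<integral>c. p v c * v - t v c \<partial>GS)"

definition seller_utility ::
  "real measure \<Rightarrow> (real \<Rightarrow> real \<Rightarrow> real) \<Rightarrow> (real \<Rightarrow> real \<Rightarrow> real) \<Rightarrow> real \<Rightarrow> real" where
  "seller_utility GB p t c = (\<integral>v. t v c - p v c * c \<partial>GB)"

text \<open>The integrability conditions make the expectations meaningful: every interim utility must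
  exist (the Bochner integral of a non-integrable function is 0 by convention), and the ex-ante
  expected payment must exist. Joint integrability is not implied by that of all sections; without
  it the two iterated integrals of \<open>t\<close> may differ, so that the buyer's and the seller's ex-ante
  expected payments would not balance.\<close>

definition direct_mechanism ::
  "real \<Rightarrow> real \<Rightarrow> real \<Rightarrow> real \<Rightarrow> real measure \<Rightarrow> real measure \<Rightarrow>
   (real \<Rightarrow> real \<Rightarrow> real) \<Rightarrow> (real \<Rightarrow> real \<Rightarrow> real) \<Rightarrow> bool" where
  "direct_mechanism vl vh cl ch GB GS p t \<longleftrightarrow>
     (\<forall>v\<in>{vl..vh}. \<forall>c\<in>{cl..ch}. 0 \<le> p v c \<and> p v c \<le> 1) \<and>
     (\<lambda>(v, c). p v c) \<in> borel_measurable (GB \<Otimes>\<^sub>M GS) \<and>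
     integrable (GB \<Otimes>\<^sub>M GS) (\<lambda>(v, c). t v c) \<and>
     (\<forall>v\<in>{vl..vh}. integrable GS (\<lambda>c. t v c)) \<and>
     (\<forall>c\<in>{cl..ch}. integrable GB (\<lambda>v. t v c))"

definition buyer_IC ::
  "real \<Rightarrow> real \<Rightarrow> real measure \<Rightarrow> (real \<Rightarrow> real \<Rightarrow> real) \<Rightarrow> (real \<Rightarrow> real \<Rightarrow> real) \<Rightarrow> bool" where
  "buyer_IC vl vh GS p t \<longleftrightarrow>
     (\<forall>v\<in>{vl..vh}. \<forall>v'\<in>{vl..vh}.
        (\<integral>c. p v c * v - t v c \<partial>GS) \<ge> (\<integral>c. p v' c * v - t v' c \<partial>GS))"

definition seller_IC ::
  "real \<Rightarrow> real \<Rightarrow> real measure \<Rightarrow> (real \<Rightarrow> real \<Rightarrow> real) \<Rightarrow> (real \<Rightarrow> real \<Rightarrow> real) \<Rightarrow> bool" where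
  "seller_IC cl ch GB p t \<longleftrightarrow>
     (\<forall>c\<in>{cl..ch}. \<forall>c'\<in>{cl..ch}.
        (\<integral>v. t v c - p v c * c \<partial>GB) \<ge> (\<integral>v. t v c' - p v c' * c \<partial>GB))"

definition buyer_IR ::
  "real \<Rightarrow> real \<Rightarrow> real measure \<Rightarrow> (real \<Rightarrow> real \<Rightarrow> real) \<Rightarrow> (real \<Rightarrow> real \<Rightarrow> real) \<Rightarrow> bool" where
  "buyer_IR vl vh GS p t \<longleftrightarrow> (\<forall>v\<in>{vl..vh}. buyer_utility GS p t v \<ge> 0)"

definition seller_IR ::
  "real \<Rightarrow> real \<Rightarrow> real measure \<Rightarrow> (real \<Rightarrow> real \<Rightarrow> real) \<Rightarrow> (real \<Rightarrow> real \<Rightarrow> real) \<Rightarrow> bool" where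
  "seller_IR cl ch GB p t \<longleftrightarrow> (\<forall>c\<in>{cl..ch}. seller_utility GB p t c \<ge> 0)"

definition mechanism ::
  "real \<Rightarrow> real \<Rightarrow> real \<Rightarrow> real \<Rightarrow> real measure \<Rightarrow> real measure \<Rightarrow>
   (real \<Rightarrow> real \<Rightarrow> real) \<Rightarrow> (real \<Rightarrow> real \<Rightarrow> real) \<Rightarrow> bool" where
  "mechanism vl vh cl ch GB GS p t \<longleftrightarrow>
     direct_mechanism vl vh cl ch GB GS p t \<and>
     buyer_IC vl vh GS p t \<and> seller_IC cl ch GB p t \<and>
     buyer_IR vl vh GS p t \<and> seller_IR cl ch GB p t"

text \<open>Costs in the pooling interval are replaced by a lottery over its two endpoints; since \<open>p\<close> is
  the probability of trade, the lottery appears as a convex combination. A value of \<open>\<phi>\<close> above \<open>vh\<close>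
  means that there is no trade.\<close>

definition markup_pooling ::
  "real \<Rightarrow> real \<Rightarrow> real \<Rightarrow> real \<Rightarrow> (real \<Rightarrow> real \<Rightarrow> real) \<Rightarrow> bool" where
  "markup_pooling vl vh cl ch p \<longleftrightarrow>
     (\<exists>\<phi> :: real \<Rightarrow> real. \<exists>cL cH k.
        mono_on {cl..ch} \<phi> \<and> cl \<le> cL \<and> cL \<le> cH \<and> cH \<le> ch \<and> 0 \<le> k \<and> k \<le> 1 \<and>
        (\<forall>v\<in>{vl..vh}. \<forall>c\<in>{cl..ch}.
           p v c = (if c \<notin> {cL..cH} then of_bool (v \<ge> \<phi> c)
                    else k * of_bool (v \<ge> \<phi> cL) + (1 - k) * of_bool (v \<ge> \<phi> cH))))"

text \<open>The weights may be infinite measures, so welfare is an extended nonnegative real. The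
  truncation of negative values by \<^const>\<open>ennreal\<close> is immaterial for mechanisms satisfying IR.\<close>

definition welfare ::
  "real measure \<Rightarrow> real measure \<Rightarrow> real measure \<Rightarrow> real measure \<Rightarrow>
   (real \<Rightarrow> real \<Rightarrow> real) \<Rightarrow> (real \<Rightarrow> real \<Rightarrow> real) \<Rightarrow> ennreal" where
  "welfare GB GS \<Lambda>B \<Lambda>S p t =
     (\<integral>\<^sup>+v. ennreal (buyer_utility GS p t v) \<partial>\<Lambda>B) + (\<integral>\<^sup>+c. ennreal (seller_utility GB p t c) \<partial>\<Lambda>S)"

end

theory Submission
  imports Defs
begin

text \<open>Incentive compatibility makes the buyer's interim trade probability \<open>x\<close> nondecreasing and the
  seller's \<open>q\<close> nonincreasing and determines both utilities up to the utilities of the worst types,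
  whose sum is a linear functional of \<open>(x, q)\<close>, the surplus. If a side has infinite total weight, a
  positive lump sum to it is optimal. For finite weights lump sums go to the side with the larger
  total weight, which leaves a linear objective in \<open>(x, q)\<close> under the single constraint that the
  surplus is nonnegative.

  For a fixed multiplier, ironing the seller's part of the Lagrangian (concave majorant in the
  quantile of the cost) turns it into a problem that is solved pointwise in the cost by a
  nondecreasing cutoff \<open>\<phi>\<close>. At the critical multiplier there are optimal cutoffs \<open>\<phi>0 \<le> \<phi>1\<close> whose surpluses
  have opposite signs. Following \<open>\<phi>0\<close> below \<open>s\<close> and \<open>\<phi>1\<close> above stays optimal as long as \<open>s\<close> is a
  contact point of the majorant, and the surplus depends continuously on \<open>s\<close>. Either it vanishes
  for some optimal \<open>s\<close>, or its sign changes across an interval without contact points; there both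
  cutoffs are essentially constant, and a lottery over the two constants, which is exactly the
  pooling interval, makes the surplus vanish.\<close>


section \<open>Atomless measures on an interval\<close>

text \<open>The distributions need not have densities or full support and the weights may have
  atoms, so virtual values do not exist as functions. Their primitives replace them:
  \<open>buyer_rev\<close> and \<open>seller_rev\<close> are continuous functions of a threshold,
  and the ironed virtual cost is the slope of the concave majorant of \<open>seller_rev\<close>
  against the quantile of the cost.

  Only the seller's side is ironed. For a given cost the trading values can be rearranged into an
  upper set, and upper sets respect the buyer's monotonicity by themselves; what remains is one
  cutoff per cost, and the antitone slope makes it monotone in the cost.

  Cutoff rules do not form a convex set, so the multiplier comes from compactness of the set of
  payoff pairs (Helly) and not from separation. It requires a rule with positive surplus. Without
  gains from trade there is none, and that case is solved by hand; it is not trivial, because types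
  outside the supports may carry welfare weight and can still be given rents.\<close>

locale atomless_on = finite_measure M for M :: "real measure" +
  fixes a b :: real
  assumes sets_M: "sets M = sets (restrict_space borel {a..b})"
    and atomless: "measure M {x} = 0"
begin

lemma space_M: "space M = {a..b}"
  using sets_eq_imp_space_eq[OF sets_M] by (simp add: space_restrict_space)

lemma borel_measurableI [measurable (raw)]: "f \<in> borel_measurable borel \<Longrightarrow> f \<in> borel_measurable M"
  using measurable_cong_sets[OF sets_M refl] measurable_restrict_space1 by blast

lemma measurable_mono: "mono_on {a..b} f \<Longrightarrow> (f :: real \<Rightarrow> real) \<in> borel_measurable M"
  using measurable_cong_sets[OF sets_M refl] borel_measurable_mono_on_fnc by blast

lemma measurable_antimono:
  assumes "\<And>x y. a \<le> x \<Longrightarrow> x \<le> y \<Longrightarrow> y \<le> b \<Longrightarrow> f y \<le> (f x :: real)"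
  shows "f \<in> borel_measurable M"
proof -
  have "mono_on {a..b} (\<lambda>x. - f x)" using assms by (auto intro!: mono_onI)
  from measurable_mono[OF this] have "(\<lambda>x. - (- f x)) \<in> borel_measurable M" by measurable
  then show ?thesis by simp
qed

lemma AE_neq: "AE x in M. x \<noteq> c"
proof (cases "c \<in> space M")
  case True
  then have "{c} \<in> sets M" by (auto simp: sets_M space_M sets_restrict_space image_iff intro!: bexI[of _ "{c}"])
  then have "{c} \<in> null_sets M" using atomless[of c] by (auto simp: null_sets_def emeasure_eq_measure)
  then show ?thesis by (rule AE_I') auto
qed (auto intro: AE_I2)

lemma AE_notin_countable: "countable A \<Longrightarrow> AE x in M. x \<notin> A"
  using AE_ball_countable[of A "\<lambda>x c. x \<noteq> c" M] AE_neq by (auto elim: eventually_mono)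

lemma integrable_bounded:
  "f \<in> borel_measurable M \<Longrightarrow> (\<And>x. x \<in> {a..b} \<Longrightarrow> \<bar>f x\<bar> \<le> B) \<Longrightarrow> integrable M (f :: real \<Rightarrow> real)"
  by (rule integrable_const_bound[where B=B]) (auto simp: space_M)

lemma integrable_indicator_mult:
  "integrable M f \<Longrightarrow> A \<in> sets borel \<Longrightarrow> integrable M (\<lambda>v. indicator A v * (f v :: real))"
  by (rule Bochner_Integration.integrable_bound[where f=f]) (auto split: split_indicator)

text \<open>The indicators converge at every \<open>v\<close> except possibly at the limit
  \<open>w\<close>, and that point is null. Continuity of distribution functions, revenues and rents
  in a threshold rests on this.\<close>

lemma continuous_integral_atLeast:
  assumes f: "integrable M f"
  shows "continuous_on UNIV (\<lambda>w. \<integral>v. indicator {w..} v * (f v :: real) \<partial>M)"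
proof (rule continuous_on_sequentiallyI)
  fix u :: "nat \<Rightarrow> real" and w assume u: "u \<longlonglongrightarrow> w"
  show "(\<lambda>n. \<integral>v. indicator {u n..} v * f v \<partial>M) \<longlonglongrightarrow> (\<integral>v. indicator {w..} v * f v \<partial>M)"
  proof (rule integral_dominated_convergence[where w="\<lambda>v. \<bar>f v\<bar>"])
    show "AE v in M. (\<lambda>n. indicator {u n..} v * f v) \<longlonglongrightarrow> indicator {w..} v * f v"
      using AE_neq[of w]
    proof eventually_elim
      case (elim v)
      have "\<forall>\<^sub>F n in sequentially. indicator {u n..} v = (indicator {w..} v :: real)"
      proof (cases "v < w")
        case True
        then have "\<forall>\<^sub>F n in sequentially. v < u n" using order_tendstoD(1)[OF u] by blast
        then show ?thesis by eventually_elim (use True in auto)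
      next
        case False
        then have "\<forall>\<^sub>F n in sequentially. u n < v" using order_tendstoD(2)[OF u] elim by simp
        then show ?thesis by eventually_elim (use False in auto)
      qed
      then show ?case by (intro tendsto_mult tendsto_const tendsto_eventually)
    qed
  qed (use f in \<open>auto split: split_indicator\<close>)
qed

lemma integral_split_at:
  assumes f: "integrable M f"
  shows "(\<integral>v. indicator {..z} v * (f v :: real) \<partial>M) = (\<integral>v. f v \<partial>M) - (\<integral>v. indicator {z..} v * f v \<partial>M)"
proof -
  have "(\<integral>v. indicator {..z} v * f v \<partial>M) = (\<integral>v. f v - indicator {z..} v * f v \<partial>M)"
    using f AE_neq[of z] by (intro integral_cong_AE) (auto split: split_indicator)
  also have "\<dots> = (\<integral>v. f v \<partial>M) - (\<integral>v. indicator {z..} v * f v \<partial>M)"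
    using f by (intro Bochner_Integration.integral_diff integrable_indicator_mult) auto
  finally show ?thesis .
qed

lemma continuous_integral_atMost:
  assumes f: "integrable M f"
  shows "continuous_on UNIV (\<lambda>w. \<integral>v. indicator {..w} v * (f v :: real) \<partial>M)"
  unfolding integral_split_at[OF f] using continuous_integral_atLeast[OF f] by (intro continuous_intros)

lemma integral_Ioc:
  assumes f: "integrable M f" and "c \<le> d"
  shows "(\<integral>v. indicator {c<..d} v * (f v :: real) \<partial>M)
    = (\<integral>v. indicator {..d} v * f v \<partial>M) - (\<integral>v. indicator {..c} v * f v \<partial>M)"
proof -
  have "(\<integral>v. indicator {c<..d} v * f v \<partial>M) = (\<integral>v. indicator {..d} v * f v - indicator {..c} v * f v \<partial>M)"
    using \<open>c \<le> d\<close> by (intro Bochner_Integration.integral_cong) (auto split: split_indicator)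
  also have "\<dots> = (\<integral>v. indicator {..d} v * f v \<partial>M) - (\<integral>v. indicator {..c} v * f v \<partial>M)"
    using f by (intro Bochner_Integration.integral_diff integrable_indicator_mult) auto
  finally show ?thesis .
qed

definition cdf :: "real \<Rightarrow> real" where "cdf z = measure M ({..z} \<inter> space M)"

definition sdf :: "real \<Rightarrow> real" where "sdf z = measure M ({z..} \<inter> space M)"

lemma cdf_eq: "cdf z = (\<integral>v. indicator {..z} v \<partial>M)" and sdf_eq: "sdf z = (\<integral>v. indicator {z..} v \<partial>M)"
  by (simp_all add: cdf_def sdf_def)

lemma integrable_indicator' [simp]: "A \<in> sets borel \<Longrightarrow> integrable M (indicator A :: real \<Rightarrow> real)"
  by (rule integrable_bounded[where B=1]) (auto split: split_indicator)

lemma integrable_const' [simp]: "integrable M (\<lambda>_. c :: real)"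
  by simp

lemma continuous_cdf: "continuous_on A cdf"
  using continuous_integral_atMost[of "\<lambda>_. 1"] unfolding cdf_def
  by (auto intro: continuous_on_subset)

lemma continuous_sdf: "continuous_on A sdf"
  using continuous_integral_atLeast[of "\<lambda>_. 1"] unfolding sdf_def
  by (auto intro: continuous_on_subset)

lemma cdf_mono: "x \<le> y \<Longrightarrow> cdf x \<le> cdf y"
  unfolding cdf_eq by (intro integral_mono integrable_indicator') (auto split: split_indicator)

lemma sdf_antimono: "x \<le> y \<Longrightarrow> sdf y \<le> sdf x"
  unfolding sdf_eq by (intro integral_mono integrable_indicator') (auto split: split_indicator)

lemma cdf_nonneg: "0 \<le> cdf x" and sdf_nonneg: "0 \<le> sdf x"
  unfolding cdf_def sdf_def by auto

lemma cdf_conv_sdf: "cdf z = measure M (space M) - sdf z"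
  using integral_split_at[of "\<lambda>_. 1" z] by (simp add: cdf_def sdf_def)

lemma cdf_lower: "x \<le> a \<Longrightarrow> cdf x = 0"
proof -
  assume "x \<le> a"
  then have "cdf x = (\<integral>v. 0 \<partial>M)" unfolding cdf_eq
    using AE_neq[of a] by (intro integral_cong_AE) (auto simp: space_M split: split_indicator)
  then show ?thesis by simp
qed

lemma cdf_upper: "b \<le> x \<Longrightarrow> cdf x = measure M (space M)"
proof -
  assume "b \<le> x"
  then have "cdf x = (\<integral>v. 1 \<partial>M)" unfolding cdf_eq
    by (intro Bochner_Integration.integral_cong) (auto simp: space_M split: split_indicator)
  then show ?thesis by simp
qed

lemma sdf_upper: "b \<le> x \<Longrightarrow> sdf x = 0" and sdf_lower: "x \<le> a \<Longrightarrow> sdf x = measure M (space M)"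
  using cdf_conv_sdf[of x] cdf_upper[of x] cdf_lower[of x] by simp_all

text \<open>On a partition that is fine with respect to \<open>M\<close>, the two subgradient inequalities pin
  the increments of \<open>U\<close> down up to a telescoping error.\<close>

lemma subgradient_integral:
  assumes cd: "c \<le> d" and sub: "{c..d} \<subseteq> {a..b}"
    and mono: "mono_on {c..d} m"
    and lower: "\<And>u v. c \<le> u \<Longrightarrow> u \<le> v \<Longrightarrow> v \<le> d \<Longrightarrow> m u * (cdf v - cdf u) \<le> U v - U u"
    and upper: "\<And>u v. c \<le> u \<Longrightarrow> u \<le> v \<Longrightarrow> v \<le> d \<Longrightarrow> U v - U u \<le> m v * (cdf v - cdf u)"
  shows "U d - U c = (\<integral>v. indicator {c<..d} v * m v \<partial>M)"
proof -
  \<comment> \<open>Clamping the argument extends \<open>m\<close> monotonically to the whole line,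
    which makes it Borel; on \<open>{c..d}\<close> nothing changes.\<close>
  define m' where "m' v = m (max c (min d v))" for v
  have m'_mono: "mono m'"
    unfolding m'_def by (intro monoI mono_onD[OF mono]) (use cd in auto)
  have m'_eq: "m' v = m v" if "v \<in> {c..d}" for v using that by (auto simp: m'_def)
  have m'_int: "integrable M m'"
  proof (rule integrable_bounded[where B="max \<bar>m c\<bar> \<bar>m d\<bar>"])
    show "m' \<in> borel_measurable M" using m'_mono by (intro borel_measurableI borel_measurable_mono)
    fix x
    have "m c \<le> m' x" "m' x \<le> m d" unfolding m'_def by (intro mono_onD[OF mono]; use cd in auto)+
    then show "\<bar>m' x\<bar> \<le> max \<bar>m c\<bar> \<bar>m d\<bar>" by linarith
  qed
  define J where "J v = (\<integral>x. indicator {..v} x * m' x \<partial>M)" for v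
  have J_diff: "J v - J u = (\<integral>x. indicator {u<..v} x * m' x \<partial>M)" if "u \<le> v" for u v
    unfolding J_def using integral_Ioc[OF m'_int that] by simp
  have cdf_diff: "cdf v - cdf u = (\<integral>x. indicator {u<..v} x \<partial>M)" if "u \<le> v" for u v
    unfolding cdf_eq using integral_Ioc[of "\<lambda>_. 1", OF integrable_const' that] by simp
  have J_lower: "m u * (cdf v - cdf u) \<le> J v - J u" if "c \<le> u" "u \<le> v" "v \<le> d" for u v
  proof -
    have "m' u * (cdf v - cdf u) = (\<integral>x. indicator {u<..v} x * m' u \<partial>M)"
      using that by (simp add: cdf_diff)
    also have "\<dots> \<le> (\<integral>x. indicator {u<..v} x * m' x \<partial>M)"
      by (intro integral_mono integrable_indicator_mult m'_int) (auto split: split_indicator intro: monoD[OF m'_mono])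
    finally show ?thesis using that by (simp add: J_diff m'_eq)
  qed
  have J_upper: "J v - J u \<le> m v * (cdf v - cdf u)" if "c \<le> u" "u \<le> v" "v \<le> d" for u v
  proof -
    have "(\<integral>x. indicator {u<..v} x * m' x \<partial>M) \<le> (\<integral>x. indicator {u<..v} x * m' v \<partial>M)"
      by (intro integral_mono integrable_indicator_mult m'_int) (auto split: split_indicator intro: monoD[OF m'_mono])
    also have "\<dots> = m' v * (cdf v - cdf u)"
      using that by (simp add: cdf_diff)
    finally show ?thesis using that by (simp add: J_diff m'_eq)
  qed
  \<comment> \<open>\<open>U\<close> and the integral \<open>J\<close> obey the same two-sided
    bounds, so an increment of their difference is at most the product of the increments of
    \<open>m\<close> and \<open>cdf\<close>.\<close>
  define N where "N v = U v - J v" for v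
  have N_step: "\<bar>N v - N u\<bar> \<le> (m v - m u) * (cdf v - cdf u)" if "c \<le> u" "u \<le> v" "v \<le> d" for u v
    using lower[OF that] upper[OF that] J_lower[OF that] J_upper[OF that]
    unfolding N_def by (simp add: algebra_simps abs_le_iff)
  have small: "\<bar>N d - N c\<bar> \<le> e * (m d - m c)" if e: "e > 0" for e
  proof -
    have "uniformly_continuous_on {c..d} cdf"
      by (intro compact_uniformly_continuous continuous_cdf) auto
    then obtain \<delta> where \<delta>: "\<delta> > 0" "\<And>x y. x \<in> {c..d} \<Longrightarrow> y \<in> {c..d} \<Longrightarrow> dist y x < \<delta> \<Longrightarrow> dist (cdf y) (cdf x) < e"
      using e unfolding uniformly_continuous_on_def by metis
    obtain n0 :: nat where "(d - c) / \<delta> < real n0" using reals_Archimedean2 by blast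
    then have "(d - c) / \<delta> < real (Suc n0)" by simp
    then obtain n :: nat where n: "(d - c) / \<delta> < real n" "n > 0" by blast
    define p where "p i = c + (d - c) * real i / real n" for i
    have p_in: "p i \<in> {c..d}" if "i \<le> n" for i
    proof -
      have "(d - c) * real i / real n \<le> (d - c) * 1"
        unfolding times_divide_eq_right[symmetric] using cd that n by (intro mult_left_mono) auto
      moreover have "0 \<le> (d - c) * real i / real n" using cd by simp
      ultimately show ?thesis by (simp add: p_def)
    qed
    have p_step: "p (Suc i) - p i = (d - c) / n" for i
      by (simp add: p_def add_divide_distrib distrib_left)
    have p_mono: "p i \<le> p (Suc i)" for i using p_step[of i] cd n by (smt (verit) divide_nonneg_nonneg of_nat_0_le_iff)
    have step: "\<bar>N (p (Suc i)) - N (p i)\<bar> \<le> e * (m (p (Suc i)) - m (p i))" if "i < n" for i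
    proof -
      have in': "p i \<in> {c..d}" "p (Suc i) \<in> {c..d}" using p_in that by auto
      have "(d - c) / n < \<delta>" using n \<delta>(1) by (simp add: field_simps)
      then have "dist (cdf (p (Suc i))) (cdf (p i)) < e"
        using in' p_step[of i] p_mono[of i] by (intro \<delta>(2)) (auto simp: dist_real_def)
      then have le: "cdf (p (Suc i)) - cdf (p i) \<le> e" by (auto simp: dist_real_def)
      have "\<bar>N (p (Suc i)) - N (p i)\<bar> \<le> (m (p (Suc i)) - m (p i)) * (cdf (p (Suc i)) - cdf (p i))"
        using in' p_mono by (intro N_step) auto
      also have "\<dots> \<le> (m (p (Suc i)) - m (p i)) * e"
        using le mono_onD[OF mono in' p_mono] by (intro mult_left_mono) auto
      finally show ?thesis by (simp add: mult.commute)
    qed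
    have "\<bar>N (p k) - N (p 0)\<bar> \<le> e * (m (p k) - m (p 0))" if "k \<le> n" for k
      using that
    proof (induction k)
      case (Suc k)
      then show ?case using step[of k] by (simp add: algebra_simps)
    qed simp
    from this[of n] show ?thesis using n by (simp add: p_def)
  qed
  have "N d = N c"
  proof (rule ccontr)
    assume ne: "N d \<noteq> N c"
    have mm: "0 \<le> m d - m c" using mono_onD[OF mono, of c d] cd by auto
    \<comment> \<open>Small enough to contradict \<open>small\<close>; the added 1 covers a constant
      \<open>m\<close>.\<close>
    define e where "e = \<bar>N d - N c\<bar> / (2 * (m d - m c + 1))"
    have e: "e > 0" using ne mm by (auto simp: e_def)
    have "e * (2 * (m d - m c + 1)) = \<bar>N d - N c\<bar>" using mm by (simp add: e_def)
    moreover have "e * (m d - m c) < e * (2 * (m d - m c + 1))" using e mm by (intro mult_strict_left_mono) auto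
    ultimately show False using small[OF e] by linarith
  qed
  then have "U d - U c = J d - J c" by (simp add: N_def)
  also have "\<dots> = (\<integral>x. indicator {c<..d} x * m' x \<partial>M)" using J_diff[OF cd] .
  also have "\<dots> = (\<integral>x. indicator {c<..d} x * m x \<partial>M)"
    by (intro Bochner_Integration.integral_cong) (auto simp: m'_eq split: split_indicator)
  finally show ?thesis .
qed

end

text \<open>Rents are integrals against Lebesgue measure on a type interval. As a further instance
  of the locale it shares all lemmas with the distributions; on \<open>{0..1}\<close> it also serves
  as the level variable of the layer-cake formula.\<close>

lemma atomless_on_lborel: "atomless_on (restrict_space lborel {a..b}) a b"
proof -
  have "finite_measure (restrict_space lborel {a..b})"
    by (rule finite_measureI) (auto simp: emeasure_restrict_space space_restrict_space emeasure_lborel_Icc_eq)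
  moreover have "measure (restrict_space lborel {a..b}) {x} = 0" for x
  proof (cases "x \<in> {a..b}")
    case True
    then show ?thesis by (simp add: measure_restrict_space)
  next
    case False
    then show ?thesis by (intro measure_notin_sets) (auto simp: sets_restrict_space)
  qed
  moreover have "sets (restrict_space lborel {a..b}) = sets (restrict_space borel {a..b})"
    by (rule sets_restrict_space_cong) simp
  ultimately show ?thesis by (simp add: atomless_on_def atomless_on_axioms_def)
qed

lemma cdf_lborel: "x \<in> {a..b} \<Longrightarrow> atomless_on.cdf (restrict_space lborel {a..b}) x = x - a"
proof -
  assume x: "x \<in> {a..b}"
  then have "{..x} \<inter> {a..b} = {a..x}" by auto
  with x show ?thesis
    by (simp add: atomless_on.cdf_def[OF atomless_on_lborel] space_restrict_space measure_restrict_space)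
qed


section \<open>Concave majorants in quantiles\<close>

locale atomless_prob_on = atomless_on + prob_space M
begin

lemma cdf_le_1: "cdf x \<le> 1"
  using prob_space by (simp add: cdf_conv_sdf sdf_nonneg)

lemma sdf_conv_cdf: "sdf x = 1 - cdf x"
  using prob_space by (simp add: cdf_conv_sdf)

lemma a_le_b: "a \<le> b"
  using not_empty by (simp add: space_M)

lemma cdf_a: "cdf a = 0" and cdf_b: "cdf b = 1"
  using cdf_lower[of a] cdf_upper[of b] prob_space by simp_all

lemma a_less_b: "a < b"
  using a_le_b cdf_a cdf_b by (cases "a = b") auto

text \<open>The level set is nonempty by the intermediate value theorem and compact;
  \<open>l\<close> and \<open>h\<close> are its ends, which differ if the support has a gap at this
  level.\<close>

lemma cdf_level:
  assumes "0 \<le> y" "y \<le> 1"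
  obtains l h where "a \<le> l" "l \<le> h" "h \<le> b" "cdf l = y" "cdf h = y"
    "\<And>x. x \<in> {a..b} \<Longrightarrow> x < l \<Longrightarrow> cdf x < y" "\<And>x. x \<in> {a..b} \<Longrightarrow> h < x \<Longrightarrow> y < cdf x"
proof -
  define A where "A = {x \<in> {a..b}. cdf x = y}"
  have "\<exists>x\<ge>a. x \<le> b \<and> cdf x = y"
    using assms by (intro IVT' continuous_cdf) (auto simp: cdf_a cdf_b a_le_b)
  then have ne: "A \<noteq> {}" by (auto simp: A_def)
  have "closed A" unfolding A_def
    by (intro continuous_closed_preimage_constant continuous_cdf closed_atLeastAtMost)
  then have cpt: "compact A"
    by (rule compact_eq_bounded_closed[THEN iffD2, OF conjI, rotated])
      (rule bounded_subset[of "{a..b}"], auto simp: A_def)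
  obtain l where l: "l \<in> A" "\<And>x. x \<in> A \<Longrightarrow> l \<le> x" using compact_attains_inf[OF cpt ne] by blast
  obtain h where h: "h \<in> A" "\<And>x. x \<in> A \<Longrightarrow> x \<le> h" using compact_attains_sup[OF cpt ne] by blast
  show ?thesis
  proof (rule that)
    show "cdf x < y" if "x \<in> {a..b}" "x < l" for x
    proof -
      have "x \<notin> A" using l(2)[of x] that by auto
      then show ?thesis using that l(1) cdf_mono[of x l] by (auto simp: A_def order.strict_iff_order)
    qed
    show "y < cdf x" if "x \<in> {a..b}" "h < x" for x
    proof -
      have "x \<notin> A" using h(2)[of x] that by auto
      then show ?thesis using that h(1) cdf_mono[of h x] by (auto simp: A_def order.strict_iff_order)
    qed
  qed (use l h in \<open>auto simp: A_def\<close>)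
qed

text \<open>A level set of \<open>cdf\<close> is an interval over which \<open>cdf\<close> does not
  grow, hence a null set: quantiles of a draw have no atoms.\<close>

lemma AE_cdf_neq: "AE c in M. cdf c \<noteq> y"
proof (cases "0 \<le> y \<and> y \<le> 1")
  case True
  then obtain l h where lh: "a \<le> l" "l \<le> h" "h \<le> b" "cdf l = y" "cdf h = y"
    "\<And>x. x \<in> {a..b} \<Longrightarrow> x < l \<Longrightarrow> cdf x < y" "\<And>x. x \<in> {a..b} \<Longrightarrow> h < x \<Longrightarrow> y < cdf x"
    using cdf_level by metis
  have "(\<integral>c. indicator {l<..h} c \<partial>M) = (0 :: real)"
    using integral_Ioc[of "\<lambda>_. 1" l h] lh by (simp add: cdf_def)
  then have "AE c in M. indicator {l<..h} c = (0 :: real)"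
    by (subst (asm) integral_nonneg_eq_0_iff_AE) auto
  then show ?thesis using AE_neq[of l] AE_space
  proof eventually_elim
    case (elim c)
    then consider "c < l" | "h < c" using lh by (auto simp: indicator_def split: if_splits)
    then show ?case using lh(6,7)[of c] elim by cases (auto simp: space_M)
  qed
next
  case False
  then have "cdf c \<noteq> y" for c using cdf_nonneg[of c] cdf_le_1[of c] by auto
  then show ?thesis by simp
qed

lemma AE_cdf_interior: "AE c in M. 0 < cdf c \<and> cdf c < 1"
  using AE_cdf_neq[of 0] AE_cdf_neq[of 1]
proof eventually_elim
  case (elim c)
  then show ?case using cdf_nonneg[of c] cdf_le_1[of c] by linarith
qed

text \<open>The probability integral transform: the quantile of a draw is uniform on the unit
  interval.\<close>

lemma integral_cdf_le: "0 \<le> y \<Longrightarrow> y \<le> 1 \<Longrightarrow> (\<integral>c. of_bool (cdf c \<le> y) \<partial>M) = y"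
proof -
  assume "0 \<le> y" "y \<le> 1"
  then obtain l h where lh: "a \<le> l" "l \<le> h" "h \<le> b" "cdf l = y" "cdf h = y"
    "\<And>x. x \<in> {a..b} \<Longrightarrow> x < l \<Longrightarrow> cdf x < y" "\<And>x. x \<in> {a..b} \<Longrightarrow> h < x \<Longrightarrow> y < cdf x"
    using cdf_level by metis
  have "(\<integral>c. of_bool (cdf c \<le> y) \<partial>M) = (\<integral>c. (indicator {..h} c :: real) \<partial>M)"
  proof (rule Bochner_Integration.integral_cong)
    fix x assume x: "x \<in> space M"
    show "of_bool (cdf x \<le> y) = (indicator {..h} x :: real)"
      using lh(7)[of x] cdf_mono[of x h] lh x by (auto simp: space_M indicator_def not_le)
  qed simp
  then show ?thesis using lh by (simp add: cdf_def)
qed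

end

locale ironing = atomless_prob_on +
  fixes B :: "real \<Rightarrow> real"
  assumes cont_B: "continuous_on {a..b} B"
begin

definition argmaxes :: "real \<Rightarrow> real set" where
  "argmaxes m = {z \<in> {a..b}. \<forall>y\<in>{a..b}. B y - m * cdf y \<le> B z - m * cdf z}"

text \<open>Taking the last maximiser keeps the selection antitone in \<open>m\<close> even where
  \<open>cdf\<close> is flat and maximisers are not separated by their quantiles.\<close>

definition last_argmax :: "real \<Rightarrow> real" where "last_argmax m = Sup (argmaxes m)"

text \<open>The Legendre transform of \<open>B\<close> in the quantile coordinate.\<close>

definition conjugate :: "real \<Rightarrow> real" where "conjugate m = B (last_argmax m) - m * cdf (last_argmax m)"

text \<open>The biconjugate, that is the infimum of all functions affine in the quantile that lie
  above \<open>B\<close>. It depends on \<open>c\<close> only through \<open>cdf c\<close>, although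
  \<open>B\<close> may vary where \<open>cdf\<close> is flat.\<close>

definition majorant :: "real \<Rightarrow> real" where "majorant c = Inf (range (\<lambda>m. conjugate m + m * cdf c))"

text \<open>The slope at \<open>c\<close> is read off the maximisers beyond \<open>c\<close> and not off the quantile of \<open>c\<close>, so that
  it changes only at contact points of the majorant, even inside gaps of the support.\<close>

definition slopes :: "real \<Rightarrow> real set" where "slopes c = {m. c \<le> last_argmax m}"

definition slope :: "real \<Rightarrow> real" where "slope c = Sup (slopes c)"

lemma argmaxes: "argmaxes m \<noteq> {}" "compact (argmaxes m)"
proof -
  have cont: "continuous_on {a..b} (\<lambda>z. B z - m * cdf z)"
    by (intro continuous_intros cont_B continuous_cdf)
  obtain z where z: "z \<in> {a..b}" "\<And>y. y \<in> {a..b} \<Longrightarrow> B y - m * cdf y \<le> B z - m * cdf z"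
    using continuous_attains_sup[OF _ _ cont] a_le_b by auto
  then show "argmaxes m \<noteq> {}" by (auto simp: argmaxes_def)
  have "argmaxes m = {y \<in> {a..b}. B y - m * cdf y = B z - m * cdf z}"
    using z by (auto simp: argmaxes_def) (metis order_antisym atLeastAtMost_iff)
  moreover have "closed {y \<in> {a..b}. B y - m * cdf y = B z - m * cdf z}"
    by (intro continuous_closed_preimage_constant[OF cont]) auto
  ultimately show "compact (argmaxes m)"
    by (auto simp: compact_eq_bounded_closed intro: bounded_subset[of "{a..b}"])
qed

lemma last_argmax_in: "last_argmax m \<in> argmaxes m"
  unfolding last_argmax_def using argmaxes[of m]
  by (intro closed_contains_Sup) (auto simp: compact_imp_closed intro: bounded_imp_bdd_above compact_imp_bounded)

lemma last_argmax_range: "a \<le> last_argmax m" "last_argmax m \<le> b"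
  using last_argmax_in[of m] by (auto simp: argmaxes_def)

lemma conjugate_ge: "y \<in> {a..b} \<Longrightarrow> B y - m * cdf y \<le> conjugate m"
  using last_argmax_in[of m] by (auto simp: argmaxes_def conjugate_def)

lemma last_argmax_last:
  assumes "y \<in> {a..b}" "last_argmax m < y" shows "B y - m * cdf y < conjugate m"
proof (rule ccontr)
  assume "\<not> ?thesis"
  then have "y \<in> argmaxes m"
    using assms conjugate_ge[of _ m] by (fastforce simp: argmaxes_def not_less)
  then have "y \<le> last_argmax m" unfolding last_argmax_def
    using argmaxes[of m] by (intro cSup_upper) (auto intro: bounded_imp_bdd_above compact_imp_bounded)
  with assms show False by simp
qed

text \<open>Revealed preference: if the order were reversed, the inequality at \<open>m\<close>
  would be strict because \<open>last_argmax m\<close> is the last maximiser, and adding the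
  inequality at \<open>m'\<close> would contradict monotonicity of \<open>cdf\<close>.\<close>

lemma last_argmax_antimono: "m \<le> m' \<Longrightarrow> last_argmax m' \<le> last_argmax m"
proof (rule ccontr)
  assume m: "m \<le> m'" and "\<not> last_argmax m' \<le> last_argmax m"
  then have less: "last_argmax m < last_argmax m'" by simp
  have "B (last_argmax m') - m * cdf (last_argmax m') < B (last_argmax m) - m * cdf (last_argmax m)"
    using last_argmax_last[OF _ less] last_argmax_range by (simp add: conjugate_def)
  moreover have "B (last_argmax m) - m' * cdf (last_argmax m) \<le> B (last_argmax m') - m' * cdf (last_argmax m')"
    using conjugate_ge[of "last_argmax m" m'] last_argmax_range by (simp add: conjugate_def)
  ultimately have "(m' - m) * (cdf (last_argmax m') - cdf (last_argmax m)) < 0"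
    by (simp add: algebra_simps)
  moreover have "0 \<le> (m' - m) * (cdf (last_argmax m') - cdf (last_argmax m))"
    using m less by (intro mult_nonneg_nonneg) (auto intro: cdf_mono)
  ultimately show False by simp
qed

lemma conjugate_lipschitz: "conjugate m \<le> conjugate m' + \<bar>m - m'\<bar>"
proof -
  let ?z = "last_argmax m"
  have "conjugate m = (B ?z - m' * cdf ?z) + (m' - m) * cdf ?z" by (simp add: conjugate_def algebra_simps)
  also have "\<dots> \<le> conjugate m' + \<bar>(m' - m) * cdf ?z\<bar>"
    using conjugate_ge[of ?z m'] last_argmax_range by (intro add_mono abs_ge_self) simp
  also have "\<bar>(m' - m) * cdf ?z\<bar> \<le> \<bar>m - m'\<bar> * 1" unfolding abs_mult
    using cdf_nonneg[of ?z] cdf_le_1[of ?z] by (intro mult_mono) auto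
  finally show ?thesis by simp
qed

text \<open>Each affine function in the family is at least \<open>B a\<close> at quantile 0 and at
  least \<open>B b\<close> at quantile 1, hence lies above the chord between these two
  values.\<close>

lemma bdd_below_majorant: "bdd_below (range (\<lambda>m. conjugate m + m * s))" if "0 \<le> s" "s \<le> 1" for s
proof (rule bdd_belowI2)
  fix m
  have "min (B a) (B b) \<le> (1 - s) * B a + s * B b"
  proof -
    have "(1 - s) * min (B a) (B b) + s * min (B a) (B b) \<le> (1 - s) * B a + s * B b"
      using that by (intro add_mono mult_left_mono) auto
    then show ?thesis by (simp add: algebra_simps)
  qed
  also have "\<dots> \<le> (1 - s) * (conjugate m) + s * (conjugate m + m)"
    using that conjugate_ge[of a m] conjugate_ge[of b m] a_le_b
    by (intro add_mono mult_left_mono) (auto simp: cdf_a cdf_b)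
  finally show "min (B a) (B b) \<le> conjugate m + m * s" by (simp add: algebra_simps)
qed

lemma majorant_le: "majorant c \<le> conjugate m + m * cdf c"
  unfolding majorant_def by (intro cINF_lower bdd_below_majorant cdf_nonneg cdf_le_1) auto

lemma majorant_ge: "c \<in> {a..b} \<Longrightarrow> B c \<le> majorant c"
  unfolding majorant_def using conjugate_ge[of c] by (intro cINF_greatest) (auto simp: algebra_simps)

lemma majorant_last_argmax: "majorant (last_argmax m) = B (last_argmax m)"
  using majorant_le[of "last_argmax m" m] majorant_ge[of "last_argmax m"] last_argmax_range[of m]
  by (simp add: conjugate_def)

lemma majorant_cong: "cdf c = cdf c' \<Longrightarrow> majorant c = majorant c'"
  by (simp add: majorant_def)

lemma majorant_concave:
  assumes "0 \<le> t" "t \<le> 1" "cdf c = (1 - t) * cdf c1 + t * cdf c2"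
  shows "(1 - t) * majorant c1 + t * majorant c2 \<le> majorant c"
  unfolding majorant_def[of c]
proof (rule cINF_greatest)
  fix m
  have "(1 - t) * majorant c1 + t * majorant c2 \<le> (1 - t) * (conjugate m + m * cdf c1) + t * (conjugate m + m * cdf c2)"
    using assms by (intro add_mono mult_left_mono majorant_le) auto
  also have "\<dots> = conjugate m + m * cdf c" unfolding assms(3) by (simp add: algebra_simps)
  finally show "(1 - t) * majorant c1 + t * majorant c2 \<le> conjugate m + m * cdf c" .
qed auto

text \<open>By concavity the majorant lies above its chords from \<open>c0\<close> to the quantiles
  0 and 1. \<open>K1\<close> and \<open>K2\<close> are the absolute slopes of these chords, set to 0
  if \<open>c0\<close> already sits at the end in question.\<close>

lemma majorant_lower_bound:
  obtains K where "0 \<le> K" "\<And>c. majorant c \<ge> majorant c0 - K * \<bar>cdf c - cdf c0\<bar>"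
proof -
  define K1 where "K1 = (if cdf c0 = 0 then 0 else \<bar>majorant c0 - majorant a\<bar> / cdf c0)"
  define K2 where "K2 = (if cdf c0 = 1 then 0 else \<bar>majorant c0 - majorant b\<bar> / (1 - cdf c0))"
  have K: "0 \<le> K1" "0 \<le> K2" using cdf_nonneg[of c0] cdf_le_1[of c0] by (auto simp: K1_def K2_def)
  have "majorant c \<ge> majorant c0 - (K1 + K2) * \<bar>cdf c - cdf c0\<bar>" for c
  proof (cases "cdf c = cdf c0")
    case True
    then show ?thesis using majorant_cong[OF True] by simp
  next
    case False
    then consider "cdf c < cdf c0" | "cdf c0 < cdf c" by linarith
    then show ?thesis
    proof cases
      case 1
      define t where "t = (cdf c0 - cdf c) / cdf c0"
      have pos: "0 < cdf c0" using 1 cdf_nonneg[of c] by linarith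
      have t: "0 \<le> t" "t \<le> 1" using 1 pos cdf_nonneg[of c] by (auto simp: t_def)
      have tc: "t * cdf c0 = cdf c0 - cdf c" using pos by (simp add: t_def)
      have "cdf c = (1 - t) * cdf c0 + t * cdf a" using tc by (simp add: cdf_a algebra_simps)
      from majorant_concave[OF t this] have "majorant c0 - t * (majorant c0 - majorant a) \<le> majorant c" by (simp add: algebra_simps)
      moreover have "t * (majorant c0 - majorant a) \<le> t * \<bar>majorant c0 - majorant a\<bar>" using t by (intro mult_left_mono) auto
      moreover have "t * \<bar>majorant c0 - majorant a\<bar> = K1 * \<bar>cdf c - cdf c0\<bar>" using pos 1 by (simp add: K1_def t_def)
      moreover have "0 \<le> K2 * \<bar>cdf c - cdf c0\<bar>" using K by simp
      ultimately show ?thesis by (simp add: algebra_simps)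
    next
      case 2
      define t where "t = (cdf c - cdf c0) / (1 - cdf c0)"
      have pos: "0 < 1 - cdf c0" using 2 cdf_le_1[of c] by linarith
      have t: "0 \<le> t" "t \<le> 1" using 2 pos cdf_le_1[of c] by (auto simp: t_def)
      have tc: "t * (1 - cdf c0) = cdf c - cdf c0" using pos by (simp add: t_def)
      have "cdf c = (1 - t) * cdf c0 + t * cdf b" using tc by (simp add: cdf_b algebra_simps)
      from majorant_concave[OF t this] have "majorant c0 - t * (majorant c0 - majorant b) \<le> majorant c" by (simp add: algebra_simps)
      moreover have "t * (majorant c0 - majorant b) \<le> t * \<bar>majorant c0 - majorant b\<bar>" using t by (intro mult_left_mono) auto
      moreover have "t * \<bar>majorant c0 - majorant b\<bar> = K2 * \<bar>cdf c - cdf c0\<bar>" using pos 2 by (simp add: K2_def t_def)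
      moreover have "0 \<le> K1 * \<bar>cdf c - cdf c0\<bar>" using K by simp
      ultimately show ?thesis by (simp add: algebra_simps)
    qed
  qed
  with K show ?thesis by (intro that[of "K1 + K2"]) auto
qed

text \<open>The chords give lower semicontinuity, including at quantiles 0 and 1; an infimum of
  continuous functions is upper semicontinuous anyway.\<close>

lemma continuous_majorant: "continuous_on A majorant"
proof (rule continuous_at_imp_continuous_on, intro ballI)
  fix c0
  have cdf_lim: "(cdf \<longlongrightarrow> cdf c0) (at c0)"
    using continuous_cdf[of UNIV] by (simp add: continuous_on_eq_continuous_at isCont_def)
  have "(majorant \<longlongrightarrow> majorant c0) (at c0)"
  proof (rule order_tendstoI)
    fix l assume l: "l < majorant c0"
    obtain K where K: "\<And>c. majorant c \<ge> majorant c0 - K * \<bar>cdf c - cdf c0\<bar>" using majorant_lower_bound[of c0] by metis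
    have "((\<lambda>c. majorant c0 - K * \<bar>cdf c - cdf c0\<bar>) \<longlongrightarrow> majorant c0 - K * \<bar>cdf c0 - cdf c0\<bar>) (at c0)"
      by (intro tendsto_intros cdf_lim)
    then have "\<forall>\<^sub>F c in at c0. l < majorant c0 - K * \<bar>cdf c - cdf c0\<bar>"
      using l by (intro order_tendstoD(1)) auto
    then show "\<forall>\<^sub>F c in at c0. l < majorant c" by eventually_elim (use K in \<open>auto intro: less_le_trans\<close>)
  next
    fix u assume "majorant c0 < u"
    then obtain m where m: "conjugate m + m * cdf c0 < u"
      unfolding majorant_def by (subst (asm) cINF_less_iff) (auto intro: bdd_below_majorant cdf_nonneg cdf_le_1)
    have "((\<lambda>c. conjugate m + m * cdf c) \<longlongrightarrow> conjugate m + m * cdf c0) (at c0)" by (intro tendsto_intros cdf_lim)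
    from order_tendstoD(2)[OF this m] show "\<forall>\<^sub>F c in at c0. majorant c < u"
      by eventually_elim (use majorant_le in \<open>auto intro: le_less_trans\<close>)
  qed
  then show "isCont majorant c0" by (simp add: isCont_def)
qed

lemma slopes_antimono: "c \<le> c' \<Longrightarrow> slopes c' \<subseteq> slopes c"
  by (auto simp: slopes_def)

lemma bounded_B: obtains K where "0 \<le> K" "\<And>c. c \<in> {a..b} \<Longrightarrow> \<bar>B c\<bar> \<le> K"
proof -
  have "bounded (B ` {a..b})" by (intro compact_imp_bounded compact_continuous_image cont_B) auto
  then obtain K where K: "\<forall>x\<in>B ` {a..b}. norm x \<le> K" unfolding bounded_iff by blast
  have "\<bar>B c\<bar> \<le> \<bar>K\<bar>" if "c \<in> {a..b}" for c
  proof -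
    have "\<bar>B c\<bar> \<le> K" using K that by (metis imageI real_norm_def)
    then show ?thesis by linarith
  qed
  then show ?thesis by (intro that[of "\<bar>K\<bar>"]) auto
qed

lemma slopes_ne_UNIV: "0 < cdf c \<Longrightarrow> slopes c \<noteq> UNIV"
proof -
  assume c: "0 < cdf c"
  obtain K where K: "0 \<le> K" "\<And>c. c \<in> {a..b} \<Longrightarrow> \<bar>B c\<bar> \<le> K" using bounded_B by blast
  \<comment> \<open>At this slope, reaching the quantile of \<open>c\<close> costs more than the
    \<open>2 * K\<close> by which \<open>B\<close> can vary, so every maximiser lies before
    \<open>c\<close>.\<close>
  define m where "m = (2 * K + 1) / cdf c"
  have m: "0 \<le> m" "m * cdf c = 2 * K + 1" using c K by (auto simp: m_def)
  have "\<not> c \<le> last_argmax m"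
  proof
    assume "c \<le> last_argmax m"
    then have "m * cdf c \<le> m * cdf (last_argmax m)" using m by (intro mult_left_mono cdf_mono) auto
    moreover have "B a \<le> B (last_argmax m) - m * cdf (last_argmax m)"
      using conjugate_ge[of a m] a_le_b by (simp add: cdf_a conjugate_def)
    moreover have "\<bar>B (last_argmax m)\<bar> \<le> K" "\<bar>B a\<bar> \<le> K" using K(2) last_argmax_range a_le_b by auto
    ultimately show False using m by linarith
  qed
  then show ?thesis by (auto simp: slopes_def)
qed

lemma slopes_nonempty: "cdf c < 1 \<Longrightarrow> slopes c \<noteq> {}"
proof -
  assume c: "cdf c < 1"
  obtain K where K: "0 \<le> K" "\<And>c. c \<in> {a..b} \<Longrightarrow> \<bar>B c\<bar> \<le> K" using bounded_B by blast
  define m where "m = (2 * K + 1) / (1 - cdf c)"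
  have m: "0 \<le> m" "m * (1 - cdf c) = 2 * K + 1" using c K by (auto simp: m_def)
  have "c \<le> last_argmax (- m)"
  proof (rule ccontr)
    assume "\<not> ?thesis"
    then have "m * cdf (last_argmax (- m)) \<le> m * cdf c" using m by (intro mult_left_mono cdf_mono) auto
    moreover have "B b + m \<le> B (last_argmax (- m)) + m * cdf (last_argmax (- m))"
      using conjugate_ge[of b "- m"] a_le_b by (simp add: cdf_b conjugate_def)
    moreover have "\<bar>B (last_argmax (- m))\<bar> \<le> K" "\<bar>B b\<bar> \<le> K" using K(2) last_argmax_range a_le_b by auto
    ultimately show False using m by (simp add: algebra_simps)
  qed
  then show ?thesis by (auto simp: slopes_def)
qed

lemma bdd_slopes: "slopes c \<noteq> UNIV \<Longrightarrow> bdd_above (slopes c)"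
proof -
  assume "slopes c \<noteq> UNIV"
  then obtain m where "m \<notin> slopes c" by blast
  then have m: "last_argmax m < c" by (simp add: slopes_def)
  have "m' \<le> m" if "m' \<in> slopes c" for m'
    using that m last_argmax_antimono[of m m'] by (force simp: slopes_def)
  then show "bdd_above (slopes c)" by (rule bdd_aboveI)
qed

lemma slope_antimono:
  assumes "c \<le> c'" "slopes c \<noteq> UNIV" "slopes c' \<noteq> {}" shows "slope c' \<le> slope c"
  unfolding slope_def using assms by (intro cSup_subset_mono bdd_slopes slopes_antimono)

text \<open>As a function of \<open>m\<close>, the affine value at \<open>cdf c\<close> falls along
  \<open>slopes c\<close> and rises beyond it, because the sign of its change is decided by whether
  \<open>last_argmax m\<close> lies beyond \<open>c\<close>. Its minimum is therefore at the
  supremum, which is approached by slopes within \<open>e / 2\<close>;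
  \<open>conjugate_lipschitz\<close> pays for the distance.\<close>

lemma majorant_slope:
  assumes "slopes c \<noteq> {}" "slopes c \<noteq> UNIV"
  shows "majorant c = conjugate (slope c) + slope c * cdf c"
proof (rule antisym[OF majorant_le])
  let ?b = "slope c" and ?s = "cdf c"
  have bdd: "bdd_above (slopes c)" by (rule bdd_slopes) fact
  have shift: "m * ?s \<le> m' * ?s + \<bar>m - m'\<bar>" for m m'
  proof -
    have "(m - m') * ?s \<le> \<bar>m - m'\<bar> * 1" using cdf_nonneg[of c] cdf_le_1[of c] by (intro mult_mono) auto
    then show ?thesis by (simp add: algebra_simps)
  qed
  show "conjugate ?b + ?b * ?s \<le> majorant c" unfolding majorant_def
  proof (rule cINF_greatest)
    fix m
    show "conjugate ?b + ?b * ?s \<le> conjugate m + m * ?s"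
    proof (rule field_le_epsilon)
      fix e :: real assume e: "0 < e"
      consider "m < ?b" | "m = ?b" | "?b < m" by linarith
      then have "\<exists>m'. \<bar>m' - ?b\<bar> \<le> e / 2 \<and> conjugate m' + m' * ?s \<le> conjugate m + m * ?s"
      proof cases
        case 1
        have "max m (?b - e / 2) < Sup (slopes c)" using 1 e by (simp add: slope_def)
        then obtain m' where m': "m' \<in> slopes c" "max m (?b - e / 2) < m'" using less_cSupE assms(1) by metis
        have "m' \<le> ?b" unfolding slope_def by (intro cSup_upper m' bdd)
        let ?z = "last_argmax m'"
        have "c \<le> ?z" using m' by (simp add: slopes_def)
        then have "(m' - m) * ?s \<le> (m' - m) * cdf ?z" using m' by (intro mult_left_mono cdf_mono) auto
        moreover have "B ?z - m * cdf ?z \<le> conjugate m" using last_argmax_range by (intro conjugate_ge) simp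
        ultimately have "conjugate m' + m' * ?s \<le> conjugate m + m * ?s" by (simp add: conjugate_def[of m'] algebra_simps)
        with m' \<open>m' \<le> ?b\<close> show ?thesis by (intro exI[of _ m']) auto
      next
        case 3
        define m' where "m' = min m (?b + e / 2)"
        have "m' > ?b" using 3 e by (simp add: m'_def)
        then have "m' \<notin> slopes c" using bdd cSup_upper[of m' "slopes c"] by (auto simp: slope_def)
        let ?z = "last_argmax m'"
        have "?z \<le> c" using \<open>m' \<notin> slopes c\<close> by (simp add: slopes_def)
        then have "(m - m') * cdf ?z \<le> (m - m') * ?s" by (intro mult_left_mono cdf_mono) (auto simp: m'_def)
        moreover have "B ?z - m * cdf ?z \<le> conjugate m" using last_argmax_range by (intro conjugate_ge) simp
        ultimately have "conjugate m' + m' * ?s \<le> conjugate m + m * ?s" by (simp add: conjugate_def[of m'] algebra_simps)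
        moreover have "m' \<le> ?b + e / 2" by (simp add: m'_def)
        ultimately show ?thesis using \<open>m' > ?b\<close> by (intro exI[of _ m']) (auto simp: abs_le_iff)
      qed (use e in \<open>auto intro!: exI[of _ m]\<close>)
      then obtain m' where m': "\<bar>m' - ?b\<bar> \<le> e / 2" "conjugate m' + m' * ?s \<le> conjugate m + m * ?s" by blast
      have "\<bar>?b - m'\<bar> \<le> e / 2" using m'(1) by linarith
      then show "conjugate ?b + ?b * ?s \<le> conjugate m + m * ?s + e"
        using conjugate_lipschitz[of ?b m'] shift[of ?b m'] m'(2) by linarith
    qed
  qed simp
qed

lemma majorant_subgradient:
  assumes "slopes c \<noteq> {}" "slopes c \<noteq> UNIV"
  shows "majorant c' - majorant c \<le> slope c * (cdf c' - cdf c)"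
  using majorant_slope[OF assms] majorant_le[of c' "slope c"] by (simp add: algebra_simps)

end

section \<open>Exchange of integrals and the layer-cake formula\<close>

lemma Fubini_weight:
  fixes f :: "'a \<Rightarrow> real" and r :: "'a \<Rightarrow> 'b \<Rightarrow> real"
  assumes "finite_measure M" "finite_measure N"
    and r [measurable]: "(\<lambda>(v, c). r v c) \<in> borel_measurable (M \<Otimes>\<^sub>M N)"
    and bound: "\<And>v c. v \<in> space M \<Longrightarrow> c \<in> space N \<Longrightarrow> \<bar>r v c\<bar> \<le> 1"
    and f: "integrable M f"
  shows "integrable (M \<Otimes>\<^sub>M N) (\<lambda>(v, c). r v c * f v)"
    and "(\<integral>v. (\<integral>c. r v c \<partial>N) * f v \<partial>M) = (\<integral>c. (\<integral>v. r v c * f v \<partial>M) \<partial>N)"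
    and "integrable N (\<lambda>c. \<integral>v. r v c * f v \<partial>M)"
proof -
  interpret M: finite_measure M by fact
  interpret N: finite_measure N by fact
  interpret P: pair_sigma_finite M N ..
  note f_meas [measurable] = borel_measurable_integrable[OF f]
  show int: "integrable (M \<Otimes>\<^sub>M N) (\<lambda>(v, c). r v c * f v)"
  proof (rule P.Fubini_integrable)
    have sect: "(\<lambda>c. r v c) \<in> borel_measurable N" if "v \<in> space M" for v
      using measurable_compose[OF measurable_Pair1'[OF that] r] by simp
    have sectionI: "integrable N (\<lambda>c. r v c)" if "v \<in> space M" for v
      using sect[OF that] bound[OF that] by (intro N.integrable_const_bound[where B=1]) auto
    show "AE v in M. integrable N (\<lambda>c. case (v, c) of (v, c) \<Rightarrow> r v c * f v)"
      using sectionI by auto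
    show "integrable M (\<lambda>v. \<integral>c. norm (case (v, c) of (v, c) \<Rightarrow> r v c * f v) \<partial>N)"
    \<comment> \<open>Only \<open>r\<close> is bounded, \<open>f\<close> need not be; hence a
      multiple of \<bar>\<open>f\<close>\<bar> and not a constant dominates.\<close>
    proof (rule Bochner_Integration.integrable_bound)
      show "integrable M (\<lambda>v. measure N (space N) * \<bar>f v\<bar>)" using f by simp
      show "AE v in M. norm (\<integral>c. norm (case (v, c) of (v, c) \<Rightarrow> r v c * f v) \<partial>N) \<le> norm (measure N (space N) * \<bar>f v\<bar>)"
      proof (rule AE_I2)
        fix v assume v: "v \<in> space M"
        have "(\<integral>c. norm (r v c * f v) \<partial>N) \<le> (\<integral>c. \<bar>f v\<bar> \<partial>N)"
          using sectionI[OF v] bound[OF v]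
          by (intro integral_mono) (auto simp: abs_mult intro!: mult_left_le_one_le)
        then show "norm (\<integral>c. norm (case (v, c) of (v, c) \<Rightarrow> r v c * f v) \<partial>N) \<le> norm (measure N (space N) * \<bar>f v\<bar>)"
          by simp
      qed
    qed measurable
  qed measurable
  show "(\<integral>v. (\<integral>c. r v c \<partial>N) * f v \<partial>M) = (\<integral>c. (\<integral>v. r v c * f v \<partial>M) \<partial>N)"
    using P.Fubini_integral[OF int] by simp
  show "integrable N (\<lambda>c. \<integral>v. r v c * f v \<partial>M)"
    using P.integrable_snd[OF int] by simp
qed

lemma integral_unit_of_bool_le:
  assumes "0 \<le> t" "t \<le> 1"
  shows "(\<integral>y. of_bool (y \<le> t) \<partial>restrict_space lborel {0..1}) = (t :: real)"
proof -
  interpret U: atomless_on "restrict_space lborel {0..1}" 0 1 by (rule atomless_on_lborel)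
  have "(\<integral>y. of_bool (y \<le> t) \<partial>restrict_space lborel {0..1}) = U.cdf t"
    unfolding U.cdf_eq by (intro Bochner_Integration.integral_cong) auto
  then show ?thesis using assms by (simp add: cdf_lborel)
qed

context atomless_on
begin

text \<open>The generalised inverse of an antitone \<open>q\<close>: the right end of its upper
  level set at height \<open>y\<close>. An empty level set gets the value \<open>a\<close>, which is
  harmless since \<open>{..a}\<close> is null.\<close>

definition threshold :: "(real \<Rightarrow> real) \<Rightarrow> real \<Rightarrow> real" where
  "threshold q y = Sup (insert a {c \<in> {a..b}. y \<le> q c})"

lemma threshold_ge: "c \<in> {a..b} \<Longrightarrow> y \<le> q c \<Longrightarrow> c \<le> threshold q y"
  unfolding threshold_def by (intro cSup_upper) (auto intro!: bdd_aboveI[of _ "max a b"])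

lemma threshold_range: "a \<le> b \<Longrightarrow> a \<le> threshold q y" "a \<le> b \<Longrightarrow> threshold q y \<le> b"
  unfolding threshold_def by (auto intro!: cSup_upper cSup_least bdd_aboveI[of _ "max a b"])

lemma less_thresholdD:
  assumes q: "\<And>x y. a \<le> x \<Longrightarrow> x \<le> y \<Longrightarrow> y \<le> b \<Longrightarrow> q y \<le> q x" and c: "a \<le> c" "c < threshold q y"
  shows "y \<le> q c"
proof -
  obtain c' where "c' \<in> insert a {c \<in> {a..b}. y \<le> q c}" "c < c'"
    using less_cSupE[OF c(2)[unfolded threshold_def]] by blast
  then show ?thesis using q[of c c'] c by auto
qed

lemma threshold_antimono: "y \<le> y' \<Longrightarrow> threshold q y' \<le> threshold q y"
  unfolding threshold_def by (intro cSup_subset_mono) (auto intro!: bdd_aboveI[of _ "max a b"])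

text \<open>\<open>q c\<close> is the measure of the levels below it, and since \<open>q\<close> is
  antitone each upper level set agrees with \<open>{..threshold q y}\<close> up to its end point. A
  linear functional of \<open>q\<close> thus becomes an average of its values at one-step
  profiles.\<close>

lemma layer_cake:
  assumes q: "\<And>x y. a \<le> x \<Longrightarrow> x \<le> y \<Longrightarrow> y \<le> b \<Longrightarrow> q y \<le> q x"
    and q01: "\<And>x. x \<in> {a..b} \<Longrightarrow> 0 \<le> q x \<and> q x \<le> 1"
    and f: "integrable M f"
  shows "(\<integral>c. q c * f c \<partial>M) = (\<integral>y. (\<integral>c. indicator {..threshold q y} c * f c \<partial>M) \<partial>restrict_space lborel {0..1})"
proof -
  let ?U = "restrict_space lborel {0..1 :: real}"
  interpret U: atomless_on ?U 0 1 by (rule atomless_on_lborel)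
  have [measurable]: "q \<in> borel_measurable M" by (rule measurable_antimono) (use q in auto)
  have [measurable]: "(\<lambda>y. y) \<in> borel_measurable ?U" by (intro U.borel_measurableI) simp
  have ind: "(\<integral>c. of_bool (y \<le> q c) * f c \<partial>M) = (\<integral>c. indicator {..threshold q y} c * f c \<partial>M)" for y
  proof (rule integral_cong_AE)
    show "AE c in M. of_bool (y \<le> q c) * f c = indicator {..threshold q y} c * f c"
      using AE_neq[of "threshold q y"] AE_space
    proof eventually_elim
      case (elim c)
      then consider "c < threshold q y" | "threshold q y < c" by linarith
      then show ?case using elim threshold_ge[of c y q] less_thresholdD[of q c y] q
        by cases (auto simp: space_M)
    qed
    show "(\<lambda>c. of_bool (y \<le> q c) * f c) \<in> borel_measurable M"
      using borel_measurable_integrable[OF f] by measurable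
  qed (use f in auto)
  have "(\<integral>c. q c * f c \<partial>M) = (\<integral>c. (\<integral>y. of_bool (y \<le> q c) \<partial>?U) * f c \<partial>M)"
    using q01 by (intro Bochner_Integration.integral_cong) (auto simp: space_M integral_unit_of_bool_le)
  also have "\<dots> = (\<integral>y. (\<integral>c. of_bool (y \<le> q c) * f c \<partial>M) \<partial>?U)"
    by (intro Fubini_weight f) (auto intro: finite_measure_axioms U.finite_measure_axioms)
  also have "\<dots> = (\<integral>y. (\<integral>c. indicator {..threshold q y} c * f c \<partial>M) \<partial>?U)"
    unfolding ind ..
  finally show ?thesis .
qed

text \<open>Monotone convergence on growing sets. It is made for the density of the majorant, which
  can be unbounded near the quantiles 0 and 1.\<close>

lemma integrable_exhaust:
  assumes A: "incseq A" "\<And>n. A n \<in> sets borel" and g: "g \<in> borel_measurable M"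
    and int: "\<And>n. integrable M (\<lambda>x. indicator (A n) x * g x)"
    and nonneg: "\<And>n x. x \<in> A n \<Longrightarrow> 0 \<le> (g x :: real)"
    and bound: "\<And>n. (\<integral>x. indicator (A n) x * g x \<partial>M) \<le> K"
  shows "integrable M (\<lambda>x. indicator (\<Union>n. A n) x * g x)"
proof -
  let ?I = "\<lambda>n. \<integral>x. indicator (A n) x * g x \<partial>M"
  have mono: "mono (\<lambda>n. indicator (A n) x * g x)" for x
  proof (rule monoI)
    fix n n' :: nat assume "n \<le> n'"
    then have "A n \<subseteq> A n'" using A(1) by (rule incseqD[rotated])
    then show "indicator (A n) x * g x \<le> indicator (A n') x * g x"
      using nonneg[of x n'] by (auto split: split_indicator)
  qed
  have "incseq ?I" by (intro monoI integral_mono int) (use mono in \<open>auto simp: mono_def\<close>)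
  then obtain L where L: "?I \<longlonglongrightarrow> L" using incseq_convergent[of ?I K] bound by blast
  show ?thesis
  proof (rule integrable_monotone_convergence[OF int _ _ L])
    show "AE x in M. (\<lambda>n. indicator (A n) x * g x) \<longlonglongrightarrow> indicator (\<Union>n. A n) x * g x"
      using A(1) by (intro AE_I2 tendsto_mult LIMSEQ_indicator_incseq tendsto_const)
    show "(\<lambda>x. indicator (\<Union>n. A n) x * g x) \<in> borel_measurable M"
      using A(2) by (intro borel_measurable_times g borel_measurableI borel_measurable_indicator) auto
  qed (use mono in auto)
qed

end

section \<open>The majorant as the integral of its slope\<close>

context ironing
begin

text \<open>At quantiles 0 and 1 the set \<open>slopes c\<close> can be empty or all of the reals,
  where its \<open>Sup\<close> is meaningless. The value 0 there concerns a null set only.\<close>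

definition density :: "real \<Rightarrow> real" where
  "density c = (if 0 < cdf c \<and> cdf c < 1 then slope c else 0)"

lemma density_antimono:
  assumes "c \<le> c'" "0 < cdf c" "cdf c' < 1" shows "density c' \<le> density c"
  using assms cdf_mono[OF assms(1)] slope_antimono[OF assms(1)] slopes_ne_UNIV[of c] slopes_nonempty[of c']
  by (auto simp: density_def)

lemma density_subgradient:
  "0 < cdf c \<Longrightarrow> cdf c < 1 \<Longrightarrow> majorant c' - majorant c \<le> density c * (cdf c' - cdf c)"
  using majorant_subgradient slopes_ne_UNIV slopes_nonempty by (auto simp: density_def)

lemma density_measurable [measurable]: "density \<in> borel_measurable borel"
proof -
  let ?A = "{c. 0 < cdf c \<and> cdf c < 1}"
  have [measurable]: "cdf \<in> borel_measurable borel"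
    by (rule borel_measurable_continuous_onI) (rule continuous_cdf)
  have "(\<lambda>c. - density c) \<in> borel_measurable borel"
  proof (rule borel_measurable_piecewise_mono[of "{?A, - ?A}"])
    show "mono_on C (\<lambda>c. - density c)" if "C \<in> {?A, - ?A}" for C
    proof (cases "C = ?A")
      case True
      then show ?thesis by (auto intro!: mono_onI density_antimono)
    next
      case False
      then show ?thesis using that by (auto intro!: mono_onI simp: density_def)
    qed
  qed auto
  then show ?thesis using borel_measurable_uminus[of "\<lambda>c. - density c"] by simp
qed

lemma majorant_diff:
  assumes "u \<le> z" "a \<le> u" "z \<le> b" "0 < cdf u" "cdf z < 1"
  shows "integrable M (\<lambda>c. indicator {u<..z} c * density c)"
    "majorant z - majorant u = (\<integral>c. indicator {u<..z} c * density c \<partial>M)"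
proof -
  have in': "0 < cdf v \<and> cdf v < 1" if "u \<le> v" "v \<le> z" for v
    using cdf_mono[OF that(1)] cdf_mono[OF that(2)] assms by linarith
  show "integrable M (\<lambda>c. indicator {u<..z} c * density c)"
  proof (rule integrable_bounded[where B="\<bar>density u\<bar> + \<bar>density z\<bar>"])
    show "(\<lambda>c. indicator {u<..z} c * density c) \<in> borel_measurable M"
      by (intro borel_measurableI) measurable
    fix c
    show "\<bar>indicator {u<..z} c * density c\<bar> \<le> \<bar>density u\<bar> + \<bar>density z\<bar>"
    proof (cases "c \<in> {u<..z}")
      case True
      then have "density z \<le> density c" "density c \<le> density u"
        using in'[of c] in'[of z] in'[of u] assms by (auto intro!: density_antimono)
      then show ?thesis using True by simp
    qed simp
  qed
  \<comment> \<open>The signs are reversed because \<open>subgradient_integral\<close> expects a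
    nondecreasing integrand.\<close>
  have "(- majorant z) - (- majorant u) = (\<integral>c. indicator {u<..z} c * (- density c) \<partial>M)"
  proof (rule subgradient_integral)
    show "mono_on {u..z} (\<lambda>c. - density c)"
      by (intro mono_onI) (use in' density_antimono in auto)
    fix v w assume vw: "u \<le> v" "v \<le> w" "w \<le> z"
    show "- density v * (cdf w - cdf v) \<le> - majorant w - - majorant v"
      using density_subgradient[of v w] in'[of v] vw by simp
    show "- majorant w - - majorant v \<le> - density w * (cdf w - cdf v)"
      using density_subgradient[of w v] in'[of w] vw by (simp add: algebra_simps)
  qed (use assms in auto)
  then show "majorant z - majorant u = (\<integral>c. indicator {u<..z} c * density c \<partial>M)" by simp
qed

lemma bounded_majorant: obtains K where "\<And>c. c \<in> {a..b} \<Longrightarrow> \<bar>majorant c\<bar> \<le> K"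
proof -
  have "bounded (majorant ` {a..b})"
    by (intro compact_imp_bounded compact_continuous_image continuous_majorant) auto
  then obtain K where K: "\<forall>x\<in>majorant ` {a..b}. norm x \<le> K" unfolding bounded_iff by blast
  then show ?thesis by (intro that[of K]) auto
qed

lemma interior_interval:
  obtains l h where "a \<le> l" "l < h" "h \<le> b" "cdf l = 0" "cdf h = 1"
    "\<And>x. l < x \<Longrightarrow> x < h \<Longrightarrow> 0 < cdf x \<and> cdf x < 1"
proof -
  obtain l where l: "a \<le> l" "l \<le> b" "cdf l = 0" "\<And>x. x \<in> {a..b} \<Longrightarrow> l < x \<Longrightarrow> 0 < cdf x"
    using cdf_level[of 0] by (metis order_trans zero_le_one order_refl)
  obtain h where h: "a \<le> h" "h \<le> b" "cdf h = 1" "\<And>x. x \<in> {a..b} \<Longrightarrow> x < h \<Longrightarrow> cdf x < 1"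
    using cdf_level[of 1] by (metis order_trans zero_le_one order_refl)
  have "l < h" using l(3) h(3) cdf_mono[of h l] by (cases "l < h") auto
  then show ?thesis using l h by (intro that[of l h]) auto
qed

text \<open>Relative to its value at an interior point \<open>mid\<close>, the density has one sign
  on either side. On intervals kept away from the ends by \<open>e n\<close> its integral is a
  difference of values of the bounded majorant, so exhaustion applies to each side.\<close>

lemma integrable_density: "integrable M density"
proof -
  obtain l h where lh: "a \<le> l" "l < h" "h \<le> b" "cdf l = 0" "cdf h = 1"
    "\<And>x. l < x \<Longrightarrow> x < h \<Longrightarrow> 0 < cdf x \<and> cdf x < 1" using interior_interval by blast
  obtain K where K: "\<And>c. c \<in> {a..b} \<Longrightarrow> \<bar>majorant c\<bar> \<le> K" using bounded_majorant by blast
  define mid where "mid = (l + h) / 2"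
  define e where "e n = (h - l) / (2 * real (Suc n))" for n
  have mid: "l < mid" "mid < h" using lh by (auto simp: mid_def)
  have e: "0 < e n" "e n \<le> mid - l" "e n \<le> h - mid" for n
  proof -
    show "0 < e n" using lh by (simp add: e_def)
    have "e n \<le> (h - l) / 2" unfolding e_def using lh by (intro divide_left_mono) auto
    then show "e n \<le> mid - l" "e n \<le> h - mid" by (auto simp: mid_def field_simps)
  qed
  have e_mono: "e n' \<le> e n" if "n \<le> n'" for n n'
    unfolding e_def using lh that by (intro divide_left_mono) auto
  have e_small: "\<exists>n. e n < d" if "0 < d" for d
  proof -
    obtain n where n: "(h - l) / (2 * d) < real n" using reals_Archimedean2 by blast
    have "(h - l) < 2 * d * real n" using n that by (simp add: field_simps)
    also have "\<dots> \<le> d * (2 * real (Suc n))" using that by (simp add: field_simps)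
    finally have "e n < d" by (simp add: e_def pos_divide_less_eq del: of_nat_Suc)
    then show ?thesis ..
  qed
  let ?d = "density mid"
  have cdf_diff: "(\<integral>c. indicator {u<..z} c \<partial>M) = cdf z - cdf u" if "u \<le> z" for u z
    unfolding cdf_eq using integral_Ioc[of "\<lambda>_. 1", OF integrable_const' that] by simp
  have low: "integrable M (\<lambda>c. indicator (\<Union>n. {l + e n<..mid}) c * (density c - ?d))"
  proof (rule integrable_exhaust[where K="2 * K + \<bar>?d\<bar>"])
    fix n
    have le: "l + e n \<le> mid" using e[of n] by simp
    have pos: "0 < cdf (l + e n)" "cdf mid < 1" using lh(6) e[of n] mid by auto
    note D = majorant_diff[OF le _ _ pos]
    have A: "integrable M (\<lambda>c. indicator {l + e n<..mid} c * density c)"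
      using lh e[of n] mid by (intro D) auto
    have B: "integrable M (\<lambda>c. indicator {l + e n<..mid} c * ?d)" by (intro integrable_indicator_mult) auto
    have eq: "(\<lambda>c. indicator {l + e n<..mid} c * (density c - ?d))
        = (\<lambda>c. indicator {l + e n<..mid} c * density c - indicator {l + e n<..mid} c * ?d)"
      by (simp add: algebra_simps)
    show "integrable M (\<lambda>c. indicator {l + e n<..mid} c * (density c - ?d))" unfolding eq using A B by simp
    have "(\<integral>c. indicator {l + e n<..mid} c * (density c - ?d) \<partial>M)
      = majorant mid - majorant (l + e n) - (cdf mid - cdf (l + e n)) * ?d"
      unfolding eq using A B D(2) lh e[of n] mid cdf_diff[OF le] by simp
    also have "\<dots> \<le> K + K + 1 * \<bar>?d\<bar>"
    proof -
      have "\<bar>(cdf mid - cdf (l + e n)) * ?d\<bar> \<le> 1 * \<bar>?d\<bar>" unfolding abs_mult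
        using cdf_nonneg[of "l + e n"] cdf_nonneg[of mid] cdf_le_1[of "l + e n"] cdf_le_1[of mid] by (intro mult_right_mono) auto
      moreover have "\<bar>majorant mid\<bar> \<le> K" "\<bar>majorant (l + e n)\<bar> \<le> K" using lh e[of n] mid by (auto intro!: K)
      ultimately show ?thesis by linarith
    qed
    finally show "(\<integral>c. indicator {l + e n<..mid} c * (density c - ?d) \<partial>M) \<le> 2 * K + \<bar>?d\<bar>" by simp
    fix c assume "c \<in> {l + e n<..mid}"
    then show "0 \<le> density c - ?d" using lh(6)[of c] lh(6)[of mid] e[of n] mid density_antimono[of c mid] by auto
  next
    show "incseq (\<lambda>n. {l + e n<..mid})" using e_mono by (force simp: incseq_def)
  qed (auto intro: borel_measurableI)
  have high: "integrable M (\<lambda>c. indicator (\<Union>n. {mid<..h - e n}) c * (?d - density c))"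
  proof (rule integrable_exhaust[where K="2 * K + \<bar>?d\<bar>"])
    fix n
    have le: "mid \<le> h - e n" using e[of n] by simp
    have pos: "0 < cdf mid" "cdf (h - e n) < 1" using lh(6) e[of n] mid by auto
    note D = majorant_diff[OF le _ _ pos]
    have A: "integrable M (\<lambda>c. indicator {mid<..h - e n} c * density c)"
      using lh e[of n] mid by (intro D) auto
    have B: "integrable M (\<lambda>c. indicator {mid<..h - e n} c * ?d)" by (intro integrable_indicator_mult) auto
    have eq: "(\<lambda>c. indicator {mid<..h - e n} c * (?d - density c))
        = (\<lambda>c. indicator {mid<..h - e n} c * ?d - indicator {mid<..h - e n} c * density c)"
      by (simp add: algebra_simps)
    show "integrable M (\<lambda>c. indicator {mid<..h - e n} c * (?d - density c))" unfolding eq using A B by simp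
    have "(\<integral>c. indicator {mid<..h - e n} c * (?d - density c) \<partial>M)
      = (cdf (h - e n) - cdf mid) * ?d - (majorant (h - e n) - majorant mid)"
      unfolding eq using A B D(2) lh e[of n] mid cdf_diff[OF le] by simp
    also have "\<dots> \<le> 1 * \<bar>?d\<bar> + K + K"
    proof -
      have "\<bar>(cdf (h - e n) - cdf mid) * ?d\<bar> \<le> 1 * \<bar>?d\<bar>" unfolding abs_mult
        using cdf_nonneg[of "h - e n"] cdf_nonneg[of mid] cdf_le_1[of "h - e n"] cdf_le_1[of mid] by (intro mult_right_mono) auto
      moreover have "\<bar>majorant mid\<bar> \<le> K" "\<bar>majorant (h - e n)\<bar> \<le> K" using lh e[of n] mid by (auto intro!: K)
      ultimately show ?thesis by linarith
    qed
    finally show "(\<integral>c. indicator {mid<..h - e n} c * (?d - density c) \<partial>M) \<le> 2 * K + \<bar>?d\<bar>" by simp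
    fix c assume "c \<in> {mid<..h - e n}"
    then show "0 \<le> ?d - density c" using lh(6)[of c] lh(6)[of mid] e[of n] mid density_antimono[of mid c] by auto
  next
    show "incseq (\<lambda>n. {mid<..h - e n})" using e_mono by (force simp: incseq_def)
  qed (auto intro: borel_measurableI)
  have "integrable M (\<lambda>c. ?d + indicator (\<Union>n. {l + e n<..mid}) c * (density c - ?d)
      - indicator (\<Union>n. {mid<..h - e n}) c * (?d - density c))"
    by (intro Bochner_Integration.integrable_diff Bochner_Integration.integrable_add low high) simp
  moreover have "AE c in M. ?d + indicator (\<Union>n. {l + e n<..mid}) c * (density c - ?d)
      - indicator (\<Union>n. {mid<..h - e n}) c * (?d - density c) = density c"
    using AE_cdf_interior
  proof eventually_elim
    case (elim c)
    have "l < c" using elim cdf_mono[of c l] lh by (cases "l < c") auto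
    have "c < h" using elim cdf_mono[of h c] lh by (cases "c < h") auto
    show ?case
    proof (cases "c \<le> mid")
      case True
      obtain n where "e n < c - l" using e_small[of "c - l"] \<open>l < c\<close> by auto
      then have "c \<in> (\<Union>n. {l + e n<..mid})" using True by (auto intro!: exI[of _ n])
      moreover have "c \<notin> (\<Union>n. {mid<..h - e n})" using True by auto
      ultimately show ?thesis by simp
    next
      case False
      obtain n where "e n < h - c" using e_small[of "h - c"] \<open>c < h\<close> by auto
      then have "c \<in> (\<Union>n. {mid<..h - e n})" using False by (auto intro!: exI[of _ n])
      moreover have "c \<notin> (\<Union>n. {l + e n<..mid})" using False by auto
      ultimately show ?thesis by simp
    qed
  qed
  ultimately show ?thesis
    by (subst integrable_cong_AE[symmetric]) (auto intro: borel_measurableI)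
qed

text \<open>The difference \<open>D\<close> is constant on the open interval of interior quantiles
  and, by continuity, on its closure. Outside, \<open>cdf\<close> is 0 or 1, so the density has its
  default value and the majorant does not move.\<close>

lemma majorant_integral:
  assumes z: "z \<in> {a..b}"
  shows "majorant z = majorant a + (\<integral>c. indicator {..z} c * density c \<partial>M)"
proof -
  obtain l h where lh: "a \<le> l" "l < h" "h \<le> b" "cdf l = 0" "cdf h = 1"
    "\<And>x. l < x \<Longrightarrow> x < h \<Longrightarrow> 0 < cdf x \<and> cdf x < 1" using interior_interval by blast
  define D where "D z = majorant z - (\<integral>c. indicator {..z} c * density c \<partial>M)" for z
  have cont: "continuous_on A D" for A unfolding D_def
    by (intro continuous_intros continuous_majorant)
      (rule continuous_on_subset[OF continuous_integral_atMost[OF integrable_density]], simp)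
  have D_eq: "D z = D u" if "l < u" "u \<le> z" "z < h" for u z
    using majorant_diff[of u z] lh that integral_Ioc[OF integrable_density that(2)]
    by (auto simp: D_def algebra_simps)
  let ?m = "(l + h) / 2"
  have D_mid: "D z = D ?m" if "z \<in> {l<..<h}" for z
  proof (cases "z \<le> ?m")
    case True
    then show ?thesis using that lh by (intro D_eq[symmetric]) auto
  next
    case False
    then show ?thesis using that lh by (intro D_eq) auto
  qed
  have cl: "closure {l<..<h} = {l..h}" using lh by simp
  have D_cl: "D z = D ?m" if "z \<in> {l..h}" for z
  proof (rule continuous_constant_on_closure[of "{l<..<h}" D "D ?m"])
    show "continuous_on (closure {l<..<h}) D" by (rule cont)
    show "D x = D ?m" if "x \<in> {l<..<h}" for x by (rule D_mid) (rule that)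
    show "z \<in> closure {l<..<h}" unfolding cl by (rule that)
  qed
  have zero: "D z = majorant a" if "z \<in> {a..l}" for z
  proof -
    have cdf0: "cdf x = 0" if "x \<le> z" for x
    proof -
      have "cdf x \<le> cdf l" using that \<open>z \<in> {a..l}\<close> by (intro cdf_mono) auto
      then show ?thesis using cdf_nonneg[of x] lh(4) by simp
    qed
    then have "(\<lambda>x. indicator {..z} x * density x) = (\<lambda>_. 0)"
      by (auto simp: fun_eq_iff density_def split: split_indicator)
    moreover have "majorant z = majorant a"
      by (rule majorant_cong) (simp add: cdf0 cdf_a)
    ultimately show ?thesis by (simp add: D_def)
  qed
  have upper: "D z = D h" if "z \<in> {h..b}" for z
  proof -
    have cdf1: "cdf x = 1" if "h \<le> x" for x
      using cdf_mono[OF that] cdf_le_1[of x] lh(5) by simp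
    then have "(\<lambda>x. indicator {..z} x * density x) = (\<lambda>x. indicator {..h} x * density x)"
      using that by (auto simp: fun_eq_iff density_def split: split_indicator)
    moreover have "majorant z = majorant h"
      by (rule majorant_cong) (use that in \<open>simp add: cdf1\<close>)
    ultimately show ?thesis by (simp add: D_def)
  qed
  have "D z = majorant a"
  proof -
    consider "z \<in> {a..l}" | "z \<in> {l..h}" | "z \<in> {h..b}" using z by fastforce
    then show ?thesis
      using zero[of z] zero[of l] D_cl[of z] D_cl[of l] D_cl[of h] upper[of z] lh by cases auto
  qed
  then show ?thesis by (simp add: D_def)
qed

end


section \<open>Cutoff rules and linear objectives\<close>

locale bilateral_trade =
  GB: atomless_prob_on GB vl vh + GS: atomless_prob_on GS cl ch
  for GB GS :: "real measure" and vl vh cl ch :: real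
begin

abbreviation LB where "LB \<equiv> restrict_space lborel {vl..vh}"
abbreviation LS where "LS \<equiv> restrict_space lborel {cl..ch}"

sublocale LB: atomless_on LB vl vh by (rule atomless_on_lborel)
sublocale LS: atomless_on LS cl ch by (rule atomless_on_lborel)

text \<open>Rents are Lebesgue integrals of trade probabilities while values enter through the
  distributions, and neither measure dominates the other: hence two weights per side.\<close>

definition buyer_int :: "(real \<Rightarrow> real) \<Rightarrow> (real \<Rightarrow> real) \<Rightarrow> (real \<Rightarrow> real) \<Rightarrow> real" where
  "buyer_int f1 f2 x = (\<integral>v. x v * f1 v \<partial>LB) + (\<integral>v. x v * f2 v \<partial>GB)"

definition seller_int :: "(real \<Rightarrow> real) \<Rightarrow> (real \<Rightarrow> real) \<Rightarrow> (real \<Rightarrow> real) \<Rightarrow> real" where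
  "seller_int g1 g2 q = (\<integral>c. q c * g1 c \<partial>LS) + (\<integral>c. q c * g2 c \<partial>GS)"

definition buyer_rev :: "(real \<Rightarrow> real) \<Rightarrow> (real \<Rightarrow> real) \<Rightarrow> real \<Rightarrow> real" where
  "buyer_rev f1 f2 w = buyer_int f1 f2 (indicator {w..})"

definition seller_rev :: "(real \<Rightarrow> real) \<Rightarrow> (real \<Rightarrow> real) \<Rightarrow> real \<Rightarrow> real" where
  "seller_rev g1 g2 z = seller_int g1 g2 (indicator {..z})"

text \<open>A bounded range keeps the set sequentially compact. The cutoff \<open>vh\<close> means
  no trade up to a null set of values, since \<open>GB.sdf vh = 0\<close>.\<close>

definition cutoffs :: "(real \<Rightarrow> real) set" where
  "cutoffs = {\<phi>. mono_on {cl..ch} \<phi> \<and> (\<forall>c\<in>{cl..ch}. \<phi> c \<in> {vl..vh})}"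

text \<open>The linear objective of a deterministic cutoff rule with its buyer part collected cost
  by cost; \<open>lottery_payoff\<close> shows the agreement with \<open>buyer_int\<close> of the
  interim probability.\<close>

definition payoff :: "(real \<Rightarrow> real) \<Rightarrow> (real \<Rightarrow> real) \<Rightarrow> (real \<Rightarrow> real) \<Rightarrow> (real \<Rightarrow> real) \<Rightarrow> (real \<Rightarrow> real) \<Rightarrow> real" where
  "payoff f1 f2 g1 g2 \<phi> = (\<integral>c. buyer_rev f1 f2 (\<phi> c) \<partial>GS) + seller_int g1 g2 (\<lambda>c. GB.sdf (\<phi> c))"

definition buyer_prob :: "(real \<Rightarrow> real \<Rightarrow> real) \<Rightarrow> real \<Rightarrow> real" where
  "buyer_prob p v = (\<integral>c. p v c \<partial>GS)"

definition seller_prob :: "(real \<Rightarrow> real \<Rightarrow> real) \<Rightarrow> real \<Rightarrow> real" where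
  "seller_prob p c = (\<integral>v. p v c \<partial>GB)"

text \<open>What incentive compatibility demands of \<open>p\<close> alone. Participation enters
  separately, through the sign of \<open>surplus\<close>.\<close>

definition implementable :: "(real \<Rightarrow> real \<Rightarrow> real) \<Rightarrow> bool" where
  "implementable p \<longleftrightarrow> (\<lambda>(v, c). p v c) \<in> borel_measurable (GB \<Otimes>\<^sub>M GS) \<and>
     (\<forall>v\<in>{vl..vh}. \<forall>c\<in>{cl..ch}. 0 \<le> p v c \<and> p v c \<le> 1) \<and>
     mono_on {vl..vh} (buyer_prob p) \<and>
     (\<forall>c\<in>{cl..ch}. \<forall>c'\<in>{cl..ch}. c \<le> c' \<longrightarrow> seller_prob p c' \<le> seller_prob p c)"

lemma cutoffsD:
  assumes "\<phi> \<in> cutoffs"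
  shows "mono_on {cl..ch} \<phi>" "\<And>c. c \<in> {cl..ch} \<Longrightarrow> vl \<le> \<phi> c \<and> \<phi> c \<le> vh"
    "\<phi> \<in> borel_measurable GS" "\<phi> \<in> borel_measurable LS"
  using assms GS.measurable_mono LS.measurable_mono by (auto simp: cutoffs_def)

lemma sdf_le_1: "GB.sdf w \<le> 1"
  using GB.sdf_conv_cdf GB.cdf_nonneg by simp

lemma sdf_vl: "GB.sdf vl = 1" and sdf_vh: "GB.sdf vh = 0"
  using GB.sdf_conv_cdf GB.cdf_a GB.cdf_b by simp_all

lemma measurable_compose_sdf:
  "\<phi> \<in> borel_measurable M \<Longrightarrow> (\<lambda>c. GB.sdf (\<phi> c)) \<in> borel_measurable M"
  using measurable_compose[OF _ borel_measurable_continuous_onI[OF GB.continuous_sdf]] .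

lemma implementableD:
  assumes "implementable p"
  shows "(\<lambda>(v, c). p v c) \<in> borel_measurable (GB \<Otimes>\<^sub>M GS)"
    "\<And>v c. v \<in> {vl..vh} \<Longrightarrow> c \<in> {cl..ch} \<Longrightarrow> 0 \<le> p v c \<and> p v c \<le> 1"
    "mono_on {vl..vh} (buyer_prob p)"
    "\<And>c c'. cl \<le> c \<Longrightarrow> c \<le> c' \<Longrightarrow> c' \<le> ch \<Longrightarrow> seller_prob p c' \<le> seller_prob p c"
  using assms by (auto simp: implementable_def)

lemma section_GS:
  assumes "(\<lambda>(v, c). p v c) \<in> borel_measurable (GB \<Otimes>\<^sub>M GS)"
    and "\<And>v c. v \<in> {vl..vh} \<Longrightarrow> c \<in> {cl..ch} \<Longrightarrow> 0 \<le> p v c \<and> p v c \<le> (1 :: real)"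
    and "v \<in> {vl..vh}"
  shows "integrable GS (p v)" "0 \<le> buyer_prob p v" "buyer_prob p v \<le> 1"
proof -
  have "v \<in> space GB" using assms by (simp add: GB.space_M)
  from measurable_compose[OF measurable_Pair1'[OF this] assms(1)]
  show int: "integrable GS (p v)" using assms by (intro GS.integrable_bounded[where B=1]) auto
  show "0 \<le> buyer_prob p v" unfolding buyer_prob_def
    using assms by (intro integral_nonneg_AE AE_I2) (auto simp: GS.space_M)
  have "buyer_prob p v \<le> (\<integral>c. 1 \<partial>GS)" unfolding buyer_prob_def
    using assms int by (intro integral_mono) (auto simp: GS.space_M)
  then show "buyer_prob p v \<le> 1" by (simp add: GS.prob_space)
qed

lemma section_GB:
  assumes "(\<lambda>(v, c). p v c) \<in> borel_measurable (GB \<Otimes>\<^sub>M GS)"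
    and "\<And>v c. v \<in> {vl..vh} \<Longrightarrow> c \<in> {cl..ch} \<Longrightarrow> 0 \<le> p v c \<and> p v c \<le> (1 :: real)"
    and "c \<in> {cl..ch}"
  shows "integrable GB (\<lambda>v. p v c)" "0 \<le> seller_prob p c" "seller_prob p c \<le> 1"
proof -
  have "c \<in> space GS" using assms by (simp add: GS.space_M)
  from measurable_compose[OF measurable_Pair2'[OF this] assms(1)]
  show int: "integrable GB (\<lambda>v. p v c)" using assms by (intro GB.integrable_bounded[where B=1]) auto
  show "0 \<le> seller_prob p c" unfolding seller_prob_def
    using assms by (intro integral_nonneg_AE AE_I2) (auto simp: GB.space_M)
  have "seller_prob p c \<le> (\<integral>v. 1 \<partial>GB)" unfolding seller_prob_def
    using assms int by (intro integral_mono) (auto simp: GB.space_M)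
  then show "seller_prob p c \<le> 1" by (simp add: GB.prob_space)
qed

end

locale trade_objective = bilateral_trade +
  fixes f1 f2 g1 g2 :: "real \<Rightarrow> real"
  assumes f1: "integrable LB f1" and f2: "integrable GB f2"
    and g1: "integrable LS g1" and g2: "integrable GS g2"
begin

lemma continuous_buyer_rev: "continuous_on A (buyer_rev f1 f2)"
  unfolding buyer_rev_def buyer_int_def
  by (rule continuous_on_subset[of UNIV])
    (intro continuous_on_add LB.continuous_integral_atLeast GB.continuous_integral_atLeast f1 f2, simp)

lemma continuous_seller_rev: "continuous_on A (seller_rev g1 g2)"
  unfolding seller_rev_def seller_int_def
  by (rule continuous_on_subset[of UNIV])
    (intro continuous_on_add LS.continuous_integral_atMost GS.continuous_integral_atMost g1 g2, simp)

sublocale buyer: ironing GB vl vh "buyer_rev f1 f2"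
  by unfold_locales (rule continuous_buyer_rev)

sublocale seller: ironing GS cl ch "seller_rev g1 g2"
  by unfold_locales (rule continuous_seller_rev)

definition gap :: "real \<Rightarrow> real" where "gap z = seller.majorant z - seller_rev g1 g2 z"

text \<open>The maximum over cutoffs \<open>w\<close> of
  \<open>buyer_rev f1 f2 w + GB.sdf w * seller.density c\<close>; the second summand comes from
  \<open>GB.sdf = 1 - GB.cdf\<close>.\<close>

definition pointwise_max :: "real \<Rightarrow> real" where
  "pointwise_max c = buyer.conjugate (seller.density c) + seller.density c"

text \<open>\<open>seller.majorant cl\<close> need not vanish: if the support starts above
  \<open>cl\<close>, the Lebesgue part can make \<open>seller_rev\<close> positive at points that
  still have quantile 0.\<close>

definition bound :: real where
  "bound = seller.majorant cl + (\<integral>c. pointwise_max c \<partial>GS)"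

definition slack :: "(real \<Rightarrow> real) \<Rightarrow> real \<Rightarrow> real" where
  "slack \<phi> c = pointwise_max c - (buyer_rev f1 f2 (\<phi> c) + GB.sdf (\<phi> c) * seller.density c)"

lemma gap_nonneg: "z \<in> {cl..ch} \<Longrightarrow> 0 \<le> gap z"
  by (simp add: gap_def seller.majorant_ge)

lemma continuous_gap: "continuous_on A gap"
  unfolding gap_def by (intro continuous_intros seller.continuous_majorant continuous_seller_rev)

lemma slack_nonneg: "\<phi> c \<in> {vl..vh} \<Longrightarrow> 0 \<le> slack \<phi> c"
  using buyer.conjugate_ge[of "\<phi> c" "seller.density c"]
  by (simp add: slack_def pointwise_max_def GB.sdf_conv_cdf algebra_simps)

lemma integrable_pointwise_max: "integrable GS pointwise_max"
proof -
  have lip: "\<bar>buyer.conjugate m - buyer.conjugate m'\<bar> \<le> \<bar>m - m'\<bar>" for m m'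
    using buyer.conjugate_lipschitz[of m m'] buyer.conjugate_lipschitz[of m' m] by (simp add: abs_le_iff abs_minus_commute)
  have "continuous_on UNIV buyer.conjugate"
    by (rule lipschitz_on_continuous_on[of 1]) (auto intro!: lipschitz_onI simp: dist_real_def lip)
  then have [measurable]: "buyer.conjugate \<in> borel_measurable borel" by (rule borel_measurable_continuous_onI)
  have "integrable GS (\<lambda>c. buyer.conjugate (seller.density c))"
  proof (rule Bochner_Integration.integrable_bound)
    show "integrable GS (\<lambda>c. \<bar>buyer.conjugate 0\<bar> + \<bar>seller.density c\<bar>)"
      using seller.integrable_density by simp
    show "AE c in GS. norm (buyer.conjugate (seller.density c)) \<le> norm (\<bar>buyer.conjugate 0\<bar> + \<bar>seller.density c\<bar>)"
      using lip[of _ 0] by (intro AE_I2) (simp, smt (verit))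
  qed (intro GS.borel_measurableI, measurable)
  then show ?thesis unfolding pointwise_max_def using seller.integrable_density by simp
qed

text \<open>\<open>seller.majorant\<close> (up to a constant) and \<open>seller_rev\<close> are
  integrals up to the threshold, so the layer-cake formula turns their averages over levels into
  integrals against \<open>q\<close>. What ironing adds to the seller's term is therefore an average
  of nonnegative gaps.\<close>

lemma integral_gap_threshold:
  "(\<integral>y. gap (GS.threshold q y) \<partial>restrict_space lborel {0..1})
    = seller.majorant cl + (\<integral>c. q c * seller.density c \<partial>GS) - seller_int g1 g2 q"
  "integrable (restrict_space lborel {0..1}) (\<lambda>y. gap (GS.threshold q y))"
  if q: "\<And>x y. cl \<le> x \<Longrightarrow> x \<le> y \<Longrightarrow> y \<le> ch \<Longrightarrow> q y \<le> q x"
    and q01: "\<And>x. x \<in> {cl..ch} \<Longrightarrow> 0 \<le> q x \<and> q x \<le> 1"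
proof -
  let ?U = "restrict_space lborel {0..1 :: real}" and ?t = "GS.threshold q"
  interpret U: atomless_on ?U 0 1 by (rule atomless_on_lborel)
  have t: "?t \<in> borel_measurable ?U" by (rule U.measurable_antimono) (intro GS.threshold_antimono)
  have t_range: "?t y \<in> {cl..ch}" for y using GS.threshold_range GS.a_le_b by auto
  have cont_int: "integrable ?U (\<lambda>y. F (?t y))" if F: "continuous_on UNIV F" for F :: "real \<Rightarrow> real"
  proof -
    have "bounded (F ` {cl..ch})"
      by (intro compact_imp_bounded compact_continuous_image continuous_on_subset[OF F]) auto
    then obtain K where K: "\<forall>x\<in>F ` {cl..ch}. norm x \<le> K" unfolding bounded_iff by blast
    show ?thesis
      using K t_range by (intro U.integrable_bounded[where B=K] measurable_compose[OF t borel_measurable_continuous_onI[OF F]]) auto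
  qed
  have U1: "measure ?U (space ?U) = 1" by (simp add: space_restrict_space measure_restrict_space)
  show "integrable ?U (\<lambda>y. gap (?t y))" by (intro cont_int continuous_gap)
  note iL = cont_int[OF LS.continuous_integral_atMost[OF g1]]
  note iG = cont_int[OF GS.continuous_integral_atMost[OF g2]]
  note iD = cont_int[OF GS.continuous_integral_atMost[OF seller.integrable_density]]
  have "(\<integral>y. gap (?t y) \<partial>?U) = (\<integral>y. seller.majorant cl + (\<integral>c. indicator {..?t y} c * seller.density c \<partial>GS)
      - ((\<integral>c. indicator {..?t y} c * g1 c \<partial>LS) + (\<integral>c. indicator {..?t y} c * g2 c \<partial>GS)) \<partial>?U)"
    using seller.majorant_integral[OF t_range] by (simp add: gap_def seller_rev_def seller_int_def)
  also have "\<dots> = seller.majorant cl + (\<integral>y. (\<integral>c. indicator {..?t y} c * seller.density c \<partial>GS) \<partial>?U)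
      - ((\<integral>y. (\<integral>c. indicator {..?t y} c * g1 c \<partial>LS) \<partial>?U) + (\<integral>y. (\<integral>c. indicator {..?t y} c * g2 c \<partial>GS) \<partial>?U))"
    using iL iG iD U1 by simp
  also have "(\<integral>y. (\<integral>c. indicator {..?t y} c * seller.density c \<partial>GS) \<partial>?U) = (\<integral>c. q c * seller.density c \<partial>GS)"
    using q q01 by (intro GS.layer_cake[symmetric] seller.integrable_density) auto
  also have "(\<integral>y. (\<integral>c. indicator {..?t y} c * g1 c \<partial>LS) \<partial>?U) = (\<integral>c. q c * g1 c \<partial>LS)"
    using q q01 by (intro LS.layer_cake[symmetric] g1) auto
  also have "(\<integral>y. (\<integral>c. indicator {..?t y} c * g2 c \<partial>GS) \<partial>?U) = (\<integral>c. q c * g2 c \<partial>GS)"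
    using q q01 by (intro GS.layer_cake[symmetric] g2) auto
  finally show "(\<integral>y. gap (?t y) \<partial>?U) = seller.majorant cl + (\<integral>c. q c * seller.density c \<partial>GS) - seller_int g1 g2 q"
    by (simp add: seller_int_def)
qed

lemma sdf_cutoff:
  assumes "\<phi> \<in> cutoffs"
  shows "\<And>x y. cl \<le> x \<Longrightarrow> x \<le> y \<Longrightarrow> y \<le> ch \<Longrightarrow> GB.sdf (\<phi> y) \<le> GB.sdf (\<phi> x)"
    "\<And>x. x \<in> {cl..ch} \<Longrightarrow> 0 \<le> GB.sdf (\<phi> x) \<and> GB.sdf (\<phi> x) \<le> 1"
  using GB.sdf_nonneg sdf_le_1 by (auto intro!: GB.sdf_antimono mono_onD[OF cutoffsD(1)[OF assms]])

lemma bounded_buyer_rev: obtains K where "\<And>w. w \<in> {vl..vh} \<Longrightarrow> \<bar>buyer_rev f1 f2 w\<bar> \<le> K"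
  using buyer.bounded_B by metis

lemma integrable_buyer_rev:
  assumes "\<phi> \<in> borel_measurable GS" "\<And>c. c \<in> {cl..ch} \<Longrightarrow> \<phi> c \<in> {vl..vh}"
  shows "integrable GS (\<lambda>c. buyer_rev f1 f2 (\<phi> c))"
proof -
  obtain K where "\<And>w. w \<in> {vl..vh} \<Longrightarrow> \<bar>buyer_rev f1 f2 w\<bar> \<le> K" using bounded_buyer_rev by blast
  then show ?thesis using assms
    by (intro GS.integrable_bounded[where B=K]
        measurable_compose[OF assms(1) borel_measurable_continuous_onI[OF continuous_buyer_rev]]) auto
qed

lemma integrable_weighted:
  assumes f: "integrable M f" and q: "q \<in> borel_measurable M" "\<And>c. c \<in> space M \<Longrightarrow> 0 \<le> q c \<and> q c \<le> 1"
  shows "integrable M (\<lambda>c. q c * f c :: real)"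
proof (rule Bochner_Integration.integrable_bound[OF f])
  show "(\<lambda>c. q c * f c) \<in> borel_measurable M" using f q(1) by measurable
  show "AE c in M. norm (q c * f c) \<le> norm (f c)"
    using q(2) by (auto simp: abs_mult intro!: mult_left_le_one_le)
qed

lemma integrable_slack:
  assumes "\<phi> \<in> cutoffs" shows "integrable GS (slack \<phi>)"
  unfolding slack_def using cutoffsD[OF assms] sdf_cutoff[OF assms]
  by (intro Bochner_Integration.integrable_diff Bochner_Integration.integrable_add integrable_pointwise_max
      integrable_buyer_rev integrable_weighted seller.integrable_density measurable_compose_sdf)
    (auto simp: GS.space_M)

text \<open>The payoff loses against \<open>bound\<close> in two ways: where \<open>\<phi>\<close> is not a pointwise maximiser against
  the ironed seller term, and where the seller's threshold lies off the contact set of the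
  concave majorant.\<close>

lemma bound_minus_payoff:
  assumes \<phi>: "\<phi> \<in> cutoffs"
  shows "bound - payoff f1 f2 g1 g2 \<phi> = (\<integral>c. slack \<phi> c \<partial>GS)
    + (\<integral>y. gap (GS.threshold (\<lambda>c. GB.sdf (\<phi> c)) y) \<partial>restrict_space lborel {0..1})"
proof -
  have 1: "integrable GS (\<lambda>c. buyer_rev f1 f2 (\<phi> c))"
    using cutoffsD[OF \<phi>] by (intro integrable_buyer_rev) auto
  have 2: "integrable GS (\<lambda>c. GB.sdf (\<phi> c) * seller.density c)"
    using cutoffsD[OF \<phi>] sdf_cutoff[OF \<phi>]
    by (intro integrable_weighted seller.integrable_density measurable_compose_sdf) (auto simp: GS.space_M)
  have "(\<integral>c. slack \<phi> c \<partial>GS) = (\<integral>c. pointwise_max c \<partial>GS) - ((\<integral>c. buyer_rev f1 f2 (\<phi> c) \<partial>GS)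
      + (\<integral>c. GB.sdf (\<phi> c) * seller.density c \<partial>GS))"
    unfolding slack_def using 1 2 integrable_pointwise_max by simp
  then show ?thesis using integral_gap_threshold(1)[of "\<lambda>c. GB.sdf (\<phi> c)", OF sdf_cutoff[OF \<phi>]]
    by (simp add: bound_def payoff_def)
qed

lemma payoff_eq_bound_iff:
  assumes \<phi>: "\<phi> \<in> cutoffs"
  shows "payoff f1 f2 g1 g2 \<phi> = bound \<longleftrightarrow> (AE c in GS. slack \<phi> c = 0) \<and>
    (AE y in restrict_space lborel {0..1}. gap (GS.threshold (\<lambda>c. GB.sdf (\<phi> c)) y) = 0)"
    and payoff_le_bound: "payoff f1 f2 g1 g2 \<phi> \<le> bound"
proof -
  let ?U = "restrict_space lborel {0..1 :: real}"
  have t_range: "GS.threshold q y \<in> {cl..ch}" for q y using GS.threshold_range GS.a_le_b by auto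
  have s0: "AE c in GS. 0 \<le> slack \<phi> c" using cutoffsD[OF \<phi>] by (auto simp: GS.space_M intro!: slack_nonneg)
  have g0: "AE y in ?U. 0 \<le> gap (GS.threshold (\<lambda>c. GB.sdf (\<phi> c)) y)" using gap_nonneg[OF t_range] by simp
  note int = integrable_slack[OF \<phi>] integral_gap_threshold(2)[of "\<lambda>c. GB.sdf (\<phi> c)", OF sdf_cutoff[OF \<phi>]]
  have nonneg: "0 \<le> (\<integral>c. slack \<phi> c \<partial>GS)" "0 \<le> (\<integral>y. gap (GS.threshold (\<lambda>c. GB.sdf (\<phi> c)) y) \<partial>?U)"
    using s0 g0 by (auto intro: integral_nonneg_AE)
  then show "payoff f1 f2 g1 g2 \<phi> \<le> bound" using bound_minus_payoff[OF \<phi>] by simp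
  show "payoff f1 f2 g1 g2 \<phi> = bound \<longleftrightarrow> (AE c in GS. slack \<phi> c = 0) \<and>
    (AE y in ?U. gap (GS.threshold (\<lambda>c. GB.sdf (\<phi> c)) y) = 0)"
    using bound_minus_payoff[OF \<phi>] nonneg integral_nonneg_eq_0_iff_AE[OF int(1) s0]
      integral_nonneg_eq_0_iff_AE[OF int(2) g0] by (auto simp: add_nonneg_eq_0_iff)
qed

end

section \<open>The ironed bound for arbitrary implementable rules\<close>

context ironing
begin

text \<open>Bathtub principle, by pointwise comparison with the density at the level where the
  distribution function equals the total mass.\<close>

lemma integral_density_le:
  assumes p: "integrable M p" "\<And>c. c \<in> {a..b} \<Longrightarrow> 0 \<le> p c \<and> p c \<le> 1"
  shows "(\<integral>c. p c * density c \<partial>M) \<le> (\<integral>c. of_bool (cdf c \<le> (\<integral>c. p c \<partial>M)) * density c \<partial>M)"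
proof -
  define X where "X = (\<integral>c. p c \<partial>M)"
  let ?r = "\<lambda>c. of_bool (cdf c \<le> X) :: real"
  have cdf_meas: "cdf \<in> borel_measurable borel"
    by (rule borel_measurable_continuous_onI) (rule continuous_cdf)
  have r_meas: "?r \<in> borel_measurable M"
    using cdf_meas by (intro borel_measurableI) measurable
  have r_int: "integrable M ?r" using r_meas by (rule integrable_bounded[where B=1]) auto
  have pd: "integrable M (\<lambda>c. p c * density c)" and rd: "integrable M (\<lambda>c. ?r c * density c)"
  proof -
    show "integrable M (\<lambda>c. p c * density c)"
      by (rule Bochner_Integration.integrable_bound[OF integrable_density])
        (use p in \<open>auto simp: space_M abs_mult intro!: mult_left_le_one_le borel_measurable_times borel_measurableI\<close>)
    show "integrable M (\<lambda>c. ?r c * density c)"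
      by (rule Bochner_Integration.integrable_bound[OF integrable_density])
        (use r_meas in \<open>auto intro!: borel_measurable_times borel_measurableI\<close>)
  qed
  have X0: "0 \<le> X" unfolding X_def using p by (intro integral_nonneg_AE AE_I2) (auto simp: space_M)
  have "X \<le> (\<integral>c. 1 \<partial>M)" unfolding X_def using p by (intro integral_mono) (auto simp: space_M)
  then have X1: "X \<le> 1" by (simp add: prob_space)
  have r_X: "(\<integral>c. ?r c \<partial>M) = X" by (rule integral_cdf_le) (use X0 X1 in auto)
  consider "X = 0" | "X = 1" | "0 < X" "X < 1" using X0 X1 by linarith
  then have "(\<integral>c. p c * density c \<partial>M) \<le> (\<integral>c. ?r c * density c \<partial>M)"
  proof cases
    case 1
    have "AE c in M. 0 \<le> p c" using p(2) by (intro AE_I2) (simp add: space_M)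
    then have "AE c in M. p c = 0"
      using integral_nonneg_eq_0_iff_AE[OF p(1)] 1 by (simp add: X_def)
    then have "(\<integral>c. p c * density c \<partial>M) = (\<integral>c. ?r c * density c \<partial>M)"
      using AE_cdf_interior borel_measurable_integrable[OF pd] borel_measurable_integrable[OF rd]
      by (intro integral_cong_AE) (auto elim!: eventually_elim2 simp: 1)
    then show ?thesis by simp
  next
    case 2
    have "(\<integral>c. 1 - p c \<partial>M) = 0" using p(1) 2 by (simp add: X_def prob_space)
    then have "AE c in M. 1 - p c = 0"
      by (subst (asm) integral_nonneg_eq_0_iff_AE) (use p in \<open>auto simp: space_M\<close>)
    then have "(\<integral>c. p c * density c \<partial>M) = (\<integral>c. ?r c * density c \<partial>M)"
      using borel_measurable_integrable[OF pd] borel_measurable_integrable[OF rd] cdf_le_1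
      by (intro integral_cong_AE) (auto elim!: eventually_mono simp: 2)
    then show ?thesis by simp
  next
    case 3
    then obtain l where l: "l \<in> {a..b}" "cdf l = X"
      using cdf_level[of X] by (metis atLeastAtMost_iff less_imp_le order_trans)
    have "0 \<le> (\<integral>c. (?r c - p c) * (density c - density l) \<partial>M)"
    proof (rule integral_nonneg_AE)
      show "AE c in M. 0 \<le> (?r c - p c) * (density c - density l)"
        using AE_cdf_neq[of X] AE_cdf_interior AE_space
      proof eventually_elim
        case (elim c)
        have pc: "0 \<le> p c" "p c \<le> 1" using p(2) elim by (auto simp: space_M)
        consider "cdf c < X" | "X < cdf c" using elim by linarith
        then show ?case
        proof cases
          case 1
          then have "c \<le> l" using cdf_mono[of l c] l by (cases "c \<le> l") auto
          then have "density l \<le> density c" using elim 3 l by (intro density_antimono) auto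
          then show ?thesis using 1 pc by simp
        next
          case 2
          then have "l \<le> c" using cdf_mono[of c l] l by (cases "l \<le> c") auto
          then have "density c \<le> density l" using elim 3 l by (intro density_antimono) auto
          then show ?thesis using 2 pc by (simp add: mult_nonneg_nonpos)
        qed
      qed
    qed
    also have "(\<integral>c. (?r c - p c) * (density c - density l) \<partial>M)
      = (\<integral>c. ?r c * density c - p c * density c - density l * (?r c - p c) \<partial>M)"
      by (intro Bochner_Integration.integral_cong) (auto simp: algebra_simps)
    also have "\<dots> = (\<integral>c. ?r c * density c \<partial>M) - (\<integral>c. p c * density c \<partial>M) - density l * (X - X)"
      using pd rd p(1) r_int r_X by (simp add: X_def)
    finally show ?thesis by simp
  qed
  then show ?thesis by (simp add: X_def)
qed

end

context trade_objective
begin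

text \<open>The trade probability of each value is moved to the lowest cost quantiles:
  \<open>r v c\<close> asks whether the quantile of \<open>c\<close> is at most
  \<open>buyer_prob p v\<close>. This preserves the buyer's interim probability and, by the bathtub
  principle, does not lower the ironed seller term. For fixed \<open>c\<close>, monotonicity of
  \<open>buyer_prob p\<close> makes \<open>r\<close> a cutoff rule in \<open>v\<close>, to which the
  pointwise maximum applies.\<close>

lemma implementable_le_bound:
  assumes p: "implementable p"
  shows "buyer_int f1 f2 (buyer_prob p) + seller_int g1 g2 (seller_prob p) \<le> bound"
proof -
  note D = implementableD[OF p]
  let ?x = "buyer_prob p" and ?q = "seller_prob p"
  define r where "r v c = (of_bool (GS.cdf c \<le> ?x v) :: real)" for v c
  have x01: "0 \<le> ?x v \<and> ?x v \<le> 1" if "v \<in> {vl..vh}" for v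
    using section_GS[OF D(1,2) that] by auto
  have q01: "0 \<le> ?q c \<and> ?q c \<le> 1" if "c \<in> {cl..ch}" for c
    using section_GB[OF D(1,2) that] by auto
  have x_int_r: "?x v = (\<integral>c. r v c \<partial>GS)" if "v \<in> {vl..vh}" for v
    unfolding r_def using GS.integral_cdf_le x01[OF that] by simp
  have [measurable]: "?x \<in> borel_measurable GB" "?x \<in> borel_measurable LB"
    using GB.measurable_mono LB.measurable_mono D(3) by auto
  have [measurable]: "GS.cdf \<in> borel_measurable GS"
    by (intro GS.borel_measurableI borel_measurable_continuous_onI GS.continuous_cdf)
  have r_meas: "(\<lambda>(v, c). r v c) \<in> borel_measurable (GB \<Otimes>\<^sub>M GS)" "(\<lambda>(v, c). r v c) \<in> borel_measurable (LB \<Otimes>\<^sub>M GS)"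
    "(\<lambda>(c, v). r v c) \<in> borel_measurable (GS \<Otimes>\<^sub>M GB)"
    unfolding r_def by measurable
  have r_sect: "r v \<in> borel_measurable GS" for v unfolding r_def by measurable
  have p_swap: "(\<lambda>(c, v). p v c) \<in> borel_measurable (GS \<Otimes>\<^sub>M GB)"
    using measurable_compose[OF measurable_pair_swap' D(1)] by (simp add: case_prod_unfold)
  note fm = GB.finite_measure_axioms GS.finite_measure_axioms LB.finite_measure_axioms
  note swap1 = Fubini_weight[OF fm(3,2) r_meas(2) _ f1] and swap2 = Fubini_weight[OF fm(1,2) r_meas(1) _ f2]
  note swap3 = Fubini_weight[OF fm(2,1) p_swap _ seller.integrable_density]
    and swap4 = Fubini_weight[OF fm(2,1) r_meas(3) _ seller.integrable_density]
  have r1: "\<bar>r v c\<bar> \<le> 1" for v c by (simp add: r_def)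
  have p1: "\<bar>p v c\<bar> \<le> 1" if "c \<in> space GS" "v \<in> space GB" for v c
    using D(2)[of v c] that by (auto simp: GB.space_M GS.space_M)
  \<comment> \<open>Passing to the ironed density can only increase the seller's term; this is where
    monotonicity of \<open>seller_prob p\<close> enters.\<close>
  have "0 \<le> (\<integral>y. gap (GS.threshold ?q y) \<partial>restrict_space lborel {0..1})"
    using gap_nonneg GS.threshold_range GS.a_le_b by (intro integral_nonneg_AE AE_I2) auto
  then have "seller_int g1 g2 ?q \<le> seller.majorant cl + (\<integral>c. ?q c * seller.density c \<partial>GS)"
    using integral_gap_threshold(1)[of ?q, OF D(4) q01] by simp
  also have "(\<integral>c. ?q c * seller.density c \<partial>GS) = (\<integral>v. (\<integral>c. p v c * seller.density c \<partial>GS) \<partial>GB)"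
    unfolding seller_prob_def by (intro swap3(2) p1)
  also have "\<dots> \<le> (\<integral>v. (\<integral>c. r v c * seller.density c \<partial>GS) \<partial>GB)"
  proof (rule integral_mono)
    show "integrable GB (\<lambda>v. \<integral>c. p v c * seller.density c \<partial>GS)" using swap3(3) p1 by blast
    show "integrable GB (\<lambda>v. \<integral>c. r v c * seller.density c \<partial>GS)" using swap4(3) r1 by blast
    fix v assume "v \<in> space GB"
    then have v: "v \<in> {vl..vh}" by (simp add: GB.space_M)
    show "(\<integral>c. p v c * seller.density c \<partial>GS) \<le> (\<integral>c. r v c * seller.density c \<partial>GS)"
      using seller.integral_density_le[OF section_GS(1)[OF D(1,2) v]] D(2)[OF v] by (simp add: r_def buyer_prob_def)
  qed
  also have "\<dots> = (\<integral>c. (\<integral>v. r v c \<partial>GB) * seller.density c \<partial>GS)"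
    by (intro swap4(2)[symmetric] r1)
  finally have seller_le: "seller_int g1 g2 ?q \<le> seller.majorant cl + (\<integral>c. (\<integral>v. r v c \<partial>GB) * seller.density c \<partial>GS)"
    by simp
  have "(\<integral>v. ?x v * f1 v \<partial>LB) = (\<integral>v. (\<integral>c. r v c \<partial>GS) * f1 v \<partial>LB)"
    by (intro Bochner_Integration.integral_cong refl) (simp add: LB.space_M x_int_r)
  also have "\<dots> = (\<integral>c. (\<integral>v. r v c * f1 v \<partial>LB) \<partial>GS)" by (intro swap1(2) r1)
  finally have e1: "(\<integral>v. ?x v * f1 v \<partial>LB) = (\<integral>c. (\<integral>v. r v c * f1 v \<partial>LB) \<partial>GS)" .
  have "(\<integral>v. ?x v * f2 v \<partial>GB) = (\<integral>v. (\<integral>c. r v c \<partial>GS) * f2 v \<partial>GB)"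
    by (intro Bochner_Integration.integral_cong refl) (simp add: GB.space_M x_int_r)
  also have "\<dots> = (\<integral>c. (\<integral>v. r v c * f2 v \<partial>GB) \<partial>GS)" by (intro swap2(2) r1)
  finally have e2: "(\<integral>v. ?x v * f2 v \<partial>GB) = (\<integral>c. (\<integral>v. r v c * f2 v \<partial>GB) \<partial>GS)" .
  have i1: "integrable GS (\<lambda>c. \<integral>v. r v c * f1 v \<partial>LB)" and i2: "integrable GS (\<lambda>c. \<integral>v. r v c * f2 v \<partial>GB)"
    using swap1(3) swap2(3) r1 by auto
  have i3: "integrable GS (\<lambda>c. (\<integral>v. r v c \<partial>GB) * seller.density c)"
  proof (rule integrable_weighted[OF seller.integrable_density])
    show "(\<lambda>c. \<integral>v. r v c \<partial>GB) \<in> borel_measurable GS"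
      using r_meas(3) by (intro GB.borel_measurable_lebesgue_integral) auto
    fix c
    have "integrable GB (\<lambda>v. r v c)" unfolding r_def by (rule GB.integrable_bounded[where B=1]) auto
    then have "(\<integral>v. r v c \<partial>GB) \<le> (\<integral>v. 1 \<partial>GB)" by (intro integral_mono) (auto simp: r_def)
    moreover have "0 \<le> (\<integral>v. r v c \<partial>GB)" by (intro integral_nonneg_AE AE_I2) (simp add: r_def)
    ultimately show "0 \<le> (\<integral>v. r v c \<partial>GB) \<and> (\<integral>v. r v c \<partial>GB) \<le> 1" by (simp add: GB.prob_space)
  qed
  have pointwise: "(\<integral>v. r v c * f1 v \<partial>LB) + (\<integral>v. r v c * f2 v \<partial>GB) + (\<integral>v. r v c \<partial>GB) * seller.density c \<le> pointwise_max c" for c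
  proof -
    \<comment> \<open>The point where \<open>r\<close> switches on; \<open>vh\<close> is inserted in
      case it never does. Whether \<open>r\<close> already holds at \<open>w\<close> itself does not
      matter, as \<open>w\<close> is null.\<close>
    define w where "w = Inf (insert vh {v \<in> {vl..vh}. GS.cdf c \<le> ?x v})"
    have bdd: "bdd_below (insert vh {v \<in> {vl..vh}. GS.cdf c \<le> ?x v})" by (rule bdd_belowI[of _ "min vl vh"]) auto
    have w: "w \<in> {vl..vh}" unfolding w_def using GB.a_le_b bdd by (auto intro!: cInf_lower cInf_greatest)
    have r_w: "r v c = indicator {w..} v" if "v \<noteq> w" "v \<in> {vl..vh}" for v
    proof (cases "v < w")
      case True
      then have "\<not> GS.cdf c \<le> ?x v" using cInf_lower[OF _ bdd, of v] that by (auto simp: w_def)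
      then show ?thesis using True by (simp add: r_def)
    next
      case False
      then have "w < v" using that by simp
      then obtain u where u: "u \<in> insert vh {v \<in> {vl..vh}. GS.cdf c \<le> ?x v}" "u < v"
        unfolding w_def by (subst (asm) cInf_less_iff) (use bdd in auto)
      then have "u \<in> {vl..vh}" "GS.cdf c \<le> ?x u" using that by auto
      then have "GS.cdf c \<le> ?x v" using mono_onD[OF D(3), of u v] that u by auto
      then show ?thesis using False by (simp add: r_def)
    qed
    have ae_LB: "AE v in LB. r v c = indicator {w..} v"
      using LB.AE_neq[of w] AE_space by eventually_elim (auto simp: LB.space_M r_w)
    have ae_GB: "AE v in GB. r v c = indicator {w..} v"
      using GB.AE_neq[of w] AE_space by eventually_elim (auto simp: GB.space_M r_w)
    have m: "(\<lambda>v. r v c) \<in> borel_measurable LB" "(\<lambda>v. r v c) \<in> borel_measurable GB"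
      unfolding r_def by measurable
    have "(\<integral>v. r v c * f1 v \<partial>LB) = (\<integral>v. indicator {w..} v * f1 v \<partial>LB)"
      using ae_LB m f1 by (intro integral_cong_AE) (auto elim: eventually_mono)
    moreover have "(\<integral>v. r v c * f2 v \<partial>GB) = (\<integral>v. indicator {w..} v * f2 v \<partial>GB)"
      using ae_GB m f2 by (intro integral_cong_AE) (auto elim: eventually_mono)
    moreover have "(\<integral>v. r v c \<partial>GB) = GB.sdf w" unfolding GB.sdf_eq
      using ae_GB m by (intro integral_cong_AE) auto
    ultimately show ?thesis
      using slack_nonneg[of "\<lambda>_. w" c] w by (simp add: slack_def buyer_rev_def buyer_int_def)
  qed
  have "buyer_int f1 f2 ?x + seller_int g1 g2 ?q \<le> seller.majorant cl +
     (\<integral>c. (\<integral>v. r v c * f1 v \<partial>LB) + (\<integral>v. r v c * f2 v \<partial>GB) + (\<integral>v. r v c \<partial>GB) * seller.density c \<partial>GS)"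
    using seller_le e1 e2 i1 i2 i3 by (simp add: buyer_int_def)
  also have "\<dots> \<le> bound" unfolding bound_def
    using i1 i2 i3 by (intro add_mono order_refl integral_mono integrable_pointwise_max pointwise
      Bochner_Integration.integrable_add)
  finally show ?thesis .
qed

text \<open>The pointwise maximiser against the ironed slope. Empty \<open>slopes\<close> stand for
  slope minus infinity and give the highest cutoff, \<open>UNIV\<close> stands for plus infinity and
  gives the lowest. The value depends on \<open>c\<close> only through
  \<open>slopes c\<close>.\<close>

definition best_cutoff :: "real \<Rightarrow> real" where
  "best_cutoff c = (if seller.slopes c = {} then vh else if seller.slopes c = UNIV then vl
     else buyer.last_argmax (seller.slope c))"

lemma gap_last_argmax: "gap (seller.last_argmax m) = 0"
  by (simp add: gap_def seller.majorant_last_argmax)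

lemma best_cutoff_in: "best_cutoff \<in> cutoffs"
proof -
  have "best_cutoff c \<le> best_cutoff c'" if "c \<le> c'" for c c'
  proof -
    have sub: "seller.slopes c' \<subseteq> seller.slopes c" by (rule seller.slopes_antimono) fact
    consider "seller.slopes c' = {}" | "seller.slopes c = UNIV" | "seller.slopes c' \<noteq> {}" "seller.slopes c \<noteq> UNIV" by blast
    then show ?thesis
    proof cases
      case 3
      then have "seller.slope c' \<le> seller.slope c" using that by (intro seller.slope_antimono)
      then have "buyer.last_argmax (seller.slope c) \<le> buyer.last_argmax (seller.slope c')" by (rule buyer.last_argmax_antimono)
      moreover have "seller.slopes c \<noteq> {}" "seller.slopes c' \<noteq> UNIV" using 3 sub by auto
      ultimately show ?thesis using 3 by (simp add: best_cutoff_def)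
    qed (use buyer.last_argmax_range GB.a_le_b in \<open>auto simp: best_cutoff_def\<close>)
  qed
  moreover have "best_cutoff c \<in> {vl..vh}" for c
    using buyer.last_argmax_range GB.a_le_b by (auto simp: best_cutoff_def)
  ultimately show ?thesis by (auto simp: cutoffs_def intro!: mono_onI)
qed

text \<open>The slack vanishes by the choice of the cutoff. The cutoff changes between two costs
  only if \<open>slopes\<close> does, and then some \<open>last_argmax\<close>, a contact point,
  lies between them. A threshold at a level strictly between 0 and 1 is a limit of such points, so
  continuity of \<open>gap\<close> makes it a contact point.\<close>

lemma payoff_best_cutoff: "payoff f1 f2 g1 g2 best_cutoff = bound"
proof -
  let ?q = "\<lambda>c. GB.sdf (best_cutoff c)"
  have slack0: "AE c in GS. slack best_cutoff c = 0"
    using GS.AE_cdf_interior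
  proof eventually_elim
    case (elim c)
    then have "seller.slopes c \<noteq> {}" "seller.slopes c \<noteq> UNIV" "seller.density c = seller.slope c"
      using seller.slopes_nonempty seller.slopes_ne_UNIV by (auto simp: seller.density_def)
    then show ?case
      by (simp add: slack_def pointwise_max_def best_cutoff_def buyer.conjugate_def GB.sdf_conv_cdf algebra_simps)
  qed
  have contact: "\<exists>z. c \<le> z \<and> z < c' \<and> gap z = 0" if cc': "c \<le> c'" "?q c \<noteq> ?q c'" for c c'
  proof -
    have "seller.slopes c \<noteq> seller.slopes c'" using cc' by (metis best_cutoff_def seller.slope_def)
    moreover have "seller.slopes c' \<subseteq> seller.slopes c" by (rule seller.slopes_antimono) fact
    ultimately obtain m where "m \<in> seller.slopes c" "m \<notin> seller.slopes c'" by blast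
    then show ?thesis using gap_last_argmax[of m] by (auto simp: seller.slopes_def)
  qed
  have tight: "gap (GS.threshold ?q y) = 0" if y: "0 < y" "y < 1" for y
  proof (rule ccontr)
    let ?z = "GS.threshold ?q y"
    assume ne: "gap ?z \<noteq> 0"
    have z: "cl \<le> ?z" "?z \<le> ch" using GS.threshold_range GS.a_le_b by auto
    have "isCont gap ?z" using continuous_gap[of UNIV] by (simp add: continuous_on_eq_continuous_at)
    then have "\<forall>\<^sub>F x in nhds ?z. gap x \<noteq> 0" using ne
      by (intro tendsto_imp_eventually_ne) (auto simp: isCont_def tendsto_at_iff_tendsto_nhds)
    then obtain e where e: "0 < e" "\<And>x. dist x ?z < e \<Longrightarrow> gap x \<noteq> 0"
      unfolding eventually_nhds_metric by blast
    have left: "\<exists>c. cl \<le> c \<and> ?z - e < c \<and> c < ?z \<and> y \<le> ?q c" if "cl < ?z"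
    proof -
      have "max cl (?z - e) < ?z" using that e by simp
      then obtain c where c: "max cl (?z - e) < c" "c < ?z" using dense by blast
      then have "y \<le> ?q c"
        using GS.less_thresholdD[of ?q c y] sdf_cutoff(1)[OF best_cutoff_in] by auto
      then show ?thesis using c by (intro exI[of _ c]) auto
    qed
    have right: "\<exists>c. c \<le> ch \<and> c < ?z + e \<and> ?z < c \<and> ?q c < y" if "?z < ch"
    proof -
      have "?z < min ch (?z + e)" using that e by simp
      then obtain c where c: "?z < c" "c < min ch (?z + e)" using dense by blast
      then have "?q c < y" using GS.threshold_ge[of c y ?q] z by (cases "?q c < y") auto
      then show ?thesis using c by (intro exI[of _ c]) auto
    qed
    have "\<exists>x. ?z - e < x \<and> x < ?z + e \<and> gap x = 0"
    proof -
      consider "cl < ?z" "?z < ch" | "?z = cl" | "?z = ch" using z by linarith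
      then show ?thesis
      proof cases
        case 1
        obtain c1 c2 where c: "?z - e < c1" "c1 < ?z" "y \<le> ?q c1" "c2 < ?z + e" "?z < c2" "?q c2 < y"
          using left[OF 1(1)] right[OF 1(2)] by blast
        then have "c1 \<le> c2" "?q c1 \<noteq> ?q c2" by linarith+
        then obtain x where "c1 \<le> x" "x < c2" "gap x = 0" using contact[of c1 c2] by blast
        then show ?thesis using c by (intro exI[of _ x]) linarith
      next
        \<comment> \<open>At \<open>cl\<close> only a right neighbour is available. Its level below
          1 excludes \<open>slopes c2 = UNIV\<close>, whose cutoff \<open>vl\<close> has level 1, so
          some \<open>last_argmax\<close> lies before \<open>c2\<close>. The case of
          \<open>ch\<close> is the mirror image.\<close>
        case 2
        then obtain c2 where c: "c2 < ?z + e" "?z < c2" "?q c2 < y" using right GS.a_less_b by auto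
        then have "seller.slopes c2 \<noteq> UNIV" using y sdf_vl sdf_vh GS.a_less_b by (auto simp: best_cutoff_def)
        then obtain m where "m \<notin> seller.slopes c2" by blast
        then show ?thesis using c 2 e gap_last_argmax[of m] seller.last_argmax_range[of m]
          by (intro exI[of _ "seller.last_argmax m"]) (auto simp: seller.slopes_def)
      next
        case 3
        then obtain c1 where c: "?z - e < c1" "c1 < ?z" "y \<le> ?q c1" using left GS.a_less_b by auto
        then have "seller.slopes c1 \<noteq> {}" using y sdf_vh by (auto simp: best_cutoff_def)
        then obtain m where "m \<in> seller.slopes c1" by blast
        then show ?thesis using c 3 e gap_last_argmax[of m] seller.last_argmax_range[of m]
          by (intro exI[of _ "seller.last_argmax m"]) (auto simp: seller.slopes_def)
      qed
    qed
    then obtain x where "?z - e < x" "x < ?z + e" "gap x = 0" by blast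
    then show False using e(2)[of x] by (auto simp: dist_real_def abs_less_iff)
  qed
  interpret U: atomless_on "restrict_space lborel {0..1::real}" 0 1 by (rule atomless_on_lborel)
  have "AE y in restrict_space lborel {0..1}. gap (GS.threshold ?q y) = 0"
    using U.AE_neq[of 0] U.AE_neq[of 1] AE_space
    by eventually_elim (auto simp: U.space_M intro!: tight)
  with slack0 show ?thesis using payoff_eq_bound_iff[OF best_cutoff_in] by blast
qed

end


section \<open>Optimal cutoff rules\<close>

lemma AE_unit_interval_obtain:
  assumes "AE y in restrict_space lborel {0..1::real}. P y" "0 \<le> u" "u < w" "w \<le> 1"
  obtains y where "u < y" "y \<le> w" "P y"
proof -
  interpret U: atomless_on "restrict_space lborel {0..1::real}" 0 1 by (rule atomless_on_lborel)
  let ?U = "restrict_space lborel {0..1::real}"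
  have "\<exists>y. u < y \<and> y \<le> w \<and> P y"
  proof (rule ccontr)
    assume no: "\<not> ?thesis"
    have "AE y in ?U. indicator {u<..w} y = (0 :: real)"
      using assms(1) by eventually_elim (use no in \<open>auto simp: indicator_def\<close>)
    then have "(\<integral>y. indicator {u<..w} y \<partial>?U) = (\<integral>y. 0 \<partial>?U :: real)"
      by (intro integral_cong_AE) (auto intro!: U.borel_measurableI)
    moreover have "(\<integral>y. indicator {u<..w} y \<partial>?U) = U.cdf w - U.cdf u"
      unfolding U.cdf_eq using U.integral_Ioc[of "\<lambda>_. 1" u w] assms by simp
    ultimately show False using assms by (simp add: cdf_lborel)
  qed
  then show ?thesis using that by blast
qed

text \<open>\<open>u\<close> is the last point of \<open>S\<close> with \<open>C u \<le> 0\<close>,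
  and \<open>w\<close> the first point of \<open>S\<close> from \<open>u\<close> on with
  \<open>0 \<le> C w\<close>. A point of \<open>S\<close> strictly between them would have one of
  the two signs and contradict one of the choices.\<close>

lemma closed_sign_change:
  fixes C :: "real \<Rightarrow> real"
  assumes S: "closed S" "S \<subseteq> {l..h}" "l \<in> S" "h \<in> S" and C: "continuous_on UNIV C" "C l \<le> 0" "0 \<le> C h"
    and lh: "l \<le> h"
  shows "(\<exists>s\<in>S. C s = 0) \<or> (\<exists>u\<in>S. \<exists>w\<in>S. u < w \<and> {u<..<w} \<inter> S = {} \<and> C u < 0 \<and> 0 < C w)"
proof (rule disjCI)
  assume no: "\<not> (\<exists>u\<in>S. \<exists>w\<in>S. u < w \<and> {u<..<w} \<inter> S = {} \<and> C u < 0 \<and> 0 < C w)"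
  show "\<exists>s\<in>S. C s = 0"
  proof (rule ccontr)
    assume nz: "\<not> ?thesis"
    have cpt: "compact S" using S(1,2) by (auto simp: compact_eq_bounded_closed intro: bounded_subset[of "{l..h}"])
    have "closed {s. C s \<le> 0}" "closed {s. 0 \<le> C s}"
      using closed_Collect_le[OF C(1) continuous_on_const] closed_Collect_le[OF continuous_on_const C(1)] by auto
    then have cpts: "compact (S \<inter> {s. C s \<le> 0})" "\<And>u. compact (S \<inter> {s. 0 \<le> C s} \<inter> {u..})"
      using cpt by (auto intro!: compact_Int_closed)
    obtain u where u: "u \<in> S" "C u \<le> 0" "\<And>s. s \<in> S \<Longrightarrow> C s \<le> 0 \<Longrightarrow> s \<le> u"
      using compact_attains_sup[OF cpts(1)] S(3) C(2) by blast
    have "u \<le> h" using u(1) S(2) by auto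
    then obtain w where w: "w \<in> S" "0 \<le> C w" "u \<le> w" "\<And>s. s \<in> S \<Longrightarrow> 0 \<le> C s \<Longrightarrow> u \<le> s \<Longrightarrow> w \<le> s"
      using compact_attains_inf[OF cpts(2)[of u]] S(4) C(3) by auto
    have "C u < 0" "0 < C w" using u w nz by (auto simp: order.strict_iff_order)
    moreover have "{u<..<w} \<inter> S = {}" using u(3) w(4) by fastforce
    moreover have "u < w" using w(3) \<open>C u < 0\<close> \<open>0 < C w\<close> by (cases "u = w") auto
    ultimately show False using no u(1) w(1) by blast
  qed
qed

context atomless_on
begin

text \<open>Some point does at least as well as the average. If the interval has measure zero every
  point does, but then \<open>P\<close> may fail throughout, which explains the guard on
  \<open>P c\<close>.\<close>

lemma exists_ge_average:
  assumes F: "integrable M F" and uw: "a \<le> u" "u < w" "w \<le> b"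
    and P: "AE c in M. c \<in> {u<..<w} \<longrightarrow> P c"
  obtains c where "u < c" "c < w" "0 < measure M {u<..<w} \<Longrightarrow> P c"
    "(\<integral>c. indicator {u<..<w} c * F c \<partial>M) \<le> F c * measure M {u<..<w}"
proof -
  let ?A = "{u<..<w}"
  have A: "?A \<inter> space M = ?A" using uw by (auto simp: space_M)
  have m_eq: "(\<integral>c. indicator ?A c \<partial>M) = measure M ?A" by (simp add: A)
  have "\<exists>c. u < c \<and> c < w \<and> (0 < measure M ?A \<longrightarrow> P c) \<and>
    (\<integral>c. indicator ?A c * F c \<partial>M) \<le> F c * measure M ?A"
  proof (cases "0 < measure M ?A")
    case False
    then have m0: "measure M ?A = 0" using measure_nonneg[of M ?A] by linarith
    then have "AE c in M. indicator ?A c = (0::real)"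
      using integral_nonneg_eq_0_iff_AE[of M "indicator ?A :: real \<Rightarrow> real"] m_eq by simp
    then have "(\<integral>c. indicator ?A c * F c \<partial>M) = (\<integral>c. 0 \<partial>M)"
      using F by (intro integral_cong_AE) (auto elim: eventually_mono)
    moreover obtain c where "u < c" "c < w" using dense[OF uw(2)] by blast
    ultimately show ?thesis using m0 by auto
  next
    case True
    let ?I = "\<integral>c. indicator ?A c * F c \<partial>M" and ?m = "measure M ?A"
    show ?thesis
    proof (rule ccontr)
      assume "\<not> ?thesis"
      then have less: "F c * ?m < ?I" if "u < c" "c < w" "P c" for c using that True by force
      have FA: "integrable M (\<lambda>c. indicator ?A c * F c)" by (intro integrable_indicator_mult F) auto
      have int: "integrable M (\<lambda>c. indicator ?A c * ?I - indicator ?A c * F c * ?m)"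
        using FA by (intro Bochner_Integration.integrable_diff integrable_mult_left integrable_indicator') auto
      have "(\<integral>c. indicator ?A c * ?I - indicator ?A c * F c * ?m \<partial>M) = ?m * ?I - ?I * ?m"
        using FA m_eq by (subst Bochner_Integration.integral_diff) (auto intro: integrable_mult_left integrable_indicator')
      then have zero: "(\<integral>c. indicator ?A c * ?I - indicator ?A c * F c * ?m \<partial>M) = 0" by simp
      have "AE c in M. 0 \<le> indicator ?A c * ?I - indicator ?A c * F c * ?m"
        using P by eventually_elim (auto simp: less split: split_indicator intro!: less_imp_le)
      from integral_nonneg_eq_0_iff_AE[OF int this] zero
      have "AE c in M. indicator ?A c * ?I - indicator ?A c * F c * ?m = 0" by blast
      then have "AE c in M. indicator ?A c = (0::real)"
        using P by eventually_elim (use less in \<open>force split: split_indicator\<close>)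
      then have "measure M ?A = 0"
        using integral_nonneg_eq_0_iff_AE[of M "indicator ?A :: real \<Rightarrow> real"] m_eq by simp
      with True show False by simp
    qed
  qed
  then show ?thesis using that by blast
qed

lemma threshold_le: "a \<le> u \<Longrightarrow> (\<And>c. c \<in> {a..b} \<Longrightarrow> y \<le> q c \<Longrightarrow> c \<le> u) \<Longrightarrow> threshold q y \<le> u"
  unfolding threshold_def by (intro cSup_least) auto

text \<open>The spliced profile can cross the level \<open>y\<close> in three ways: along
  \<open>q1\<close> after \<open>s\<close>, along \<open>q0\<close> before \<open>s\<close>, or by
  the downward jump at \<open>s\<close>.\<close>

lemma threshold_splice:
  assumes le: "a \<le> b" "s \<in> {a..b}"
    and q0: "\<And>x y. a \<le> x \<Longrightarrow> x \<le> y \<Longrightarrow> y \<le> b \<Longrightarrow> q0 y \<le> q0 x"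
    and q10: "\<And>x. x \<in> {a..b} \<Longrightarrow> q1 x \<le> q0 x"
  defines "q \<equiv> (\<lambda>c. if c < s then q0 c else q1 c)"
  shows "threshold q y \<in> {threshold q0 y, threshold q1 y, s}"
proof -
  note range = threshold_range[OF le(1)]
  let ?t = "threshold q y" and ?ta = "threshold q0 y" and ?tb = "threshold q1 y"
  have t1_t: "?tb \<le> ?t"
    by (intro threshold_le threshold_ge range) (use q10 in \<open>auto simp: q_def intro: order_trans\<close>)
  have t_t0: "?t \<le> ?ta"
    by (intro threshold_le threshold_ge range) (use q10 in \<open>auto simp: q_def split: if_splits intro: order_trans\<close>)
  consider "s < ?tb" | "?tb \<le> s" "s \<le> ?ta" | "?ta < s" by linarith
  then show ?thesis
  proof cases
    case 1
    have "?t \<le> ?tb"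
    proof (rule threshold_le[OF range(1)])
      fix c assume c: "c \<in> {a..b}" "y \<le> q c"
      then show "c \<le> ?tb" using 1 threshold_ge[of c y q1] by (auto simp: q_def split: if_splits)
    qed
    with t1_t show ?thesis by simp
  next
    case 2
    have "?t \<le> s"
    proof (rule threshold_le)
      fix c assume c: "c \<in> {a..b}" "y \<le> q c"
      then show "c \<le> s" using 2 threshold_ge[of c y q1] by (auto simp: q_def split: if_splits)
    qed (use le in auto)
    moreover have "s \<le> ?t"
    proof (cases "s = a")
      case False
      show ?thesis
      proof (rule dense_le_bounded[of a])
        fix c assume c: "a < c" "c < s"
        then have "y \<le> q0 c" using 2 le by (intro less_thresholdD[of q0 c y] q0) auto
        then show "c \<le> ?t" using c le by (intro threshold_ge) (auto simp: q_def)
      qed (use False le in auto)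
    qed (use range in simp)
    ultimately show ?thesis by simp
  next
    case 3
    have "?ta \<le> ?t"
    proof (rule threshold_le[OF range(1)])
      fix c assume c: "c \<in> {a..b}" "y \<le> q0 c"
      then have "c < s" using 3 threshold_ge[of c y q0] by auto
      then show "c \<le> ?t" using c by (intro threshold_ge) (auto simp: q_def)
    qed
    with t_t0 show ?thesis by simp
  qed
qed

end

section \<open>Splicing and pooling of cutoff rules\<close>

definition splice :: "real \<Rightarrow> (real \<Rightarrow> real) \<Rightarrow> (real \<Rightarrow> real) \<Rightarrow> real \<Rightarrow> real" where
  "splice s \<phi>0 \<phi>1 c = (if c < s then \<phi>0 c else \<phi>1 c)"

text \<open>With \<open>t = \<phi> u\<close> and \<open>t = \<phi> w\<close> these are the two
  outcomes of the lottery in a markup-pooling mechanism.\<close>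

definition pooled :: "real \<Rightarrow> real \<Rightarrow> real \<Rightarrow> (real \<Rightarrow> real) \<Rightarrow> real \<Rightarrow> real" where
  "pooled u w t \<phi> c = (if c \<in> {u..w} then t else \<phi> c)"

context bilateral_trade
begin

lemma splice_cutoffs:
  assumes "\<phi>0 \<in> cutoffs" "\<phi>1 \<in> cutoffs" "\<And>c. c \<in> {cl..ch} \<Longrightarrow> \<phi>0 c \<le> \<phi>1 c"
  shows "splice s \<phi>0 \<phi>1 \<in> cutoffs"
proof -
  have "splice s \<phi>0 \<phi>1 c \<le> splice s \<phi>0 \<phi>1 c'" if "c \<in> {cl..ch}" "c' \<in> {cl..ch}" "c \<le> c'" for c c'
    using mono_onD[OF cutoffsD(1)[OF assms(1)] that] mono_onD[OF cutoffsD(1)[OF assms(2)] that]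
      assms(3)[of c'] that by (auto simp: splice_def)
  then show ?thesis using cutoffsD(2)[OF assms(1)] cutoffsD(2)[OF assms(2)]
    by (auto simp: cutoffs_def splice_def intro!: mono_onI)
qed

lemma max_min_cutoffs:
  assumes "\<phi>0 \<in> cutoffs" "\<phi>1 \<in> cutoffs"
  shows "(\<lambda>c. max (\<phi>0 c) (\<phi>1 c)) \<in> cutoffs" "(\<lambda>c. min (\<phi>0 c) (\<phi>1 c)) \<in> cutoffs"
proof -
  have "max (\<phi>0 c) (\<phi>1 c) \<le> max (\<phi>0 c') (\<phi>1 c')" "min (\<phi>0 c) (\<phi>1 c) \<le> min (\<phi>0 c') (\<phi>1 c')"
    if "c \<in> {cl..ch}" "c' \<in> {cl..ch}" "c \<le> c'" for c c'
    using mono_onD[OF cutoffsD(1)[OF assms(1)] that] mono_onD[OF cutoffsD(1)[OF assms(2)] that]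
    by (auto simp: max_def min_def)
  then show "(\<lambda>c. max (\<phi>0 c) (\<phi>1 c)) \<in> cutoffs" "(\<lambda>c. min (\<phi>0 c) (\<phi>1 c)) \<in> cutoffs"
    using cutoffsD(2)[OF assms(1)] cutoffsD(2)[OF assms(2)]
    by (auto simp: cutoffs_def intro!: mono_onI simp: min_le_iff_disj le_max_iff_disj)
qed

end

context trade_objective
begin

lemma payoff_integrable:
  assumes \<phi>: "\<phi> \<in> cutoffs"
  shows "integrable GS (\<lambda>c. buyer_rev f1 f2 (\<phi> c))" "integrable LS (\<lambda>c. GB.sdf (\<phi> c) * g1 c)"
    "integrable GS (\<lambda>c. GB.sdf (\<phi> c) * g2 c)"
  using cutoffsD[OF \<phi>] sdf_cutoff(2)[OF \<phi>]
  by (auto intro!: integrable_buyer_rev integrable_weighted g1 g2 measurable_compose_sdf simp: GS.space_M LS.space_M)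

lemma payoff_cong_AE:
  assumes \<phi>: "\<phi> \<in> cutoffs" "\<phi>' \<in> cutoffs"
    and "AE c in GS. \<phi> c = \<phi>' c" "AE c in LS. GB.sdf (\<phi> c) = GB.sdf (\<phi>' c)"
  shows "payoff f1 f2 g1 g2 \<phi> = payoff f1 f2 g1 g2 \<phi>'"
proof -
  note i = payoff_integrable[OF \<phi>(1), THEN borel_measurable_integrable]
    payoff_integrable[OF \<phi>(2), THEN borel_measurable_integrable]
  have "(\<integral>c. buyer_rev f1 f2 (\<phi> c) \<partial>GS) = (\<integral>c. buyer_rev f1 f2 (\<phi>' c) \<partial>GS)"
    "(\<integral>c. GB.sdf (\<phi> c) * g2 c \<partial>GS) = (\<integral>c. GB.sdf (\<phi>' c) * g2 c \<partial>GS)"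
    "(\<integral>c. GB.sdf (\<phi> c) * g1 c \<partial>LS) = (\<integral>c. GB.sdf (\<phi>' c) * g1 c \<partial>LS)"
    using assms(3,4) i by (auto intro!: integral_cong_AE elim: eventually_mono)
  then show ?thesis by (simp add: payoff_def seller_int_def)
qed

text \<open>At each cost \<open>max\<close> and \<open>min\<close> merely exchange the two cutoffs.
  Together with the upper bound this makes the optimal rules a lattice, so that an ordered pair of
  optimal rules can be found.\<close>

lemma payoff_max_min:
  assumes \<phi>: "\<phi>0 \<in> cutoffs" "\<phi>1 \<in> cutoffs"
  shows "payoff f1 f2 g1 g2 (\<lambda>c. max (\<phi>0 c) (\<phi>1 c)) + payoff f1 f2 g1 g2 (\<lambda>c. min (\<phi>0 c) (\<phi>1 c))
    = payoff f1 f2 g1 g2 \<phi>0 + payoff f1 f2 g1 g2 \<phi>1"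
proof -
  note mm = max_min_cutoffs[OF \<phi>]
  note i0 = payoff_integrable[OF \<phi>(1)] and i1 = payoff_integrable[OF \<phi>(2)]
    and j0 = payoff_integrable[OF mm(1)] and j1 = payoff_integrable[OF mm(2)]
  have eq: "F (max (\<phi>0 c) (\<phi>1 c)) + F (min (\<phi>0 c) (\<phi>1 c)) = F (\<phi>0 c) + F (\<phi>1 c)" for F :: "real \<Rightarrow> real" and c
    by (auto simp: max_def min_def)
  have "(\<integral>c. buyer_rev f1 f2 (max (\<phi>0 c) (\<phi>1 c)) \<partial>GS) + (\<integral>c. buyer_rev f1 f2 (min (\<phi>0 c) (\<phi>1 c)) \<partial>GS)
    = (\<integral>c. buyer_rev f1 f2 (\<phi>0 c) \<partial>GS) + (\<integral>c. buyer_rev f1 f2 (\<phi>1 c) \<partial>GS)"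
    using i0 i1 j0 j1 eq[of "buyer_rev f1 f2"] by (simp flip: Bochner_Integration.integral_add)
  moreover have "(\<integral>c. GB.sdf (max (\<phi>0 c) (\<phi>1 c)) * g1 c \<partial>LS) + (\<integral>c. GB.sdf (min (\<phi>0 c) (\<phi>1 c)) * g1 c \<partial>LS)
    = (\<integral>c. GB.sdf (\<phi>0 c) * g1 c \<partial>LS) + (\<integral>c. GB.sdf (\<phi>1 c) * g1 c \<partial>LS)"
    using i0 i1 j0 j1 eq[of GB.sdf] by (simp flip: Bochner_Integration.integral_add distrib_right)
  moreover have "(\<integral>c. GB.sdf (max (\<phi>0 c) (\<phi>1 c)) * g2 c \<partial>GS) + (\<integral>c. GB.sdf (min (\<phi>0 c) (\<phi>1 c)) * g2 c \<partial>GS)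
    = (\<integral>c. GB.sdf (\<phi>0 c) * g2 c \<partial>GS) + (\<integral>c. GB.sdf (\<phi>1 c) * g2 c \<partial>GS)"
    using i0 i1 j0 j1 eq[of GB.sdf] by (simp flip: Bochner_Integration.integral_add distrib_right)
  ultimately show ?thesis by (simp add: payoff_def seller_int_def)
qed

lemma continuous_payoff_splice:
  assumes \<phi>: "\<phi>0 \<in> cutoffs" "\<phi>1 \<in> cutoffs" 
  shows "continuous_on UNIV (\<lambda>s. payoff f1 f2 g1 g2 (splice s \<phi>0 \<phi>1))"
proof -
  note i0 = payoff_integrable[OF \<phi>(1)] and i1 = payoff_integrable[OF \<phi>(2)]
  have split: "F (splice s \<phi>0 \<phi>1 c) * g = F (\<phi>0 c) * g + indicator {s..} c * (F (\<phi>1 c) * g - F (\<phi>0 c) * g)"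
    for F :: "real \<Rightarrow> real" and s c g by (auto simp: splice_def)
  have split1: "F (splice s \<phi>0 \<phi>1 c) = F (\<phi>0 c) + indicator {s..} c * (F (\<phi>1 c) - F (\<phi>0 c))"
    for F :: "real \<Rightarrow> real" and s c by (auto simp: splice_def)
  have d: "integrable GS (\<lambda>c. buyer_rev f1 f2 (\<phi>1 c) - buyer_rev f1 f2 (\<phi>0 c))"
    "integrable LS (\<lambda>c. GB.sdf (\<phi>1 c) * g1 c - GB.sdf (\<phi>0 c) * g1 c)"
    "integrable GS (\<lambda>c. GB.sdf (\<phi>1 c) * g2 c - GB.sdf (\<phi>0 c) * g2 c)"
    using i0 i1 by auto
  have "payoff f1 f2 g1 g2 (splice s \<phi>0 \<phi>1) = payoff f1 f2 g1 g2 \<phi>0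
     + (\<integral>c. indicator {s..} c * (buyer_rev f1 f2 (\<phi>1 c) - buyer_rev f1 f2 (\<phi>0 c)) \<partial>GS)
     + (\<integral>c. indicator {s..} c * (GB.sdf (\<phi>1 c) * g1 c - GB.sdf (\<phi>0 c) * g1 c) \<partial>LS)
     + (\<integral>c. indicator {s..} c * (GB.sdf (\<phi>1 c) * g2 c - GB.sdf (\<phi>0 c) * g2 c) \<partial>GS)" for s
    unfolding payoff_def seller_int_def split split1[of "buyer_rev f1 f2"]
    using i0 d GS.integrable_indicator_mult[OF d(1), of "{s..}"] LS.integrable_indicator_mult[OF d(2), of "{s..}"]
      GS.integrable_indicator_mult[OF d(3), of "{s..}"] by simp
  then show ?thesis
    using GS.continuous_integral_atLeast[OF d(1)] LS.continuous_integral_atLeast[OF d(2)] GS.continuous_integral_atLeast[OF d(3)]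
    by (auto intro!: continuous_on_add)
qed

text \<open>The seller's term sees a cutoff only through \<open>GB.sdf\<close>, which is unchanged.
  The buyer's revenue can still move while \<open>GB.sdf\<close> is constant, because rents also
  accrue in gaps of the support.\<close>

lemma payoff_pooled:
  assumes \<psi>: "\<psi> \<in> cutoffs" "\<psi>' \<in> cutoffs" and uw: "cl \<le> u" "u < w" "w \<le> ch"
    and off: "\<And>c. c \<notin> {u..w} \<Longrightarrow> \<psi>' c = \<psi> c"
    and on: "\<And>c. u < c \<Longrightarrow> c < w \<Longrightarrow> \<psi>' c = \<kappa> \<and> GB.sdf (\<psi> c) = GB.sdf \<kappa>"
  shows "payoff f1 f2 g1 g2 \<psi>' = payoff f1 f2 g1 g2 \<psi> + buyer_rev f1 f2 \<kappa> * measure GS {u<..<w}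
    - (\<integral>c. indicator {u<..<w} c * buyer_rev f1 f2 (\<psi> c) \<partial>GS)"
proof -
  note i = payoff_integrable[OF \<psi>(1)] and j = payoff_integrable[OF \<psi>(2)]
  have sdf_eq: "GB.sdf (\<psi>' c) = GB.sdf (\<psi> c)" if "c \<noteq> u" "c \<noteq> w" for c
    using off[of c] on[of c] that by (cases "c \<in> {u..w}") auto
  have "seller_int g1 g2 (\<lambda>c. GB.sdf (\<psi>' c)) = seller_int g1 g2 (\<lambda>c. GB.sdf (\<psi> c))"
  proof -
    have "AE c in LS. GB.sdf (\<psi>' c) * g1 c = GB.sdf (\<psi> c) * g1 c"
      using LS.AE_neq[of u] LS.AE_neq[of w] by eventually_elim (simp add: sdf_eq)
    moreover have "AE c in GS. GB.sdf (\<psi>' c) * g2 c = GB.sdf (\<psi> c) * g2 c"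
      using GS.AE_neq[of u] GS.AE_neq[of w] by eventually_elim (simp add: sdf_eq)
    ultimately show ?thesis unfolding seller_int_def using i j
      by (intro arg_cong2[where f="(+)"] integral_cong_AE) auto
  qed
  moreover have "(\<integral>c. buyer_rev f1 f2 (\<psi>' c) \<partial>GS) = (\<integral>c. buyer_rev f1 f2 (\<psi> c) \<partial>GS)
     + buyer_rev f1 f2 \<kappa> * measure GS {u<..<w} - (\<integral>c. indicator {u<..<w} c * buyer_rev f1 f2 (\<psi> c) \<partial>GS)"
  proof -
    let ?A = "{u<..<w}"
    have iA: "integrable GS (\<lambda>c. indicator ?A c * buyer_rev f1 f2 (\<psi> c))" by (intro GS.integrable_indicator_mult i) auto
    have iB: "integrable GS (\<lambda>c. indicator ?A c * buyer_rev f1 f2 \<kappa>)" by (intro GS.integrable_indicator_mult) auto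
    have "(\<integral>c. buyer_rev f1 f2 (\<psi>' c) \<partial>GS) = (\<integral>c. buyer_rev f1 f2 (\<psi> c)
      + indicator ?A c * buyer_rev f1 f2 \<kappa> - indicator ?A c * buyer_rev f1 f2 (\<psi> c) \<partial>GS)"
    proof (rule integral_cong_AE)
      show "AE c in GS. buyer_rev f1 f2 (\<psi>' c) = buyer_rev f1 f2 (\<psi> c)
        + indicator ?A c * buyer_rev f1 f2 \<kappa> - indicator ?A c * buyer_rev f1 f2 (\<psi> c)"
        using GS.AE_neq[of u] GS.AE_neq[of w]
      proof eventually_elim
        case (elim c)
        then show ?case using off[of c] on[of c] by (cases "c \<in> {u..w}") auto
      qed
    qed (use i j iA iB in auto)
    also have "\<dots> = (\<integral>c. buyer_rev f1 f2 (\<psi> c) \<partial>GS) + (\<integral>c. indicator ?A c * buyer_rev f1 f2 \<kappa> \<partial>GS)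
      - (\<integral>c. indicator ?A c * buyer_rev f1 f2 (\<psi> c) \<partial>GS)"
      using i iA iB by simp
    also have "(\<integral>c. indicator ?A c * buyer_rev f1 f2 \<kappa> \<partial>GS) = buyer_rev f1 f2 \<kappa> * measure GS ?A"
    proof -
      have "?A \<inter> space GS = ?A" using uw by (auto simp: GS.space_M)
      then show ?thesis by simp
    qed
    finally show ?thesis .
  qed
  ultimately show ?thesis by (simp add: payoff_def)
qed

lemma optimalD:
  assumes "\<phi> \<in> cutoffs" "payoff f1 f2 g1 g2 \<phi> = bound"
  shows "AE c in GS. slack \<phi> c = 0"
    "AE y in restrict_space lborel {0..1}. gap (GS.threshold (\<lambda>c. GB.sdf (\<phi> c)) y) = 0"
  using payoff_eq_bound_iff[OF assms(1)] assms(2) by auto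

text \<open>\<open>slack\<close> is local in the cost, so splicing keeps it at zero. By
  \<open>threshold_splice\<close> every threshold of the splice is one of the two rules' or
  \<open>s\<close> itself, and \<open>gap\<close> vanishes at almost all of the former and at
  \<open>s\<close>.\<close>

lemma splice_optimal:
  assumes \<phi>: "\<phi>0 \<in> cutoffs" "\<phi>1 \<in> cutoffs" and le: "\<And>c. c \<in> {cl..ch} \<Longrightarrow> \<phi>0 c \<le> \<phi>1 c"
    and opt: "payoff f1 f2 g1 g2 \<phi>0 = bound" "payoff f1 f2 g1 g2 \<phi>1 = bound"
    and s: "s \<in> {cl..ch}" "gap s = 0"
  shows "payoff f1 f2 g1 g2 (splice s \<phi>0 \<phi>1) = bound"
proof -
  note o0 = optimalD[OF \<phi>(1) opt(1)] and o1 = optimalD[OF \<phi>(2) opt(2)]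
  have "AE c in GS. slack (splice s \<phi>0 \<phi>1) c = 0"
    using o0(1) o1(1) by eventually_elim (auto simp: slack_def splice_def)
  moreover have "AE y in restrict_space lborel {0..1}. gap (GS.threshold (\<lambda>c. GB.sdf (splice s \<phi>0 \<phi>1 c)) y) = 0"
    using o0(2) o1(2)
  proof eventually_elim
    case (elim y)
    have eq: "(\<lambda>c. GB.sdf (splice s \<phi>0 \<phi>1 c)) = (\<lambda>c. if c < s then GB.sdf (\<phi>0 c) else GB.sdf (\<phi>1 c))"
      by (auto simp: splice_def)
    have "GS.threshold (\<lambda>c. GB.sdf (splice s \<phi>0 \<phi>1 c)) y \<in>
      {GS.threshold (\<lambda>c. GB.sdf (\<phi>0 c)) y, GS.threshold (\<lambda>c. GB.sdf (\<phi>1 c)) y, s}"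
      unfolding eq by (rule GS.threshold_splice)
        (use GS.a_le_b s sdf_cutoff(1)[OF \<phi>(1)] GB.sdf_antimono[OF le] in auto)
    then show ?case using elim s by auto
  qed
  ultimately show ?thesis using payoff_eq_bound_iff[OF splice_cutoffs[OF \<phi> le]] by blast
qed

text \<open>A fall of the trade probability between \<open>c\<close> and \<open>c'\<close> would
  send a whole interval of levels to thresholds inside \<open>{c..c'}\<close>, while almost every
  threshold of an optimal rule is a contact point.\<close>

lemma optimal_constant_off_contact:
  assumes \<phi>: "\<phi> \<in> cutoffs" "payoff f1 f2 g1 g2 \<phi> = bound"
    and c: "cl \<le> c" "c \<le> c'" "c' \<le> ch" and off: "\<And>s. s \<in> {c..c'} \<Longrightarrow> gap s \<noteq> 0"
  shows "GB.sdf (\<phi> c) = GB.sdf (\<phi> c')"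
proof (rule ccontr)
  let ?q = "\<lambda>c. GB.sdf (\<phi> c)"
  assume "?q c \<noteq> ?q c'"
  then have "?q c' < ?q c" using sdf_cutoff(1)[OF \<phi>(1) c] by simp
  moreover have "0 \<le> ?q c'" "?q c \<le> 1" using GB.sdf_nonneg sdf_le_1 by auto
  ultimately obtain y where y: "?q c' < y" "y \<le> ?q c" "gap (GS.threshold ?q y) = 0"
    using AE_unit_interval_obtain[OF optimalD(2)[OF \<phi>]] by metis
  have "c \<le> GS.threshold ?q y" using c y by (intro GS.threshold_ge) auto
  moreover have "GS.threshold ?q y \<le> c'"
  proof (rule GS.threshold_le)
    fix d assume d: "d \<in> {cl..ch}" "y \<le> ?q d"
    show "d \<le> c'"
    proof (rule ccontr)
      assume "\<not> d \<le> c'"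
      then have "?q d \<le> ?q c'" using c d by (intro sdf_cutoff(1)[OF \<phi>(1)]) auto
      with y d show False by simp
    qed
  qed (use c in auto)
  ultimately show False using off y(3) by auto
qed

lemma slopes_constant_off_contact:
  assumes "c \<le> c'" "\<And>s. s \<in> {c..c'} \<Longrightarrow> gap s \<noteq> 0"
  shows "seller.slopes c = seller.slopes c'"
proof (rule ccontr)
  assume "seller.slopes c \<noteq> seller.slopes c'"
  then obtain m where "m \<in> seller.slopes c" "m \<notin> seller.slopes c'" using seller.slopes_antimono[OF assms(1)] by blast
  then show False using assms(2)[of "seller.last_argmax m"] gap_last_argmax[of m] by (auto simp: seller.slopes_def)
qed

text \<open>Off the contact set the trade probability and the ironed slope are both constant, and
  zero slack then fixes the buyer's revenue. The cutoff itself may still move inside a gap of the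
  support of \<open>GB\<close>, so constancy is claimed for the revenue only.\<close>

lemma optimal_rev_constant:
  assumes \<phi>: "\<phi> \<in> cutoffs" "payoff f1 f2 g1 g2 \<phi> = bound"
    and uw: "cl \<le> u" "u < w" "w \<le> ch" and off: "\<And>s. u < s \<Longrightarrow> s < w \<Longrightarrow> gap s \<noteq> 0"
  obtains \<eta> where "AE c in GS. c \<in> {u<..<w} \<longrightarrow> buyer_rev f1 f2 (\<phi> c) = \<eta>"
proof -
  define mid where "mid = (u + w) / 2"
  have mid: "u < mid" "mid < w" using uw by (auto simp: mid_def)
  have const: "GB.sdf (\<phi> c) = GB.sdf (\<phi> mid)" "seller.slopes c = seller.slopes mid" if "u < c" "c < w" for c
  proof -
    have *: "gap s \<noteq> 0" if "s \<in> {min c mid..max c mid}" for s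
      using off[of s] that mid \<open>u < c\<close> \<open>c < w\<close> by (cases "c \<le> mid") auto
    show "GB.sdf (\<phi> c) = GB.sdf (\<phi> mid)"
    proof (cases "c \<le> mid")
      case True
      then show ?thesis using * uw mid that by (intro optimal_constant_off_contact[OF \<phi>]) auto
    next
      case False
      then show ?thesis using * uw mid that by (intro optimal_constant_off_contact[OF \<phi>, symmetric]) auto
    qed
    show "seller.slopes c = seller.slopes mid"
    proof (cases "c \<le> mid")
      case True
      then show ?thesis using * by (intro slopes_constant_off_contact) auto
    next
      case False
      then show ?thesis using * by (intro slopes_constant_off_contact[symmetric]) auto
    qed
  qed
  let ?b = "seller.slope mid"
  have "AE c in GS. c \<in> {u<..<w} \<longrightarrow> buyer_rev f1 f2 (\<phi> c) = buyer.conjugate ?b + ?b - GB.sdf (\<phi> mid) * ?b"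
    using optimalD(1)[OF \<phi>] GS.AE_cdf_interior
  proof eventually_elim
    case (elim c)
    show ?case
    proof
      assume "c \<in> {u<..<w}"
      then have "GB.sdf (\<phi> c) = GB.sdf (\<phi> mid)" "seller.density c = ?b"
        using const[of c] elim by (auto simp: seller.density_def seller.slope_def)
      then show "buyer_rev f1 f2 (\<phi> c) = buyer.conjugate ?b + ?b - GB.sdf (\<phi> mid) * ?b"
        using elim by (simp add: slack_def pointwise_max_def)
    qed
  qed
  then show ?thesis by (rule that)
qed

end

lemma (in atomless_on) integral_indicator_AE_const:
  assumes F: "integrable M F" and const: "AE c in M. c \<in> A \<longrightarrow> F c = \<eta>" and A: "A \<in> sets borel" "A \<subseteq> {a..b}"
    and x: "0 < measure M A \<Longrightarrow> x = \<eta>"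
  shows "(\<integral>c. indicator A c * F c \<partial>M) = x * measure M A"
proof -
  have "(\<integral>c. indicator A c * F c \<partial>M) = (\<integral>c. indicator A c * \<eta> \<partial>M)"
  proof (rule integral_cong_AE)
    show "AE c in M. indicator A c * F c = indicator A c * \<eta>"
      using const by eventually_elim (auto split: split_indicator)
    show "(\<lambda>c. indicator A c * F c) \<in> borel_measurable M" "(\<lambda>c. indicator A c * \<eta>) \<in> borel_measurable M"
      using integrable_indicator_mult[OF F A(1)] integrable_indicator_mult[of "\<lambda>_. \<eta>", OF _ A(1)] by auto
  qed
  also have "\<dots> = measure M A * \<eta>"
  proof -
    have "A \<inter> space M = A" using A(2) by (auto simp: space_M)
    then show ?thesis by simp
  qed
  also have "\<dots> = x * measure M A"
    using x measure_nonneg[of M A] by (cases "measure M A = 0") (auto simp: less_le)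
  finally show ?thesis .
qed

lemma pooled_same: "pooled u u (\<phi> u) \<phi> = \<phi>"
  by (auto simp: pooled_def)

section \<open>Mixing two optimal rules so that a second objective vanishes\<close>

context trade_objective
begin

text \<open>Splicing at \<open>s\<close> leads from \<open>\<phi>1\<close> at \<open>cl\<close> to
  \<open>\<phi>0\<close> at \<open>ch\<close>, and \<open>S\<close> collects the \<open>s\<close>
  for which the splice is optimal. If the second objective jumps over zero across a hole of
  \<open>S\<close>, each rule is replaced there by a constant cutoff. The constants have to be
  chosen with care: inside gaps of the support the original cutoffs can vary and affect the second
  objective although their trade probabilities agree.\<close>

lemma optimal_pooled_mixture_ordered:
  assumes C: "trade_objective GB GS vl vh cl ch h1 h2 k1 k2"
    and \<phi>: "\<phi>0 \<in> cutoffs" "\<phi>1 \<in> cutoffs" and le: "\<And>c. c \<in> {cl..ch} \<Longrightarrow> \<phi>0 c \<le> \<phi>1 c"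
    and opt: "payoff f1 f2 g1 g2 \<phi>0 = bound" "payoff f1 f2 g1 g2 \<phi>1 = bound"
    and sign: "payoff h1 h2 k1 k2 \<phi>0 * payoff h1 h2 k1 k2 \<phi>1 \<le> 0"
  shows "\<exists>\<phi> u w k. \<phi> \<in> cutoffs \<and> cl \<le> u \<and> u \<le> w \<and> w \<le> ch \<and> 0 \<le> k \<and> k \<le> 1 \<and>
    pooled u w (\<phi> u) \<phi> \<in> cutoffs \<and> pooled u w (\<phi> w) \<phi> \<in> cutoffs \<and>
    payoff f1 f2 g1 g2 (pooled u w (\<phi> u) \<phi>) = bound \<and> payoff f1 f2 g1 g2 (pooled u w (\<phi> w) \<phi>) = bound \<and>
    k * payoff h1 h2 k1 k2 (pooled u w (\<phi> u) \<phi>) + (1 - k) * payoff h1 h2 k1 k2 (pooled u w (\<phi> w) \<phi>) = 0"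
proof -
  interpret C: trade_objective GB GS vl vh cl ch h1 h2 k1 k2 by (rule C)
  define Q where "Q s = payoff h1 h2 k1 k2 (splice s \<phi>0 \<phi>1)" for s
  define S where "S = {cl..ch} \<inter> {s. payoff f1 f2 g1 g2 (splice s \<phi>0 \<phi>1) = bound}"
  note sc = splice_cutoffs[OF \<phi> le]
  have S_closed: "closed S" unfolding S_def
    by (intro closed_Int closed_Collect_eq continuous_payoff_splice \<phi> continuous_on_const closed_atLeastAtMost)
  have at_cl: "AE c in GS. splice cl \<phi>0 \<phi>1 c = \<phi>1 c" "AE c in LS. GB.sdf (splice cl \<phi>0 \<phi>1 c) = GB.sdf (\<phi>1 c)"
    by (auto intro!: AE_I2 simp: GS.space_M LS.space_M splice_def)
  have at_ch: "AE c in GS. splice ch \<phi>0 \<phi>1 c = \<phi>0 c" "AE c in LS. GB.sdf (splice ch \<phi>0 \<phi>1 c) = GB.sdf (\<phi>0 c)"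
    using GS.AE_neq[of ch] LS.AE_neq[of ch] AE_space[of GS] AE_space[of LS]
    by (auto elim!: eventually_elim2 simp: GS.space_M LS.space_M splice_def)
  have "cl \<in> S" "ch \<in> S"
    using payoff_cong_AE[OF sc \<phi>(2) at_cl] payoff_cong_AE[OF sc \<phi>(1) at_ch] opt GS.a_le_b by (auto simp: S_def)
  have Q_cl: "Q cl = payoff h1 h2 k1 k2 \<phi>1" and Q_ch: "Q ch = payoff h1 h2 k1 k2 \<phi>0"
    unfolding Q_def using C.payoff_cong_AE[OF sc \<phi>(2) at_cl] C.payoff_cong_AE[OF sc \<phi>(1) at_ch] by auto
  \<comment> \<open>The sign \<open>e\<close> orients the change from nonpositive to nonnegative, as
    \<open>closed_sign_change\<close> expects.\<close>
  obtain e :: real where e: "e = 1 \<or> e = - 1" "e * Q cl \<le> 0" "0 \<le> e * Q ch"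
  proof (cases "Q cl \<le> 0 \<and> 0 \<le> Q ch")
    case True
    then show ?thesis by (intro that[of 1]) auto
  next
    case False
    then have "0 \<le> Q cl" "Q ch \<le> 0" using sign unfolding Q_cl Q_ch by (auto simp: mult_le_0_iff)
    then show ?thesis by (intro that[of "-1"]) auto
  qed
  have Q_cont: "continuous_on UNIV (\<lambda>s. e * Q s)"
    unfolding Q_def by (intro continuous_intros C.continuous_payoff_splice \<phi>)
  from closed_sign_change[OF S_closed _ \<open>cl \<in> S\<close> \<open>ch \<in> S\<close> Q_cont e(2,3) GS.a_le_b]
  consider s where "s \<in> S" "e * Q s = 0"
    | u w where "u \<in> S" "w \<in> S" "u < w" "{u<..<w} \<inter> S = {}" "e * Q u < 0" "0 < e * Q w"
    by (auto simp: S_def)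
  then show ?thesis
  proof cases
    case 1
    then have "Q s = 0" using e(1) by auto
    then show ?thesis using 1 sc[of s] GS.a_le_b
      by (intro exI[of _ "splice s \<phi>0 \<phi>1"] exI[of _ cl] exI[of _ cl] exI[of _ 1])
        (auto simp: S_def Q_def pooled_same)
  next
    case 2
    have uw: "cl \<le> u" "u < w" "w \<le> ch" using 2 by (auto simp: S_def)
    have no_contact: "gap s \<noteq> 0" if "u < s" "s < w" for s
      using splice_optimal[OF \<phi> le opt, of s] 2(4) that uw by (auto simp: S_def)
    define mid where "mid = (u + w) / 2"
    have mid: "u < mid" "mid < w" using uw by (auto simp: mid_def)
    have const: "GB.sdf (\<phi> c) = GB.sdf (\<phi> mid)"
      if "\<phi> \<in> cutoffs" "payoff f1 f2 g1 g2 \<phi> = bound" "u < c" "c < w" for \<phi> c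
    proof (cases "c \<le> mid")
      case True
      then show ?thesis using no_contact uw mid that by (intro optimal_constant_off_contact) auto
    next
      case False
      then show ?thesis using no_contact uw mid that by (intro optimal_constant_off_contact[symmetric]) auto
    qed
    note const0 = const[OF \<phi>(1) opt(1)] and const1 = const[OF \<phi>(2) opt(2)]
    \<comment> \<open>With equal trade probabilities, splicing at \<open>mid\<close> and at
      \<open>w\<close> would give the same thresholds, so the splice at \<open>mid\<close> would be
      optimal and \<open>mid\<close> would lie in the hole of \<open>S\<close>. The inequality is
      what orders the constants \<kappa>0 and \<kappa>1.\<close>
    have ne: "GB.sdf (\<phi>0 mid) \<noteq> GB.sdf (\<phi>1 mid)"
    proof
      assume eq: "GB.sdf (\<phi>0 mid) = GB.sdf (\<phi>1 mid)"
      have "GB.sdf (splice mid \<phi>0 \<phi>1 c) = GB.sdf (splice w \<phi>0 \<phi>1 c)" for c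
        using const0[of c] const1[of c] eq mid by (auto simp: splice_def)
      moreover have "AE y in restrict_space lborel {0..1}. gap (GS.threshold (\<lambda>c. GB.sdf (splice w \<phi>0 \<phi>1 c)) y) = 0"
        using optimalD(2)[OF sc] 2(2) by (simp add: S_def)
      moreover have "AE c in GS. slack (splice mid \<phi>0 \<phi>1) c = 0"
        using optimalD(1)[OF \<phi>(1) opt(1)] optimalD(1)[OF \<phi>(2) opt(2)]
        by eventually_elim (auto simp: slack_def splice_def)
      ultimately have "payoff f1 f2 g1 g2 (splice mid \<phi>0 \<phi>1) = bound"
        using payoff_eq_bound_iff[OF sc] by simp
      then have "mid \<in> {u<..<w} \<inter> S" using mid uw by (auto simp: S_def)
      with 2(4) show False by blast
    qed
    have A: "{u<..<w} \<subseteq> {cl..ch}" using uw by auto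
    let ?m = "measure GS {u<..<w}"
    obtain \<eta>0 where \<eta>0: "AE c in GS. c \<in> {u<..<w} \<longrightarrow> buyer_rev f1 f2 (\<phi>0 c) = \<eta>0"
      using optimal_rev_constant[OF \<phi>(1) opt(1) uw no_contact] by blast
    obtain \<eta>1 where \<eta>1: "AE c in GS. c \<in> {u<..<w} \<longrightarrow> buyer_rev f1 f2 (\<phi>1 c) = \<eta>1"
      using optimal_rev_constant[OF \<phi>(2) opt(2) uw no_contact] by blast
    have i0: "integrable GS (\<lambda>c. e * buyer_rev h1 h2 (\<phi>0 c))" and i1: "integrable GS (\<lambda>c. - e * buyer_rev h1 h2 (\<phi>1 c))"
      using C.payoff_integrable(1)[OF \<phi>(1)] C.payoff_integrable(1)[OF \<phi>(2)] by auto
    \<comment> \<open>\<open>c0\<close> is picked where \<open>e\<close> times the second revenue is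
      at least its average, and \<open>c1\<close> where it is at most its average. Flattening to the
      cutoffs at these points then preserves the strict signs at \<open>w\<close> and
      \<open>u\<close>.\<close>
    obtain c0 where c0: "u < c0" "c0 < w" "0 < ?m \<Longrightarrow> buyer_rev f1 f2 (\<phi>0 c0) = \<eta>0"
      "(\<integral>c. indicator {u<..<w} c * (e * buyer_rev h1 h2 (\<phi>0 c)) \<partial>GS) \<le> e * buyer_rev h1 h2 (\<phi>0 c0) * ?m"
      using GS.exists_ge_average[OF i0 uw \<eta>0] by blast
    obtain c1 where c1: "u < c1" "c1 < w" "0 < ?m \<Longrightarrow> buyer_rev f1 f2 (\<phi>1 c1) = \<eta>1"
      "(\<integral>c. indicator {u<..<w} c * (- e * buyer_rev h1 h2 (\<phi>1 c)) \<partial>GS) \<le> - e * buyer_rev h1 h2 (\<phi>1 c1) * ?m"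
      using GS.exists_ge_average[OF i1 uw \<eta>1] by blast
    define \<kappa>0 \<kappa>1 where "\<kappa>0 = \<phi>0 c0" and "\<kappa>1 = \<phi>1 c1"
    have "GB.sdf (\<phi>1 mid) \<le> GB.sdf (\<phi>0 mid)" using le mid uw by (intro GB.sdf_antimono) auto
    then have "GB.sdf \<kappa>1 < GB.sdf \<kappa>0" using ne const0[of c0] const1[of c1] c0 c1 by (simp add: \<kappa>0_def \<kappa>1_def)
    then have \<kappa>: "\<kappa>0 \<le> \<kappa>1" using GB.sdf_antimono[of \<kappa>1 \<kappa>0] by (cases "\<kappa>0 \<le> \<kappa>1") auto
    have \<kappa>0_ge: "\<phi>0 c \<le> \<kappa>0" if "cl \<le> c" "c < u" for c
      unfolding \<kappa>0_def using that c0 uw by (intro mono_onD[OF cutoffsD(1)[OF \<phi>(1)]]) auto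
    have \<kappa>1_le: "\<kappa>1 \<le> \<phi>1 c" if "w < c" "c \<le> ch" for c
      unfolding \<kappa>1_def using that c1 uw by (intro mono_onD[OF cutoffsD(1)[OF \<phi>(2)]]) auto
    have \<kappa>_range: "vl \<le> \<kappa>0" "\<kappa>1 \<le> vh"
      using cutoffsD(2)[OF \<phi>(1), of c0] cutoffsD(2)[OF \<phi>(2), of c1] c0 c1 uw by (auto simp: \<kappa>0_def \<kappa>1_def)
    \<comment> \<open>In \<open>st \<kappa>0 \<kappa>1\<close> the value at \<open>u\<close> is
      \<kappa>0 and the value at \<open>w\<close> is \<kappa>1, so pooling it at its own end values
      yields exactly the two flattened rules.\<close>
    define st where "st x y c = (if c < u then \<phi>0 c else if c < w then x else if c = w then y else \<phi>1 c)" for x y c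
    have st_cutoffs: "st x y \<in> cutoffs" if xy: "\<kappa>0 \<le> x" "x \<le> y" "y \<le> \<kappa>1" for x y
    proof -
      have "st x y c \<le> st x y c'" if c: "c \<in> {cl..ch}" "c' \<in> {cl..ch}" "c \<le> c'" for c c'
        using mono_onD[OF cutoffsD(1)[OF \<phi>(1)] c] mono_onD[OF cutoffsD(1)[OF \<phi>(2)] c]
          \<kappa>0_ge[of c] \<kappa>1_le[of c'] c xy uw by (auto simp: st_def)
      moreover have "st x y c \<in> {vl..vh}" if "c \<in> {cl..ch}" for c
        using cutoffsD(2)[OF \<phi>(1) that] cutoffsD(2)[OF \<phi>(2) that] xy \<kappa>_range by (auto simp: st_def)
      ultimately show ?thesis by (auto simp: cutoffs_def intro!: mono_onI)
    qed
    let ?\<phi> = "st \<kappa>0 \<kappa>1"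
    have pooled_eq: "pooled u w (?\<phi> u) ?\<phi> = st \<kappa>0 \<kappa>0" "pooled u w (?\<phi> w) ?\<phi> = st \<kappa>1 \<kappa>1"
      using uw by (auto simp: pooled_def st_def fun_eq_iff)
    have on0: "st \<kappa>0 \<kappa>0 c = \<kappa>0 \<and> GB.sdf (splice w \<phi>0 \<phi>1 c) = GB.sdf \<kappa>0"
      and on1: "st \<kappa>1 \<kappa>1 c = \<kappa>1 \<and> GB.sdf (splice u \<phi>0 \<phi>1 c) = GB.sdf \<kappa>1" if "u < c" "c < w" for c
      using that const0[of c] const1[of c] const0[of c0] const1[of c1] c0 c1
      by (auto simp: st_def splice_def \<kappa>0_def \<kappa>1_def)
    have off0: "st \<kappa>0 \<kappa>0 c = splice w \<phi>0 \<phi>1 c" and off1: "st \<kappa>1 \<kappa>1 c = splice u \<phi>0 \<phi>1 c" if "c \<notin> {u..w}" for c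
      using that uw by (auto simp: st_def splice_def)
    have ind0: "indicator {u<..<w} c * F (splice w \<phi>0 \<phi>1 c) = indicator {u<..<w} c * (F (\<phi>0 c) :: real)"
      and ind1: "indicator {u<..<w} c * F (splice u \<phi>0 \<phi>1 c) = indicator {u<..<w} c * (F (\<phi>1 c) :: real)" for F c
      by (auto simp: splice_def split: split_indicator)
    have cut: "st \<kappa>0 \<kappa>0 \<in> cutoffs" "st \<kappa>1 \<kappa>1 \<in> cutoffs" "?\<phi> \<in> cutoffs" using \<kappa> by (auto intro!: st_cutoffs)
    have L0: "payoff f1 f2 g1 g2 (st \<kappa>0 \<kappa>0) = bound"
    proof -
      have "(\<integral>c. indicator {u<..<w} c * buyer_rev f1 f2 (\<phi>0 c) \<partial>GS) = buyer_rev f1 f2 \<kappa>0 * ?m"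
        using c0(3) by (intro GS.integral_indicator_AE_const[OF payoff_integrable(1)[OF \<phi>(1)] \<eta>0 _ A])
          (simp_all add: \<kappa>0_def)
      then show ?thesis
        using payoff_pooled[OF sc cut(1) uw off0 on0] 2(2) by (simp add: S_def ind0)
    qed
    have L1: "payoff f1 f2 g1 g2 (st \<kappa>1 \<kappa>1) = bound"
    proof -
      have "(\<integral>c. indicator {u<..<w} c * buyer_rev f1 f2 (\<phi>1 c) \<partial>GS) = buyer_rev f1 f2 \<kappa>1 * ?m"
        using c1(3) by (intro GS.integral_indicator_AE_const[OF payoff_integrable(1)[OF \<phi>(2)] \<eta>1 _ A])
          (simp_all add: \<kappa>1_def)
      then show ?thesis
        using payoff_pooled[OF sc cut(2) uw off1 on1] 2(1) by (simp add: S_def ind1)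
    qed
    let ?C0 = "payoff h1 h2 k1 k2 (st \<kappa>0 \<kappa>0)" and ?C1 = "payoff h1 h2 k1 k2 (st \<kappa>1 \<kappa>1)"
    have pull: "(\<integral>c. indicator {u<..<w} c * (d * F c) \<partial>GS) = d * (\<integral>c. indicator {u<..<w} c * F c \<partial>GS)" for d :: real and F
      by (simp add: mult.left_commute)
    have C0: "0 < e * ?C0"
    proof -
      have eq: "?C0 = Q w + buyer_rev h1 h2 \<kappa>0 * ?m - (\<integral>c. indicator {u<..<w} c * buyer_rev h1 h2 (\<phi>0 c) \<partial>GS)"
        using C.payoff_pooled[OF sc cut(1) uw off0 on0] by (simp add: Q_def ind0)
      have "e * ?C0 = e * Q w + (e * buyer_rev h1 h2 \<kappa>0 * ?m - e * (\<integral>c. indicator {u<..<w} c * buyer_rev h1 h2 (\<phi>0 c) \<partial>GS))"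
        unfolding eq by (simp add: algebra_simps)
      then show ?thesis using 2(6) c0(4) unfolding pull \<kappa>0_def by linarith
    qed
    have C1: "e * ?C1 < 0"
    proof -
      have eq: "?C1 = Q u + buyer_rev h1 h2 \<kappa>1 * ?m - (\<integral>c. indicator {u<..<w} c * buyer_rev h1 h2 (\<phi>1 c) \<partial>GS)"
        using C.payoff_pooled[OF sc cut(2) uw off1 on1] by (simp add: Q_def ind1)
      have "e * ?C1 = e * Q u - (- e * buyer_rev h1 h2 \<kappa>1 * ?m - (- e) * (\<integral>c. indicator {u<..<w} c * buyer_rev h1 h2 (\<phi>1 c) \<partial>GS))"
        unfolding eq by (simp add: algebra_simps)
      then show ?thesis using 2(5) c1(4) unfolding pull \<kappa>1_def by linarith
    qed
    \<comment> \<open>The solution of \<open>k * ?C0 + (1 - k) * ?C1 = 0\<close>; the factor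
      \<open>e\<close> only makes the signs of numerator and denominator visible.\<close>
    define k where "k = - (e * ?C1) / (e * ?C0 - e * ?C1)"
    have den: "0 < e * ?C0 - e * ?C1" using C0 C1 by linarith
    have k: "0 \<le> k" "k \<le> 1" using C0 C1 den by (auto simp: k_def field_simps)
    have "k * (e * ?C0 - e * ?C1) = - (e * ?C1)" using den by (metis k_def less_irrefl nonzero_divide_eq_eq)
    then have "e * (k * ?C0 + (1 - k) * ?C1) = 0" by (simp add: algebra_simps)
    then have zero: "k * ?C0 + (1 - k) * ?C1 = 0" using e(1) by auto
    show ?thesis
      using cut k zero L0 L1 uw
      by (intro exI[of _ ?\<phi>] exI[of _ u] exI[of _ w] exI[of _ k]) (simp add: pooled_eq)
  qed
qed

text \<open>Splices are monotone only for ordered rules, so the pair is replaced by its minimum and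
  maximum. If these do not bracket zero, the maximum has a strict sign and lies above the given rule
  of the opposite sign, which is paired with it instead.\<close>

lemma optimal_pooled_mixture:
  assumes C: "trade_objective GB GS vl vh cl ch h1 h2 k1 k2"
    and \<phi>: "\<phi>0 \<in> cutoffs" "\<phi>1 \<in> cutoffs"
    and opt: "payoff f1 f2 g1 g2 \<phi>0 = bound" "payoff f1 f2 g1 g2 \<phi>1 = bound"
    and sign: "0 \<le> payoff h1 h2 k1 k2 \<phi>0" "payoff h1 h2 k1 k2 \<phi>1 \<le> 0"
  shows "\<exists>\<phi> u w k. \<phi> \<in> cutoffs \<and> cl \<le> u \<and> u \<le> w \<and> w \<le> ch \<and> 0 \<le> k \<and> k \<le> 1 \<and>
    pooled u w (\<phi> u) \<phi> \<in> cutoffs \<and> pooled u w (\<phi> w) \<phi> \<in> cutoffs \<and>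
    payoff f1 f2 g1 g2 (pooled u w (\<phi> u) \<phi>) = bound \<and> payoff f1 f2 g1 g2 (pooled u w (\<phi> w) \<phi>) = bound \<and>
    k * payoff h1 h2 k1 k2 (pooled u w (\<phi> u) \<phi>) + (1 - k) * payoff h1 h2 k1 k2 (pooled u w (\<phi> w) \<phi>) = 0"
proof -
  interpret C: trade_objective GB GS vl vh cl ch h1 h2 k1 k2 by (rule C)
  let ?mx = "\<lambda>c. max (\<phi>0 c) (\<phi>1 c)" and ?mn = "\<lambda>c. min (\<phi>0 c) (\<phi>1 c)"
  note mm = max_min_cutoffs[OF \<phi>]
  have opt': "payoff f1 f2 g1 g2 ?mx = bound" "payoff f1 f2 g1 g2 ?mn = bound"
    using payoff_max_min[OF \<phi>] opt payoff_le_bound[OF mm(1)] payoff_le_bound[OF mm(2)] by linarith+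
  consider "payoff h1 h2 k1 k2 ?mn * payoff h1 h2 k1 k2 ?mx \<le> 0"
    | "0 < payoff h1 h2 k1 k2 ?mx" | "payoff h1 h2 k1 k2 ?mx < 0" by (fastforce simp: mult_le_0_iff)
  then show ?thesis
  proof cases
    case 1
    then show ?thesis using mm opt' by (intro optimal_pooled_mixture_ordered[OF C, of ?mn ?mx]) auto
  next
    case 2
    then show ?thesis using mm opt opt' \<phi> sign
      by (intro optimal_pooled_mixture_ordered[OF C, of \<phi>1 ?mx]) (auto simp: mult_nonpos_nonneg)
  next
    case 3
    then show ?thesis using mm opt opt' \<phi> sign
      by (intro optimal_pooled_mixture_ordered[OF C, of \<phi>0 ?mx]) (auto simp: mult_nonneg_nonpos)
  qed
qed

end


section \<open>Compactness of cutoff rules and the multiplier\<close>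

text \<open>\<open>K\<close> consists of pairs of objective and constraint value, and
  \<open>l\<close> is the multiplier of the constraint.\<close>

definition maximises :: "(real \<times> real) set \<Rightarrow> real \<Rightarrow> real \<times> real \<Rightarrow> bool" where
  "maximises K l z \<longleftrightarrow> z \<in> K \<and> (\<forall>z'\<in>K. fst z' + l * snd z' \<le> fst z + l * snd z)"

text \<open>\<open>l\<close> is the least multiplier above \<open>m\<close> that admits a maximiser with nonnegative
  second component; maximisers for smaller multipliers accumulate at the other witness.\<close>

lemma compact_multiplier:
  fixes K :: "(real \<times> real) set"
  assumes K: "compact K" and slater: "(w0, c0) \<in> K" "0 < c0"
  obtains l z where "m \<le> l" "maximises K l z" "0 \<le> snd z" "l = m \<or> (\<exists>z. maximises K l z \<and> snd z \<le> 0)"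
proof -
  have ne: "K \<noteq> {}" using slater by auto
  have exists_opt: "\<exists>z. maximises K l z" for l
  proof -
    have "continuous_on K (\<lambda>z. fst z + l * snd z)" by (intro continuous_intros)
    from continuous_attains_sup[OF K ne this] show ?thesis unfolding maximises_def by blast
  qed
  \<comment> \<open>The correspondence from multipliers to maximisers has a closed graph, and
    \<open>K\<close> supplies convergent subsequences.\<close>
  have limit: "\<exists>z r. strict_mono r \<and> (\<lambda>n. Z (r n)) \<longlonglongrightarrow> z \<and> maximises K l z"
    if ln: "ln \<longlonglongrightarrow> l" and Z: "\<And>n. maximises K (ln n) (Z n)" for ln l and Z :: "nat \<Rightarrow> real \<times> real"
  proof -
    have "\<forall>n. Z n \<in> K" using Z by (auto simp: maximises_def)
    then obtain z r where zr: "z \<in> K" "strict_mono r" "(Z \<circ> r) \<longlonglongrightarrow> z"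
      using K unfolding compact_def by blast
    have Zr: "(\<lambda>n. Z (r n)) \<longlonglongrightarrow> z" using zr(3) by (simp add: comp_def)
    have lr: "(\<lambda>n. ln (r n)) \<longlonglongrightarrow> l" using LIMSEQ_subseq_LIMSEQ[OF ln zr(2)] by (simp add: comp_def)
    have "fst z' + l * snd z' \<le> fst z + l * snd z" if "z' \<in> K" for z'
    proof (rule LIMSEQ_le)
      show "(\<lambda>n. fst z' + ln (r n) * snd z') \<longlonglongrightarrow> fst z' + l * snd z'" by (intro tendsto_intros lr)
      show "(\<lambda>n. fst (Z (r n)) + ln (r n) * snd (Z (r n))) \<longlonglongrightarrow> fst z + l * snd z" by (intro tendsto_intros lr Zr)
      show "\<exists>N. \<forall>n\<ge>N. fst z' + ln (r n) * snd z' \<le> fst (Z (r n)) + ln (r n) * snd (Z (r n))"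
        using Z that by (auto simp: maximises_def)
    qed
    then show ?thesis using zr(1,2) Zr by (intro exI[of _ z] exI[of _ r]) (auto simp: maximises_def)
  qed
  define T where "T = {l. m \<le> l \<and> (\<exists>z. maximises K l z \<and> 0 \<le> snd z)}"
  have "T \<noteq> {}"
  proof -
    have "bounded (fst ` K)" by (intro compact_imp_bounded compact_continuous_image K continuous_intros)
    then obtain B where B: "\<forall>x\<in>fst ` K. norm x \<le> B" unfolding bounded_iff by blast
    \<comment> \<open>Beyond \<open>(B - w0) / c0\<close> the Slater point scores above every first
      component in \<open>K\<close>, so with a nonnegative multiplier no maximiser has a negative
      second component.\<close>
    define l where "l = max (max m 0) ((B - w0) / c0) + 1"
    obtain z where z: "maximises K l z" using exists_opt by blast
    have "0 \<le> snd z"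
    proof (rule ccontr)
      assume neg: "\<not> ?thesis"
      have "(B - w0) / c0 * c0 < l * c0" using slater by (intro mult_strict_right_mono) (auto simp: l_def)
      then have "B < w0 + l * c0" using slater by simp
      also have "\<dots> \<le> fst z + l * snd z" using z slater by (auto simp: maximises_def)
      finally have "B < fst z + l * snd z" .
      moreover have "fst z \<le> B" using B z by (force simp: maximises_def)
      moreover have "l * snd z \<le> 0" using neg by (intro mult_nonneg_nonpos) (auto simp: l_def)
      ultimately show False by linarith
    qed
    moreover have "m \<le> l" by (simp add: l_def)
    ultimately have "l \<in> T" using z unfolding T_def by blast
    then show ?thesis by blast
  qed
  have bdd: "bdd_below T" by (rule bdd_belowI[of _ m]) (simp add: T_def)
  define ls where "ls = Inf T"
  have m_ls: "m \<le> ls" unfolding ls_def by (rule cInf_greatest) (use \<open>T \<noteq> {}\<close> in \<open>auto simp: T_def\<close>)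
  have "\<exists>z. maximises K ls z \<and> 0 \<le> snd z"
  proof -
    have "\<exists>l\<in>T. l < ls + 1 / real (Suc n)" for n
      unfolding ls_def by (rule cInf_lessD) (use \<open>T \<noteq> {}\<close> in auto)
    then obtain ln where ln: "\<And>n. ln n \<in> T" "\<And>n. ln n < ls + 1 / real (Suc n)" by metis
    have lim: "ln \<longlonglongrightarrow> ls"
    proof (rule tendsto_sandwich[OF _ _ tendsto_const])
      show "(\<lambda>n. ls + 1 / real (Suc n)) \<longlonglongrightarrow> ls"
        using tendsto_add[OF tendsto_const LIMSEQ_inverse_real_of_nat] by (simp add: inverse_eq_divide)
      show "\<forall>\<^sub>F n in sequentially. ls \<le> ln n" unfolding ls_def using ln(1) bdd by (intro eventuallyI cInf_lower)
      show "\<forall>\<^sub>F n in sequentially. ln n \<le> ls + 1 / real (Suc n)" using ln(2) by (intro eventuallyI less_imp_le)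
    qed
    have "\<forall>n. \<exists>z. maximises K (ln n) z \<and> 0 \<le> snd z" using ln(1) unfolding T_def by blast
    then obtain Z where Z: "\<And>n. maximises K (ln n) (Z n)" "\<And>n. 0 \<le> snd (Z n)" by metis
    obtain z r where zr: "strict_mono r" "(\<lambda>n. Z (r n)) \<longlonglongrightarrow> z" "maximises K ls z" using limit[OF lim Z(1)] by blast
    have "0 \<le> snd z" using tendsto_snd[OF zr(2)] by (rule LIMSEQ_le_const) (use Z in auto)
    with zr show ?thesis by blast
  qed
  then obtain z where z: "maximises K ls z" "0 \<le> snd z" by blast
  have "ls = m \<or> (\<exists>z. maximises K ls z \<and> snd z \<le> 0)"
  proof (rule disjCI)
    assume "\<not> (\<exists>z. maximises K ls z \<and> snd z \<le> 0)"
    show "ls = m"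
    proof (rule ccontr)
      assume "ls \<noteq> m"
      then have less: "0 < ls - m" using m_ls by simp
      define ln where "ln = (\<lambda>n. ls - (ls - m) * (1 / real (Suc n)))"
      have ln_less: "ln n < ls" "m \<le> ln n" for n
      proof -
        define d where "d = (ls - m) * (1 / real (Suc n))"
        have "0 < d" unfolding d_def by (rule mult_pos_pos[OF less]) simp
        moreover have ln_d: "ln n = ls - d" by (simp add: ln_def d_def)
        ultimately show "ln n < ls" by simp
        have "d \<le> (ls - m) * 1" unfolding d_def by (rule mult_left_mono) (use less in auto)
        then show "m \<le> ln n" unfolding ln_d by simp
      qed
      have "(\<lambda>n. 1 / real (Suc n)) \<longlonglongrightarrow> 0"
        using LIMSEQ_inverse_real_of_nat unfolding inverse_eq_divide .
      then have "ln \<longlonglongrightarrow> ls - (ls - m) * 0" unfolding ln_def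
        by (rule tendsto_diff[OF tendsto_const tendsto_mult[OF tendsto_const]])
      then have lim: "ln \<longlonglongrightarrow> ls" by simp
      have "\<forall>n. \<exists>z. maximises K (ln n) z" using exists_opt by blast
      from choice[OF this] obtain Z where Z: "\<And>n. maximises K (ln n) (Z n)" by blast
      have "snd (Z n) < 0" for n
      proof (rule ccontr)
        assume "\<not> ?thesis"
        then have "0 \<le> snd (Z n)" by simp
        then have "ln n \<in> T" using Z[of n] ln_less(2)[of n] unfolding T_def by blast
        then have "ls \<le> ln n" unfolding ls_def by (intro cInf_lower bdd)
        with ln_less[of n] show False by simp
      qed
      moreover obtain z r where zr: "strict_mono r" "(\<lambda>n. Z (r n)) \<longlonglongrightarrow> z" "maximises K ls z" using limit[OF lim Z] by blast
      ultimately have "snd z \<le> 0" using tendsto_snd[OF zr(2)]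
        by (intro LIMSEQ_le_const2[of "\<lambda>n. snd (Z (r n))"]) (auto intro: less_imp_le)
      with zr \<open>\<not> (\<exists>z. maximises K ls z \<and> snd z \<le> 0)\<close> show False by blast
    qed
  qed
  with m_ls z show ?thesis by (rule that)
qed

text \<open>\<open>Helly_selection\<close> is stated for right-continuous functions. The right
  limits differ from \<open>g\<close> only at its countably many discontinuities, which an atomless
  measure ignores.\<close>

lemma mono_right_continuous_version:
  fixes g :: "real \<Rightarrow> real"
  assumes g: "mono g" and bound: "\<And>x. \<bar>g x\<bar> \<le> B"
  obtains h where "mono h" "\<And>x. continuous (at_right x) h" "\<And>x. \<bar>h x\<bar> \<le> B" "countable {x. h x \<noteq> g x}"
proof -
  define h where "h x = Inf (g ` {x<..})" for x
  have bdd: "bdd_below (g ` {x<..})" for x using bound by (intro bdd_belowI2[of _ "- B"]) (simp add: abs_le_iff minus_le_iff)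
  have h_ge: "g x \<le> h x" for x unfolding h_def by (intro cINF_greatest) (auto intro: monoD[OF g])
  have h_le: "h x \<le> g y" if "x < y" for x y unfolding h_def using that by (intro cINF_lower bdd) simp
  have mono: "mono h"
  proof (rule monoI)
    fix x y :: real assume "x \<le> y"
    then show "h x \<le> h y" using h_le[of x y] h_ge[of y] by (cases "x = y") auto
  qed
  moreover have "continuous (at_right x) h" for x
    unfolding continuous_within
  proof (rule order_tendstoI)
    fix l assume "l < h x"
    then show "\<forall>\<^sub>F y in at_right x. l < h y"
      using monoD[OF mono, of x] by (auto simp: eventually_at_right_field intro!: exI[of _ "x + 1"] elim!: less_le_trans)
  next
    fix u assume "h x < u"
    then obtain y where y: "x < y" "g y < u" unfolding h_def by (subst (asm) cINF_less_iff[OF _ bdd]) auto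
    then show "\<forall>\<^sub>F z in at_right x. h z < u"
      using h_le by (auto simp: eventually_at_right_field intro!: exI[of _ y] intro: le_less_trans)
  qed
  moreover have "\<bar>h x\<bar> \<le> B" for x
    using h_ge[of x] h_le[of x "x + 1"] bound[of x] bound[of "x + 1"] by (simp add: abs_le_iff)
  moreover have "countable {x. h x \<noteq> g x}"
  proof (rule countable_subset)
    show "countable {x. \<not> isCont g x}" using g by (rule mono_ctble_discont)
    show "{x. h x \<noteq> g x} \<subseteq> {x. \<not> isCont g x}"
    proof (intro subsetI CollectI notI)
      fix x assume x: "x \<in> {x. h x \<noteq> g x}" and cont: "isCont g x"
      have "(g \<longlongrightarrow> g x) (at_right x)" using cont by (simp add: isCont_def filterlim_at_split)
      then have "h x \<le> g x"
        by (rule tendsto_lowerbound) (auto simp: eventually_at_right_field intro!: exI[of _ "x + 1"] h_le)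
      with h_ge[of x] x show False by simp
    qed
  qed
  ultimately show ?thesis by (rule that)
qed


context bilateral_trade
begin

text \<open>Helly's theorem gives convergence off a countable set of costs, a null set for
  \<open>GS\<close> and \<open>LS\<close> alike; both are required because the seller's term has a
  part against each.\<close>

lemma cutoffs_sequentially_compact:
  fixes \<phi> :: "nat \<Rightarrow> real \<Rightarrow> real"
  assumes \<phi>: "\<And>n. \<phi> n \<in> cutoffs"
  obtains r \<psi> where "strict_mono r" "\<psi> \<in> cutoffs" "AE c in GS. (\<lambda>n. \<phi> (r n) c) \<longlonglongrightarrow> \<psi> c"
    "AE c in LS. (\<lambda>n. \<phi> (r n) c) \<longlonglongrightarrow> \<psi> c"
proof -
  define g where "g n x = \<phi> n (max cl (min ch x))" for n x
  have clamp: "max cl (min ch x) \<in> {cl..ch}" for x using GS.a_le_b by auto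
  have g_mono: "mono (g n)" for n
    unfolding g_def by (intro monoI mono_onD[OF cutoffsD(1)[OF \<phi>]]) (use GS.a_le_b in auto)
  have g_range: "vl \<le> g n x" "g n x \<le> vh" for n x
    using cutoffsD(2)[OF \<phi> clamp] by (auto simp: g_def)
  have g_bound: "\<bar>g n x\<bar> \<le> max \<bar>vl\<bar> \<bar>vh\<bar>" for n x using g_range[of n x] by linarith
  have "\<exists>h. mono h \<and> (\<forall>x. continuous (at_right x) h) \<and> (\<forall>x. \<bar>h x\<bar> \<le> max \<bar>vl\<bar> \<bar>vh\<bar>) \<and> countable {x. h x \<noteq> g n x}" for n
    using mono_right_continuous_version[OF g_mono[of n] g_bound[of n]] by metis
  then obtain h where h: "\<And>n. mono (h n)" "\<And>n x. continuous (at_right x) (h n)"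
    "\<And>n x. \<bar>h n x\<bar> \<le> max \<bar>vl\<bar> \<bar>vh\<bar>" "\<And>n. countable {x. h n x \<noteq> g n x}" by metis
  obtain r F where rF: "strict_mono r" "mono F" "\<And>x. continuous (at x) F \<Longrightarrow> (\<lambda>n. h (r n) x) \<longlonglongrightarrow> F x"
    using Helly_selection[of h, OF h(2,1,3)] by metis
  define \<psi> where "\<psi> c = max vl (min vh (F c))" for c
  have \<psi>: "\<psi> \<in> cutoffs"
    unfolding cutoffs_def \<psi>_def
    using GB.a_le_b by (auto intro!: mono_onI max.mono[OF order_refl] min.mono[OF order_refl] monoD[OF rF(2)])
  define N where "N = {x. \<not> isCont F x} \<union> (\<Union>n. {x. h n x \<noteq> g n x})"
  have N: "countable N" unfolding N_def using mono_ctble_discont[OF rF(2)] h(4) by auto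
  have lim: "(\<lambda>n. \<phi> (r n) c) \<longlonglongrightarrow> \<psi> c" if c: "c \<in> {cl..ch}" "c \<notin> N" for c
  proof -
    have eq: "h n c = \<phi> n c" for n using c by (auto simp: N_def g_def)
    have *: "(\<lambda>n. \<phi> (r n) c) \<longlonglongrightarrow> F c" using rF(3)[of c] c by (simp add: N_def eq)
    have "vl \<le> F c" by (rule LIMSEQ_le_const[OF *]) (use cutoffsD(2)[OF \<phi> c(1)] in auto)
    moreover have "F c \<le> vh" by (rule LIMSEQ_le_const2[OF *]) (use cutoffsD(2)[OF \<phi> c(1)] in auto)
    ultimately show ?thesis using * by (simp add: \<psi>_def)
  qed
  have "AE c in GS. (\<lambda>n. \<phi> (r n) c) \<longlonglongrightarrow> \<psi> c"
    using GS.AE_notin_countable[OF N] AE_space by eventually_elim (auto simp: GS.space_M intro: lim)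
  moreover have "AE c in LS. (\<lambda>n. \<phi> (r n) c) \<longlonglongrightarrow> \<psi> c"
    using LS.AE_notin_countable[OF N] AE_space by eventually_elim (auto simp: LS.space_M intro: lim)
  ultimately show ?thesis using rF(1) \<psi> by (intro that)
qed

end

lemma (in trade_objective) payoff_tendsto:
  assumes \<phi>: "\<And>n. \<phi> n \<in> cutoffs" "\<psi> \<in> cutoffs"
    and lim: "AE c in GS. (\<lambda>n. \<phi> n c) \<longlonglongrightarrow> \<psi> c" "AE c in LS. (\<lambda>n. \<phi> n c) \<longlonglongrightarrow> \<psi> c"
  shows "(\<lambda>n. payoff f1 f2 g1 g2 (\<phi> n)) \<longlonglongrightarrow> payoff f1 f2 g1 g2 \<psi>"
proof -
  note i = payoff_integrable[OF \<phi>(1), THEN borel_measurable_integrable]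
    and j = payoff_integrable[OF \<phi>(2), THEN borel_measurable_integrable]
  obtain K where K: "\<And>w. w \<in> {vl..vh} \<Longrightarrow> \<bar>buyer_rev f1 f2 w\<bar> \<le> K" using bounded_buyer_rev by blast
  have lim_comp: "(\<lambda>n. F (X n)) \<longlonglongrightarrow> F x" if "continuous_on UNIV F" "X \<longlonglongrightarrow> x" for F :: "real \<Rightarrow> real" and X x
    using continuous_on_tendsto_compose[OF that] by simp
  have lim_sdf: "(\<lambda>n. GB.sdf (X n) * y) \<longlonglongrightarrow> GB.sdf x * y" if "X \<longlonglongrightarrow> x" for X x y
    using lim_comp[OF GB.continuous_sdf that] by (rule tendsto_mult_right)
  have bound: "\<bar>GB.sdf w * y\<bar> \<le> \<bar>y\<bar>" for w y
    using GB.sdf_nonneg[of w] sdf_le_1[of w] by (auto simp: abs_mult intro: mult_left_le_one_le)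
  have a: "(\<lambda>n. \<integral>c. buyer_rev f1 f2 (\<phi> n c) \<partial>GS) \<longlonglongrightarrow> (\<integral>c. buyer_rev f1 f2 (\<psi> c) \<partial>GS)"
  proof (rule integral_dominated_convergence[where w="\<lambda>_. K"])
    show "AE c in GS. (\<lambda>n. buyer_rev f1 f2 (\<phi> n c)) \<longlonglongrightarrow> buyer_rev f1 f2 (\<psi> c)"
      using lim(1) by eventually_elim (rule lim_comp[OF continuous_buyer_rev])
    show "AE c in GS. norm (buyer_rev f1 f2 (\<phi> n c)) \<le> K" for n
      using cutoffsD(2)[OF \<phi>(1)[of n]] K by (auto simp: GS.space_M)
  qed (use i j in auto)
  have b: "(\<lambda>n. \<integral>c. GB.sdf (\<phi> n c) * g1 c \<partial>LS) \<longlonglongrightarrow> (\<integral>c. GB.sdf (\<psi> c) * g1 c \<partial>LS)"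
  proof (rule integral_dominated_convergence[where w="\<lambda>c. \<bar>g1 c\<bar>"])
    show "AE c in LS. (\<lambda>n. GB.sdf (\<phi> n c) * g1 c) \<longlonglongrightarrow> GB.sdf (\<psi> c) * g1 c"
      using lim(2) by eventually_elim (rule lim_sdf)
  qed (use i j g1 bound in auto)
  have c: "(\<lambda>n. \<integral>c. GB.sdf (\<phi> n c) * g2 c \<partial>GS) \<longlonglongrightarrow> (\<integral>c. GB.sdf (\<psi> c) * g2 c \<partial>GS)"
  proof (rule integral_dominated_convergence[where w="\<lambda>c. \<bar>g2 c\<bar>"])
    show "AE c in GS. (\<lambda>n. GB.sdf (\<phi> n c) * g2 c) \<longlonglongrightarrow> GB.sdf (\<psi> c) * g2 c"
      using lim(1) by eventually_elim (rule lim_sdf)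
  qed (use i j g2 bound in auto)
  show ?thesis unfolding payoff_def seller_int_def by (rule tendsto_add[OF a tendsto_add[OF b c]])
qed

lemma (in bilateral_trade) compact_payoffs:
  assumes "trade_objective GB GS vl vh cl ch f1 f2 g1 g2" "trade_objective GB GS vl vh cl ch h1 h2 k1 k2"
  shows "compact ((\<lambda>\<phi>. (payoff f1 f2 g1 g2 \<phi>, payoff h1 h2 k1 k2 \<phi>)) ` cutoffs)"
  unfolding compact_def
proof (intro allI impI)
  interpret F: trade_objective GB GS vl vh cl ch f1 f2 g1 g2 by fact
  interpret H: trade_objective GB GS vl vh cl ch h1 h2 k1 k2 by fact
  let ?P = "\<lambda>\<phi>. (payoff f1 f2 g1 g2 \<phi>, payoff h1 h2 k1 k2 \<phi>)"
  fix X :: "nat \<Rightarrow> real \<times> real" assume "\<forall>n. X n \<in> ?P ` cutoffs"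
  then have "\<forall>n. \<exists>\<phi>. \<phi> \<in> cutoffs \<and> X n = ?P \<phi>" by blast
  then obtain \<phi> where \<phi>: "\<And>n. \<phi> n \<in> cutoffs" "\<And>n. X n = ?P (\<phi> n)" by metis
  obtain r \<psi> where r: "strict_mono r" "\<psi> \<in> cutoffs" "AE c in GS. (\<lambda>n. \<phi> (r n) c) \<longlonglongrightarrow> \<psi> c"
    "AE c in LS. (\<lambda>n. \<phi> (r n) c) \<longlonglongrightarrow> \<psi> c" by (rule cutoffs_sequentially_compact[OF \<phi>(1)])
  have "(X \<circ> r) \<longlonglongrightarrow> ?P \<psi>" unfolding comp_def \<phi>(2)
    by (intro tendsto_Pair F.payoff_tendsto[OF \<phi>(1) r(2-4)] H.payoff_tendsto[OF \<phi>(1) r(2-4)])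
  then show "\<exists>l\<in>?P ` cutoffs. \<exists>r. strict_mono r \<and> (X \<circ> r) \<longlonglongrightarrow> l" using r(1,2) by blast
qed


section \<open>Rents and incentive compatibility\<close>

lemma integral_lborel_Ioc:
  assumes "u \<in> {a..b}" "v \<in> {a..b}" "u \<le> v"
  shows "(\<integral>x. indicator {u<..v} x * (k :: real) \<partial>restrict_space lborel {a..b}) = k * (v - u)"
proof -
  have "{u<..v} \<inter> {a..b} = {u<..v}" "{u<..v} \<subseteq> {a..b}" using assms by auto
  then show ?thesis using assms by (simp add: space_restrict_space measure_restrict_space)
qed

context bilateral_trade
begin

text \<open>Expected gains from trade minus expected rents, after exchanging integrals:
  \<open>GB.sdf v\<close> is the mass of buyers whose rent contains the trade probability at
  \<open>v\<close>, and \<open>GS.cdf c\<close> plays this role for sellers.\<close>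

definition surplus :: "(real \<Rightarrow> real \<Rightarrow> real) \<Rightarrow> real" where
  "surplus p = buyer_int (\<lambda>v. - GB.sdf v) (\<lambda>v. v) (buyer_prob p) + seller_int (\<lambda>c. - GS.cdf c) (\<lambda>c. - c) (seller_prob p)"

definition buyer_rent :: "(real \<Rightarrow> real \<Rightarrow> real) \<Rightarrow> real \<Rightarrow> real" where
  "buyer_rent p v = (\<integral>u. indicator {..v} u * buyer_prob p u \<partial>LB)"

definition seller_rent :: "(real \<Rightarrow> real \<Rightarrow> real) \<Rightarrow> real \<Rightarrow> real" where
  "seller_rent p c = (\<integral>u. indicator {c..} u * seller_prob p u \<partial>LS)"

lemma implementable_bounds:
  assumes "implementable p"
  shows "\<And>v. v \<in> {vl..vh} \<Longrightarrow> 0 \<le> buyer_prob p v \<and> buyer_prob p v \<le> 1"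
    "\<And>c. c \<in> {cl..ch} \<Longrightarrow> 0 \<le> seller_prob p c \<and> seller_prob p c \<le> 1"
  using section_GS[OF implementableD(1,2)[OF assms]] section_GB[OF implementableD(1,2)[OF assms]] by auto

lemma implementable_measurable:
  assumes "implementable p"
  shows "buyer_prob p \<in> borel_measurable LB" "buyer_prob p \<in> borel_measurable GB"
    "seller_prob p \<in> borel_measurable LS" "seller_prob p \<in> borel_measurable GS"
  using implementableD(3,4)[OF assms] LB.measurable_mono GB.measurable_mono
  by (auto intro!: LS.measurable_antimono GS.measurable_antimono)

lemma implementable_integrable:
  assumes "implementable p"
  shows "integrable LB (buyer_prob p)" "integrable GB (buyer_prob p)"
    "integrable LS (seller_prob p)" "integrable GS (seller_prob p)"
  using implementable_bounds[OF assms] implementable_measurable[OF assms]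
  by (auto intro!: LB.integrable_bounded[where B=1] GB.integrable_bounded[where B=1]
      LS.integrable_bounded[where B=1] GS.integrable_bounded[where B=1])

lemma continuous_rents:
  assumes "implementable p"
  shows "continuous_on UNIV (buyer_rent p)" "continuous_on UNIV (seller_rent p)"
  using LB.continuous_integral_atMost LS.continuous_integral_atLeast implementable_integrable[OF assms]
  unfolding buyer_rent_def seller_rent_def by auto

lemma rents_nonneg:
  assumes "implementable p"
  shows "0 \<le> buyer_rent p v" "0 \<le> seller_rent p c"
  using implementable_bounds[OF assms] unfolding buyer_rent_def seller_rent_def
  by (auto intro!: integral_nonneg_AE AE_I2 simp: LB.space_M LS.space_M)

text \<open>Monotonicity of the interim probability turns the envelope formula into the global
  incentive constraint: its value at \<open>v'\<close> bounds the integrand on either side of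
  \<open>v'\<close>.\<close>

lemma buyer_rent_le:
  assumes p: "implementable p" and "v' \<in> {vl..vh}" "v \<in> {vl..vh}"
  shows "buyer_prob p v' * (v - v') \<le> buyer_rent p v - buyer_rent p v'"
proof -
  have mono: "buyer_prob p u \<le> buyer_prob p w" if "vl \<le> u" "u \<le> w" "w \<le> vh" for u w
    using mono_onD[OF implementableD(3)[OF p]] that by auto
  note int = implementable_integrable(1)[OF p]
  let ?k = "buyer_prob p v'"
  show ?thesis
  proof (cases "v' \<le> v")
    case True
    have "?k * (v - v') = (\<integral>u. indicator {v'<..v} u * ?k \<partial>LB)"
      using assms True by (intro integral_lborel_Ioc[symmetric]) auto
    also have "\<dots> \<le> (\<integral>u. indicator {v'<..v} u * buyer_prob p u \<partial>LB)"
      using mono assms by (intro integral_mono LB.integrable_indicator_mult int) (auto split: split_indicator)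
    finally show ?thesis using LB.integral_Ioc[OF int True] by (simp add: buyer_rent_def)
  next
    case False
    then have le: "v \<le> v'" by simp
    have "(\<integral>u. indicator {v<..v'} u * buyer_prob p u \<partial>LB) \<le> (\<integral>u. indicator {v<..v'} u * ?k \<partial>LB)"
      using mono assms by (intro integral_mono LB.integrable_indicator_mult int) (auto split: split_indicator)
    also have "\<dots> = ?k * (v' - v)"
      using assms le by (intro integral_lborel_Ioc) auto
    finally show ?thesis using LB.integral_Ioc[OF int le] by (simp add: buyer_rent_def algebra_simps)
  qed
qed

lemma seller_rent_conv:
  "implementable p \<Longrightarrow> seller_rent p c = (\<integral>u. seller_prob p u \<partial>LS) - (\<integral>u. indicator {..c} u * seller_prob p u \<partial>LS)"
  using LS.integral_split_at[OF implementable_integrable(3), of p c] by (simp add: seller_rent_def)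

lemma seller_rent_le:
  assumes p: "implementable p" and "c' \<in> {cl..ch}" "c \<in> {cl..ch}"
  shows "seller_prob p c' * (c' - c) \<le> seller_rent p c - seller_rent p c'"
proof -
  note mono = implementableD(4)[OF p]
  note int = implementable_integrable(3)[OF p]
  let ?k = "seller_prob p c'"
  show ?thesis
  proof (cases "c \<le> c'")
    case True
    have "?k * (c' - c) = (\<integral>u. indicator {c<..c'} u * ?k \<partial>LS)"
      using assms True by (intro integral_lborel_Ioc[symmetric]) auto
    also have "\<dots> \<le> (\<integral>u. indicator {c<..c'} u * seller_prob p u \<partial>LS)"
      using mono assms by (intro integral_mono LS.integrable_indicator_mult int) (auto split: split_indicator)
    finally show ?thesis using LS.integral_Ioc[OF int True] by (simp add: seller_rent_conv[OF p])
  next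
    case False
    then have le: "c' \<le> c" by simp
    have "(\<integral>u. indicator {c'<..c} u * seller_prob p u \<partial>LS) \<le> (\<integral>u. indicator {c'<..c} u * ?k \<partial>LS)"
      using mono assms by (intro integral_mono LS.integrable_indicator_mult int) (auto split: split_indicator)
    also have "\<dots> = ?k * (c - c')"
      using assms le by (intro integral_lborel_Ioc) auto
    finally show ?thesis using LS.integral_Ioc[OF int le] by (simp add: seller_rent_conv[OF p] algebra_simps)
  qed
qed

lemma of_bool_le_measurable:
  assumes M: "sets M = sets (restrict_space borel {a..b::real})" and N: "sets N = sets (restrict_space borel {a'..b'::real})"
  shows "(\<lambda>(u, v). of_bool (u \<le> v) :: real) \<in> borel_measurable (M \<Otimes>\<^sub>M N)"
proof -
  have "(\<lambda>x. x) \<in> borel_measurable (restrict_space borel A)" for A :: "real set"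
    by (rule measurable_restrict_space1) simp
  then have "(\<lambda>x. x) \<in> borel_measurable M" "(\<lambda>x. x) \<in> borel_measurable N"
    using measurable_cong_sets[OF M refl] measurable_cong_sets[OF N refl] by blast+
  then have [measurable]: "fst \<in> borel_measurable (M \<Otimes>\<^sub>M N)" "snd \<in> borel_measurable (M \<Otimes>\<^sub>M N)"
    using measurable_compose[OF measurable_fst] measurable_compose[OF measurable_snd] by blast+
  show ?thesis unfolding case_prod_unfold by measurable
qed

text \<open>By Fubini, the trade probability at a value is weighted by all types at or above it, and
  at a cost by all types at or below it. \<Lambda> may have atoms, so the closed half-lines
  matter.\<close>

lemma integral_rents:
  assumes p: "implementable p"
  shows "finite_measure \<Lambda> \<Longrightarrow> borel_measure_on vl vh \<Lambda> \<Longrightarrow>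
      (\<integral>v. buyer_rent p v \<partial>\<Lambda>) = (\<integral>v. buyer_prob p v * measure \<Lambda> ({v..} \<inter> {vl..vh}) \<partial>LB)"
    and "finite_measure \<Lambda> \<Longrightarrow> borel_measure_on cl ch \<Lambda> \<Longrightarrow>
      (\<integral>c. seller_rent p c \<partial>\<Lambda>) = (\<integral>c. seller_prob p c * measure \<Lambda> ({..c} \<inter> {cl..ch}) \<partial>LS)"
proof -
  assume fin: "finite_measure \<Lambda>" and "borel_measure_on vl vh \<Lambda>"
  then have sets: "sets \<Lambda> = sets (restrict_space borel {vl..vh})" by (simp add: borel_measure_on_def)
  have space: "space \<Lambda> = {vl..vh}" using sets_eq_imp_space_eq[OF sets] by (simp add: space_restrict_space)
  have "(\<integral>v. buyer_rent p v \<partial>\<Lambda>) = (\<integral>v. (\<integral>u. of_bool (u \<le> v) * buyer_prob p u \<partial>LB) \<partial>\<Lambda>)"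
    unfolding buyer_rent_def by (intro Bochner_Integration.integral_cong refl) (auto simp: indicator_def)
  also have "\<dots> = (\<integral>u. (\<integral>v. of_bool (u \<le> v) \<partial>\<Lambda>) * buyer_prob p u \<partial>LB)"
    by (rule Fubini_weight(2)[OF LB.finite_measure_axioms fin, symmetric])
      (auto intro!: of_bool_le_measurable[OF LB.sets_M sets] implementable_integrable p)
  also have "\<dots> = (\<integral>v. buyer_prob p v * measure \<Lambda> ({v..} \<inter> {vl..vh}) \<partial>LB)"
  proof (intro Bochner_Integration.integral_cong refl)
    fix u
    have "(\<integral>v. of_bool (u \<le> v) \<partial>\<Lambda>) = (\<integral>v. indicator {u..} v \<partial>\<Lambda> :: real)"
      by (intro Bochner_Integration.integral_cong) auto
    then show "(\<integral>v. of_bool (u \<le> v) \<partial>\<Lambda>) * buyer_prob p u = buyer_prob p u * measure \<Lambda> ({u..} \<inter> {vl..vh})"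
      by (simp add: space)
  qed
  finally show "(\<integral>v. buyer_rent p v \<partial>\<Lambda>) = (\<integral>v. buyer_prob p v * measure \<Lambda> ({v..} \<inter> {vl..vh}) \<partial>LB)" .
next
  assume fin: "finite_measure \<Lambda>" and "borel_measure_on cl ch \<Lambda>"
  then have sets: "sets \<Lambda> = sets (restrict_space borel {cl..ch})" by (simp add: borel_measure_on_def)
  have space: "space \<Lambda> = {cl..ch}" using sets_eq_imp_space_eq[OF sets] by (simp add: space_restrict_space)
  have meas: "(\<lambda>(u, c). of_bool (c \<le> u) :: real) \<in> borel_measurable (LS \<Otimes>\<^sub>M \<Lambda>)"
    using measurable_compose[OF measurable_pair_swap' of_bool_le_measurable[OF sets LS.sets_M]]
    by (simp add: case_prod_unfold)
  have "(\<integral>c. seller_rent p c \<partial>\<Lambda>) = (\<integral>c. (\<integral>u. of_bool (c \<le> u) * seller_prob p u \<partial>LS) \<partial>\<Lambda>)"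
    unfolding seller_rent_def by (intro Bochner_Integration.integral_cong refl) (auto simp: indicator_def)
  also have "\<dots> = (\<integral>u. (\<integral>c. of_bool (c \<le> u) \<partial>\<Lambda>) * seller_prob p u \<partial>LS)"
    by (rule Fubini_weight(2)[OF LS.finite_measure_axioms fin, symmetric])
      (auto intro!: meas implementable_integrable p)
  also have "\<dots> = (\<integral>c. seller_prob p c * measure \<Lambda> ({..c} \<inter> {cl..ch}) \<partial>LS)"
  proof (intro Bochner_Integration.integral_cong refl)
    fix u
    have "(\<integral>c. of_bool (c \<le> u) \<partial>\<Lambda>) = (\<integral>c. indicator {..u} c \<partial>\<Lambda> :: real)"
      by (intro Bochner_Integration.integral_cong) auto
    then show "(\<integral>c. of_bool (c \<le> u) \<partial>\<Lambda>) * seller_prob p u = seller_prob p u * measure \<Lambda> ({..u} \<inter> {cl..ch})"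
      by (simp add: space)
  qed
  finally show "(\<integral>c. seller_rent p c \<partial>\<Lambda>) = (\<integral>c. seller_prob p c * measure \<Lambda> ({..c} \<inter> {cl..ch}) \<partial>LS)" .
qed

lemma integrable_rents:
  assumes p: "implementable p"
  shows "integrable GB (buyer_rent p)" "integrable GS (seller_rent p)"
    "integrable GB (\<lambda>v. buyer_prob p v * v)" "integrable GS (\<lambda>c. seller_prob p c * c)"
proof -
  note bounds = implementable_bounds[OF p] and meas = implementable_measurable[OF p]
  show "integrable GB (buyer_rent p)" "integrable GS (seller_rent p)"
  proof -
    have "bounded (buyer_rent p ` {vl..vh})" "bounded (seller_rent p ` {cl..ch})"
      by (auto intro!: compact_imp_bounded compact_continuous_image continuous_on_subset[OF continuous_rents(1)[OF p]]
        continuous_on_subset[OF continuous_rents(2)[OF p]])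
    then obtain K K' where K: "\<forall>x\<in>buyer_rent p ` {vl..vh}. norm x \<le> K" "\<forall>x\<in>seller_rent p ` {cl..ch}. norm x \<le> K'"
      unfolding bounded_iff by blast
    show "integrable GB (buyer_rent p)" "integrable GS (seller_rent p)"
      using K continuous_rents[OF p]
      by (auto intro!: GB.integrable_bounded[where B=K] GS.integrable_bounded[where B=K']
        GB.borel_measurableI GS.borel_measurableI borel_measurable_continuous_onI)
  qed
  show "integrable GB (\<lambda>v. buyer_prob p v * v)"
  proof (rule GB.integrable_bounded[where B="1 * max \<bar>vl\<bar> \<bar>vh\<bar>"])
    show "\<bar>buyer_prob p v * v\<bar> \<le> 1 * max \<bar>vl\<bar> \<bar>vh\<bar>" if "v \<in> {vl..vh}" for v
      unfolding abs_mult using bounds(1)[OF that] that by (intro mult_mono) auto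
  qed (use meas(2) in \<open>auto intro!: borel_measurable_times GB.borel_measurableI[of "\<lambda>v. v"]\<close>)
  show "integrable GS (\<lambda>c. seller_prob p c * c)"
  proof (rule GS.integrable_bounded[where B="1 * max \<bar>cl\<bar> \<bar>ch\<bar>"])
    show "\<bar>seller_prob p c * c\<bar> \<le> 1 * max \<bar>cl\<bar> \<bar>ch\<bar>" if "c \<in> {cl..ch}" for c
      unfolding abs_mult using bounds(2)[OF that] that by (intro mult_mono) auto
  qed (use meas(4) in \<open>auto intro!: borel_measurable_times GS.borel_measurableI[of "\<lambda>v. v"]\<close>)
qed

lemma surplus_eq:
  assumes p: "implementable p"
  shows "surplus p = (\<integral>v. buyer_prob p v * v - buyer_rent p v \<partial>GB) - (\<integral>c. seller_prob p c * c + seller_rent p c \<partial>GS)"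
proof -
  note ir = integrable_rents(1,2)[OF p] and iv = integrable_rents(3,4)[OF p]
  have "borel_measure_on vl vh GB" "borel_measure_on cl ch GS" by (simp_all add: borel_measure_on_def GB.sets_M GS.sets_M)
  note R = integral_rents(1)[OF p GB.finite_measure_axioms this(1)] integral_rents(2)[OF p GS.finite_measure_axioms this(2)]
  have "(\<integral>v. buyer_rent p v \<partial>GB) = (\<integral>v. buyer_prob p v * GB.sdf v \<partial>LB)"
    unfolding R by (simp add: GB.sdf_def GB.space_M)
  moreover have "(\<integral>c. seller_rent p c \<partial>GS) = (\<integral>c. seller_prob p c * GS.cdf c \<partial>LS)"
    unfolding R by (simp add: GS.cdf_def GS.space_M)
  ultimately show ?thesis using ir iv by (simp add: surplus_def buyer_int_def seller_int_def)
qed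

end

section \<open>From mechanisms to trade probabilities and back\<close>

definition lottery :: "real \<Rightarrow> (real \<Rightarrow> real) \<Rightarrow> (real \<Rightarrow> real) \<Rightarrow> real \<Rightarrow> real \<Rightarrow> real" where
  "lottery k \<phi> \<psi> v c = k * of_bool (\<phi> c \<le> v) + (1 - k) * of_bool (\<psi> c \<le> v)"

context bilateral_trade
begin

lemma direct_mechanism_transfers:
  assumes "direct_mechanism vl vh cl ch GB GS p t"
  shows "\<And>v w. v \<in> {vl..vh} \<Longrightarrow> (\<integral>c. p v c * w - t v c \<partial>GS) = buyer_prob p v * w - (\<integral>c. t v c \<partial>GS)"
    and "\<And>c w. c \<in> {cl..ch} \<Longrightarrow> (\<integral>v. t v c - p v c * w \<partial>GB) = (\<integral>v. t v c \<partial>GB) - seller_prob p c * w"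
    and "integrable GB (\<lambda>v. \<integral>c. t v c \<partial>GS)" "integrable GS (\<lambda>c. \<integral>v. t v c \<partial>GB)"
    and "(\<integral>v. (\<integral>c. t v c \<partial>GS) \<partial>GB) = (\<integral>c. (\<integral>v. t v c \<partial>GB) \<partial>GS)"
proof -
  interpret P: pair_sigma_finite GB GS ..
  note D = assms[unfolded direct_mechanism_def]
  have p: "(\<lambda>(v, c). p v c) \<in> borel_measurable (GB \<Otimes>\<^sub>M GS)"
    "\<And>v c. v \<in> {vl..vh} \<Longrightarrow> c \<in> {cl..ch} \<Longrightarrow> 0 \<le> p v c \<and> p v c \<le> 1" using D by auto
  have t: "integrable (GB \<Otimes>\<^sub>M GS) (\<lambda>(v, c). t v c)" using D by simp
  show "(\<integral>c. p v c * w - t v c \<partial>GS) = buyer_prob p v * w - (\<integral>c. t v c \<partial>GS)" if "v \<in> {vl..vh}" for v w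
    using section_GS(1)[OF p that] D that by (simp add: buyer_prob_def)
  show "(\<integral>v. t v c - p v c * w \<partial>GB) = (\<integral>v. t v c \<partial>GB) - seller_prob p c * w" if "c \<in> {cl..ch}" for c w
    using section_GB(1)[OF p that] D that by (simp add: seller_prob_def)
  show "integrable GB (\<lambda>v. \<integral>c. t v c \<partial>GS)" using P.integrable_fst[OF t] by simp
  show "integrable GS (\<lambda>c. \<integral>v. t v c \<partial>GB)" using P.integrable_snd[OF t] by simp
  show "(\<integral>v. (\<integral>c. t v c \<partial>GS) \<partial>GB) = (\<integral>c. (\<integral>v. t v c \<partial>GB) \<partial>GS)"
    using P.Fubini_integral[OF t] by simp
qed

text \<open>The envelope theorem without differentiability: incentive compatibility makes the
  interim probability a subgradient of the utility, and \<open>subgradient_integral\<close> with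
  Lebesgue measure integrates it. The last identity holds because both sides compute the same
  ex-ante payment.\<close>

lemma mechanism_implementable:
  assumes mech: "mechanism vl vh cl ch GB GS p t"
  shows "implementable p"
    and "v \<in> {vl..vh} \<Longrightarrow> buyer_utility GS p t v = buyer_utility GS p t vl + buyer_rent p v"
    and "c \<in> {cl..ch} \<Longrightarrow> seller_utility GB p t c = seller_utility GB p t ch + seller_rent p c"
    and "0 \<le> buyer_utility GS p t vl" "0 \<le> seller_utility GB p t ch"
    and "buyer_utility GS p t vl + seller_utility GB p t ch = surplus p"
proof -
  have dm: "direct_mechanism vl vh cl ch GB GS p t" using mech by (simp add: mechanism_def)
  note T = direct_mechanism_transfers[OF dm]
  let ?U = "buyer_utility GS p t" and ?V = "seller_utility GB p t"
  define TB TS where "TB v = (\<integral>c. t v c \<partial>GS)" and "TS c = (\<integral>v. t v c \<partial>GB)" for v c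
  have U: "?U v = buyer_prob p v * v - TB v" if "v \<in> {vl..vh}" for v
    using T(1)[OF that] by (simp add: buyer_utility_def TB_def)
  have V: "?V c = TS c - seller_prob p c * c" if "c \<in> {cl..ch}" for c
    using T(2)[OF that] by (simp add: seller_utility_def TS_def)
  have U_ic: "buyer_prob p v' * (v - v') \<le> ?U v - ?U v'" if "v \<in> {vl..vh}" "v' \<in> {vl..vh}" for v v'
  proof -
    have "(\<integral>c. p v' c * v - t v' c \<partial>GS) \<le> (\<integral>c. p v c * v - t v c \<partial>GS)"
      using mech that unfolding mechanism_def buyer_IC_def by blast
    then have "buyer_prob p v' * v - TB v' \<le> buyer_prob p v * v - TB v" using T(1) that by (simp add: TB_def)
    then show ?thesis unfolding U[OF that(1)] U[OF that(2)] by (simp add: algebra_simps)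
  qed
  have V_ic: "seller_prob p c' * (c' - c) \<le> ?V c - ?V c'" if "c \<in> {cl..ch}" "c' \<in> {cl..ch}" for c c'
  proof -
    have "(\<integral>v. t v c' - p v c' * c \<partial>GB) \<le> (\<integral>v. t v c - p v c * c \<partial>GB)"
      using mech that unfolding mechanism_def seller_IC_def by blast
    then have "TS c' - seller_prob p c' * c \<le> TS c - seller_prob p c * c" using T(2) that by (simp add: TS_def)
    then show ?thesis unfolding V[OF that(1)] V[OF that(2)] by (simp add: algebra_simps)
  qed
  have x_mono: "buyer_prob p v' \<le> buyer_prob p v" if "v' \<in> {vl..vh}" "v \<in> {vl..vh}" "v' \<le> v" for v v'
  proof (cases "v' = v")
    case False
    have "buyer_prob p v' * (v - v') \<le> buyer_prob p v * (v - v')"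
      using U_ic[of v v'] U_ic[of v' v] that by (simp add: algebra_simps)
    then show ?thesis using False that by simp
  qed simp
  have q_anti: "seller_prob p c' \<le> seller_prob p c" if "c \<in> {cl..ch}" "c' \<in> {cl..ch}" "c \<le> c'" for c c'
  proof (cases "c' = c")
    case False
    have "seller_prob p c' * (c' - c) \<le> seller_prob p c * (c' - c)"
      using V_ic[of c c'] V_ic[of c' c] that by (simp add: algebra_simps)
    then show ?thesis using False that by simp
  qed simp
  show impl: "implementable p"
    using dm x_mono q_anti by (auto simp: implementable_def direct_mechanism_def intro!: mono_onI)
  have lb_cdf: "LB.cdf u = u - vl" if "u \<in> {vl..vh}" for u using that by (rule cdf_lborel)
  have ls_cdf: "LS.cdf u = u - cl" if "u \<in> {cl..ch}" for u using that by (rule cdf_lborel)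
  show U_rent: "?U v = ?U vl + buyer_rent p v" if v: "v \<in> {vl..vh}" for v
  proof -
    have "?U v - ?U vl = (\<integral>u. indicator {vl<..v} u * buyer_prob p u \<partial>LB)"
    proof (rule LB.subgradient_integral)
      show "mono_on {vl..v} (buyer_prob p)" using v x_mono by (auto intro!: mono_onI)
      show "buyer_prob p u * (LB.cdf w - LB.cdf u) \<le> ?U w - ?U u" if "vl \<le> u" "u \<le> w" "w \<le> v" for u w
        using U_ic[of w u] that v by (simp add: lb_cdf)
      show "?U w - ?U u \<le> buyer_prob p w * (LB.cdf w - LB.cdf u)" if "vl \<le> u" "u \<le> w" "w \<le> v" for u w
        using U_ic[of u w] that v by (simp add: lb_cdf algebra_simps)
    qed (use v in auto)
    also have "\<dots> = buyer_rent p v"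
    proof -
      have "buyer_rent p vl = (\<integral>u. 0 \<partial>LB)" unfolding buyer_rent_def
        using LB.AE_neq[of vl] AE_space[of LB] implementable_measurable(1)[OF impl]
        by (intro integral_cong_AE) (auto simp: LB.space_M elim!: eventually_elim2 intro!: borel_measurable_times LB.borel_measurableI)
      then show ?thesis
        using LB.integral_Ioc[OF implementable_integrable(1)[OF impl], of vl v] v by (simp add: buyer_rent_def)
    qed
    finally show ?thesis by simp
  qed
  show V_rent: "?V c = ?V ch + seller_rent p c" if c: "c \<in> {cl..ch}" for c
  proof -
    have "?V ch - ?V c = (\<integral>u. indicator {c<..ch} u * - seller_prob p u \<partial>LS)"
    proof (rule LS.subgradient_integral)
      show "mono_on {c..ch} (\<lambda>u. - seller_prob p u)" using c q_anti by (auto intro!: mono_onI)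
      show "- seller_prob p u * (LS.cdf w - LS.cdf u) \<le> ?V w - ?V u" if "c \<le> u" "u \<le> w" "w \<le> ch" for u w
        using V_ic[of w u] that c by (simp add: ls_cdf algebra_simps)
      show "?V w - ?V u \<le> - seller_prob p w * (LS.cdf w - LS.cdf u)" if "c \<le> u" "u \<le> w" "w \<le> ch" for u w
        using V_ic[of u w] that c by (simp add: ls_cdf algebra_simps)
    qed (use c in auto)
    also have "\<dots> = - (\<integral>u. indicator {c<..ch} u * seller_prob p u \<partial>LS)" by simp
    also have "(\<integral>u. indicator {c<..ch} u * seller_prob p u \<partial>LS) = seller_rent p c"
      unfolding seller_rent_def using LS.AE_neq[of c] AE_space[of LS] implementable_measurable(3)[OF impl]
      by (intro integral_cong_AE)
        (auto simp: LS.space_M elim!: eventually_elim2 intro!: borel_measurable_times LS.borel_measurableI split: split_indicator)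
    finally show ?thesis by simp
  qed
  show "0 \<le> ?U vl" "0 \<le> ?V ch"
    using mech GB.a_le_b GS.a_le_b by (auto simp: mechanism_def buyer_IR_def seller_IR_def)
  have "(\<integral>v. buyer_prob p v * v - buyer_rent p v \<partial>GB) = (\<integral>v. ?U vl + TB v \<partial>GB)"
  proof (intro Bochner_Integration.integral_cong refl)
    fix v assume "v \<in> space GB"
    then have "v \<in> {vl..vh}" by (simp add: GB.space_M)
    from U[OF this] U_rent[OF this] show "buyer_prob p v * v - buyer_rent p v = ?U vl + TB v" by linarith
  qed
  also have "\<dots> = ?U vl + (\<integral>v. TB v \<partial>GB)" using T(3) by (simp add: TB_def GB.prob_space)
  finally have e1: "(\<integral>v. buyer_prob p v * v - buyer_rent p v \<partial>GB) = ?U vl + (\<integral>v. TB v \<partial>GB)" .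
  have "(\<integral>c. seller_prob p c * c + seller_rent p c \<partial>GS) = (\<integral>c. TS c - ?V ch \<partial>GS)"
  proof (intro Bochner_Integration.integral_cong refl)
    fix c assume "c \<in> space GS"
    then have "c \<in> {cl..ch}" by (simp add: GS.space_M)
    from V[OF this] V_rent[OF this] show "seller_prob p c * c + seller_rent p c = TS c - ?V ch" by linarith
  qed
  also have "\<dots> = (\<integral>c. TS c \<partial>GS) - ?V ch" using T(4) by (simp add: TS_def GS.prob_space)
  finally have e2: "(\<integral>c. seller_prob p c * c + seller_rent p c \<partial>GS) = (\<integral>c. TS c \<partial>GS) - ?V ch" .
  show "?U vl + ?V ch = surplus p"
    using T(5) e1 e2 by (simp add: surplus_eq[OF impl] TB_def TS_def)
qed

text \<open>The desired utilities dictate the interim payments \<open>TB\<close> and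
  \<open>TS\<close>. The condition \<open>u0 + w0 = surplus p\<close> says exactly that the two have
  the same mean \<kappa>, so the additive transfer \<open>TB v + TS c - \<kappa>\<close> realises
  both.\<close>

lemma implementable_mechanism:
  assumes p: "implementable p" and base: "0 \<le> u0" "0 \<le> w0" "u0 + w0 = surplus p"
  obtains t where "mechanism vl vh cl ch GB GS p t"
    "\<And>v. v \<in> {vl..vh} \<Longrightarrow> buyer_utility GS p t v = u0 + buyer_rent p v"
    "\<And>c. c \<in> {cl..ch} \<Longrightarrow> seller_utility GB p t c = w0 + seller_rent p c"
proof -
  interpret P: pair_prob_space GB GS ..
  define TB where "TB v = buyer_prob p v * v - buyer_rent p v - u0" for v
  define TS where "TS c = seller_prob p c * c + seller_rent p c + w0" for c
  define \<kappa> where "\<kappa> = (\<integral>v. TB v \<partial>GB)"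
  define t where "t v c = TB v + TS c - \<kappa>" for v c
  note ir = integrable_rents[OF p]
  have iB: "integrable GB TB" and iS: "integrable GS TS" unfolding TB_def TS_def using ir by auto
  have "\<kappa> = (\<integral>v. buyer_prob p v * v - buyer_rent p v \<partial>GB) - u0"
    unfolding \<kappa>_def TB_def using ir by (simp add: GB.prob_space)
  moreover have "(\<integral>c. TS c \<partial>GS) = (\<integral>c. seller_prob p c * c + seller_rent p c \<partial>GS) + w0"
    unfolding TS_def using ir by (simp add: GS.prob_space)
  ultimately have kS: "(\<integral>c. TS c \<partial>GS) = \<kappa>" using base(3) surplus_eq[OF p] by simp
  have t_joint: "integrable (GB \<Otimes>\<^sub>M GS) (\<lambda>(v, c). t v c)"
  proof -
    have "integrable (GB \<Otimes>\<^sub>M GS) (\<lambda>(v, c). 1 * TB v)"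
      by (rule Fubini_weight(1)[OF GB.finite_measure_axioms GS.finite_measure_axioms _ _ iB]) auto
    moreover have "integrable (GS \<Otimes>\<^sub>M GB) (\<lambda>(c, v). 1 * TS c)"
      by (rule Fubini_weight(1)[OF GS.finite_measure_axioms GB.finite_measure_axioms _ _ iS]) auto
    then have "integrable (GB \<Otimes>\<^sub>M GS) (\<lambda>(v, c). TS c)"
      using P.integrable_product_swap_iff[of "\<lambda>(v, c). TS c"] by simp
    ultimately show ?thesis unfolding t_def by (simp add: case_prod_unfold)
  qed
  have t_GS: "integrable GS (t v)" "(\<integral>c. t v c \<partial>GS) = TB v" for v
    unfolding t_def using iS kS by (simp_all add: GS.prob_space)
  have t_GB: "integrable GB (\<lambda>v. t v c)" "(\<integral>v. t v c \<partial>GB) = TS c" for c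
    unfolding t_def using iB by (simp_all add: GB.prob_space \<kappa>_def)
  have dm: "direct_mechanism vl vh cl ch GB GS p t"
    using implementableD(1,2)[OF p] t_joint t_GS(1) t_GB(1) by (simp add: direct_mechanism_def)
  note T = direct_mechanism_transfers(1,2)[OF dm]
  have U: "buyer_utility GS p t v = u0 + buyer_rent p v" if "v \<in> {vl..vh}" for v
    using T(1)[OF that] by (simp add: buyer_utility_def t_GS TB_def)
  have V: "seller_utility GB p t c = w0 + seller_rent p c" if "c \<in> {cl..ch}" for c
    using T(2)[OF that] by (simp add: seller_utility_def t_GB TS_def)
  have "buyer_IC vl vh GS p t" unfolding buyer_IC_def
  proof (intro ballI)
    fix v v' assume vv: "v \<in> {vl..vh}" "v' \<in> {vl..vh}"
    show "(\<integral>c. p v' c * v - t v' c \<partial>GS) \<le> (\<integral>c. p v c * v - t v c \<partial>GS)"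
      unfolding T(1)[OF vv(1)] T(1)[OF vv(2)] using buyer_rent_le[OF p vv(2,1)] by (simp add: t_GS TB_def algebra_simps)
  qed
  moreover have "seller_IC cl ch GB p t" unfolding seller_IC_def
  proof (intro ballI)
    fix c c' assume cc: "c \<in> {cl..ch}" "c' \<in> {cl..ch}"
    show "(\<integral>v. t v c' - p v c' * c \<partial>GB) \<le> (\<integral>v. t v c - p v c * c \<partial>GB)"
      unfolding T(2)[OF cc(1)] T(2)[OF cc(2)] using seller_rent_le[OF p cc(2,1)] by (simp add: t_GB TS_def algebra_simps)
  qed
  moreover have "buyer_IR vl vh GS p t" "seller_IR cl ch GB p t"
    using U V rents_nonneg[OF p] base by (auto simp: buyer_IR_def seller_IR_def)
  ultimately have "mechanism vl vh cl ch GB GS p t" using dm by (simp add: mechanism_def)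
  then show ?thesis using U V by (rule that)
qed

lemma cutoff_measurable:
  assumes "\<phi> \<in> cutoffs"
  shows "(\<lambda>(v, c). of_bool (\<phi> c \<le> v) :: real) \<in> borel_measurable (GB \<Otimes>\<^sub>M GS)"
    "(\<lambda>(v, c). of_bool (\<phi> c \<le> v) :: real) \<in> borel_measurable (LB \<Otimes>\<^sub>M GS)"
proof -
  have [measurable]: "\<phi> \<in> borel_measurable GS" by (rule cutoffsD(3)[OF assms])
  have [measurable]: "(\<lambda>x. x) \<in> borel_measurable GB" "(\<lambda>x. x) \<in> borel_measurable LB"
    by (auto intro!: GB.borel_measurableI LB.borel_measurableI)
  show "(\<lambda>(v, c). of_bool (\<phi> c \<le> v) :: real) \<in> borel_measurable (GB \<Otimes>\<^sub>M GS)"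
    "(\<lambda>(v, c). of_bool (\<phi> c \<le> v) :: real) \<in> borel_measurable (LB \<Otimes>\<^sub>M GS)"
    by measurable
qed

lemma cutoff_probs:
  assumes "\<phi> \<in> cutoffs"
  shows "integrable GS (\<lambda>c. of_bool (\<phi> c \<le> v) :: real)" "integrable GB (\<lambda>v. of_bool (\<phi> c \<le> v) :: real)"
    "(\<integral>v. of_bool (\<phi> c \<le> v) \<partial>GB) = GB.sdf (\<phi> c)"
    "v \<le> v' \<Longrightarrow> (\<integral>c. of_bool (\<phi> c \<le> v) \<partial>GS) \<le> (\<integral>c. of_bool (\<phi> c \<le> v') \<partial>GS :: real)"
proof -
  have [measurable]: "\<phi> \<in> borel_measurable GS" by (rule cutoffsD(3)[OF assms])
  show i: "integrable GS (\<lambda>c. of_bool (\<phi> c \<le> v) :: real)" for v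
    by (rule GS.integrable_bounded[where B=1]) auto
  have eq: "(\<lambda>v. of_bool (\<phi> c \<le> v)) = (indicator {\<phi> c..} :: real \<Rightarrow> real)" by (auto simp: fun_eq_iff)
  show "integrable GB (\<lambda>v. of_bool (\<phi> c \<le> v) :: real)" unfolding eq by simp
  show "(\<integral>v. of_bool (\<phi> c \<le> v) \<partial>GB) = GB.sdf (\<phi> c)" unfolding eq GB.sdf_eq ..
  show "(\<integral>c. of_bool (\<phi> c \<le> v) \<partial>GS) \<le> (\<integral>c. of_bool (\<phi> c \<le> v') \<partial>GS :: real)" if "v \<le> v'"
    using that by (intro integral_mono i) auto
qed

lemma lottery_probs:
  assumes "\<phi> \<in> cutoffs" "\<psi> \<in> cutoffs"
  shows "buyer_prob (lottery k \<phi> \<psi>) v = k * (\<integral>c. of_bool (\<phi> c \<le> v) \<partial>GS) + (1 - k) * (\<integral>c. of_bool (\<psi> c \<le> v) \<partial>GS)"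
    "seller_prob (lottery k \<phi> \<psi>) c = k * GB.sdf (\<phi> c) + (1 - k) * GB.sdf (\<psi> c)"
  using cutoff_probs(1,2,3)[OF assms(1)] cutoff_probs(1,2,3)[OF assms(2)]
  by (simp_all add: buyer_prob_def seller_prob_def lottery_def)

lemma implementable_lottery:
  assumes \<phi>: "\<phi> \<in> cutoffs" "\<psi> \<in> cutoffs" and k: "0 \<le> k" "k \<le> 1"
  shows "implementable (lottery k \<phi> \<psi>)"
  unfolding implementable_def
proof (intro conjI ballI impI mono_onI)
  show "(\<lambda>(v, c). lottery k \<phi> \<psi> v c) \<in> borel_measurable (GB \<Otimes>\<^sub>M GS)"
    using cutoff_measurable(1)[OF \<phi>(1)] cutoff_measurable(1)[OF \<phi>(2)] unfolding lottery_def case_prod_unfold by measurable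
  show "0 \<le> lottery k \<phi> \<psi> v c" "lottery k \<phi> \<psi> v c \<le> 1" for v c
    using k by (auto simp: lottery_def)
  show "buyer_prob (lottery k \<phi> \<psi>) v \<le> buyer_prob (lottery k \<phi> \<psi>) v'" if "v \<le> v'" for v v'
    unfolding lottery_probs[OF \<phi>] using k cutoff_probs(4)[OF \<phi>(1) that] cutoff_probs(4)[OF \<phi>(2) that]
    by (intro add_mono mult_left_mono) auto
  show "seller_prob (lottery k \<phi> \<psi>) c' \<le> seller_prob (lottery k \<phi> \<psi>) c"
    if "c \<in> {cl..ch}" "c' \<in> {cl..ch}" "c \<le> c'" for c c'
    unfolding lottery_probs[OF \<phi>]
    using k mono_onD[OF cutoffsD(1)[OF \<phi>(1)] that] mono_onD[OF cutoffsD(1)[OF \<phi>(2)] that]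
    by (intro add_mono mult_left_mono GB.sdf_antimono) auto
qed

end

lemma (in trade_objective) lottery_payoff:
  assumes \<phi>: "\<phi> \<in> cutoffs" "\<psi> \<in> cutoffs"
  shows "buyer_int f1 f2 (buyer_prob (lottery k \<phi> \<psi>)) + seller_int g1 g2 (seller_prob (lottery k \<phi> \<psi>))
    = k * payoff f1 f2 g1 g2 \<phi> + (1 - k) * payoff f1 f2 g1 g2 \<psi>"
proof -
  define x where "x \<phi> v = (\<integral>c. of_bool (\<phi> c \<le> v) \<partial>GS :: real)" for \<phi> :: "real \<Rightarrow> real" and v
  have x: "integrable LB (\<lambda>v. x \<phi> v * f1 v)" "integrable GB (\<lambda>v. x \<phi> v * f2 v)"
    "(\<integral>v. x \<phi> v * f1 v \<partial>LB) + (\<integral>v. x \<phi> v * f2 v \<partial>GB) = (\<integral>c. buyer_rev f1 f2 (\<phi> c) \<partial>GS)"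
    if \<phi>: "\<phi> \<in> cutoffs" for \<phi>
  proof -
    note F1 = Fubini_weight[OF LB.finite_measure_axioms GS.finite_measure_axioms cutoff_measurable(2)[OF \<phi>] _ f1, simplified]
    note F2 = Fubini_weight[OF GB.finite_measure_axioms GS.finite_measure_axioms cutoff_measurable(1)[OF \<phi>] _ f2, simplified]
    have x_mono: "mono (x \<phi>)" unfolding x_def by (intro monoI cutoff_probs(4)[OF \<phi>])
    then have x_meas: "x \<phi> \<in> borel_measurable borel" by (rule borel_measurable_mono)
    have x01: "0 \<le> x \<phi> v \<and> x \<phi> v \<le> 1" for v
    proof -
      have "x \<phi> v \<le> (\<integral>c. 1 \<partial>GS)" unfolding x_def using cutoff_probs(1)[OF \<phi>] by (intro integral_mono) auto
      then show ?thesis unfolding x_def by (auto intro: integral_nonneg_AE simp: GS.prob_space)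
    qed
    show "integrable LB (\<lambda>v. x \<phi> v * f1 v)" "integrable GB (\<lambda>v. x \<phi> v * f2 v)"
      using x01 x_meas by (auto intro!: integrable_weighted f1 f2 LB.borel_measurableI GB.borel_measurableI)
    have ind: "of_bool (\<phi> c \<le> v) = (indicator {\<phi> c..} v :: real)" for c v by auto
    have "(\<integral>c. buyer_rev f1 f2 (\<phi> c) \<partial>GS) = (\<integral>c. (\<integral>v. of_bool (\<phi> c \<le> v) * f1 v \<partial>LB) \<partial>GS) + (\<integral>c. (\<integral>v. of_bool (\<phi> c \<le> v) * f2 v \<partial>GB) \<partial>GS)"
      unfolding buyer_rev_def buyer_int_def ind[symmetric] using F1(3) F2(3) by (rule Bochner_Integration.integral_add)
    also have "\<dots> = (\<integral>v. x \<phi> v * f1 v \<partial>LB) + (\<integral>v. x \<phi> v * f2 v \<partial>GB)"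
      using F1(2) F2(2) by (simp add: x_def)
    finally show "(\<integral>v. x \<phi> v * f1 v \<partial>LB) + (\<integral>v. x \<phi> v * f2 v \<partial>GB) = (\<integral>c. buyer_rev f1 f2 (\<phi> c) \<partial>GS)" ..
  qed
  have "buyer_int f1 f2 (buyer_prob (lottery k \<phi> \<psi>)) = (\<integral>v. k * (x \<phi> v * f1 v) + (1 - k) * (x \<psi> v * f1 v) \<partial>LB)
      + (\<integral>v. k * (x \<phi> v * f2 v) + (1 - k) * (x \<psi> v * f2 v) \<partial>GB)"
    unfolding buyer_int_def lottery_probs[OF \<phi>] x_def by (simp add: algebra_simps)
  also have "\<dots> = k * (\<integral>c. buyer_rev f1 f2 (\<phi> c) \<partial>GS) + (1 - k) * (\<integral>c. buyer_rev f1 f2 (\<psi> c) \<partial>GS)"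
    using x(1,2)[OF \<phi>(1)] x(1,2)[OF \<phi>(2)] by (simp add: algebra_simps flip: x(3)[OF \<phi>(1)] x(3)[OF \<phi>(2)])
  finally have e1: "buyer_int f1 f2 (buyer_prob (lottery k \<phi> \<psi>))
    = k * (\<integral>c. buyer_rev f1 f2 (\<phi> c) \<partial>GS) + (1 - k) * (\<integral>c. buyer_rev f1 f2 (\<psi> c) \<partial>GS)" .
  note i = payoff_integrable(2,3)[OF \<phi>(1)] payoff_integrable(2,3)[OF \<phi>(2)]
  have "seller_int g1 g2 (seller_prob (lottery k \<phi> \<psi>))
    = (\<integral>c. k * (GB.sdf (\<phi> c) * g1 c) + (1 - k) * (GB.sdf (\<psi> c) * g1 c) \<partial>LS)
      + (\<integral>c. k * (GB.sdf (\<phi> c) * g2 c) + (1 - k) * (GB.sdf (\<psi> c) * g2 c) \<partial>GS)"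
    unfolding seller_int_def lottery_probs[OF \<phi>] by (simp add: algebra_simps)
  also have "\<dots> = k * seller_int g1 g2 (\<lambda>c. GB.sdf (\<phi> c)) + (1 - k) * seller_int g1 g2 (\<lambda>c. GB.sdf (\<psi> c))"
    using i by (simp add: seller_int_def algebra_simps)
  finally show ?thesis using e1 by (simp add: payoff_def algebra_simps)
qed

text \<open>A point \<open>x\<close> carries at most the increment \<open>F x - F (x - d)\<close>,
  which vanishes with \<open>d\<close>. Continuity on the whole line covers \<open>x = a\<close>
  too.\<close>

lemma continuous_distribution_atomless:
  assumes "continuous_distribution_on a b G"
  shows "atomless_prob_on G a b"
proof -
  have sets: "sets G = sets (restrict_space borel {a..b})" and "prob_space G"
    and cont: "continuous_on UNIV (\<lambda>x. measure G {y \<in> {a..b}. y \<le> x})"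
    using assms by (auto simp: continuous_distribution_on_def borel_measure_on_def)
  interpret prob_space G by fact
  define F where "F x = measure G {y \<in> {a..b}. y \<le> x}" for x
  have in_sets: "{y \<in> {a..b}. y \<le> x} \<in> sets G" for x
  proof -
    have "{y \<in> {a..b}. y \<le> x} = {a..b} \<inter> {..x}" by auto
    then show ?thesis by (auto simp: sets sets_restrict_space)
  qed
  have "measure G {x} = 0" for x
  proof (cases "x \<in> {a..b}")
    case True
    have "measure G {x} \<le> F x - F (x - d)" if "0 < d" for d
    proof -
      have "F x - F (x - d) = measure G ({y \<in> {a..b}. y \<le> x} - {y \<in> {a..b}. y \<le> x - d})"
        unfolding F_def using that by (intro finite_measure_Diff[symmetric] in_sets) auto
      moreover have "measure G {x} \<le> \<dots>"
        using True that in_sets by (intro finite_measure_mono sets.Diff) auto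
      ultimately show ?thesis by simp
    qed
    then have "\<forall>\<^sub>F d in at_right 0. measure G {x} \<le> F x - F (x - d)"
      by (auto simp: eventually_at_right_field intro!: exI[of _ 1])
    moreover have "((\<lambda>d. F x - F (x - d)) \<longlongrightarrow> F x - F (x - 0)) (at_right 0)"
    proof -
      have "isCont F (x - 0)" using cont by (auto simp: F_def[abs_def] continuous_on_eq_continuous_at)
      then show ?thesis by (intro tendsto_intros isCont_tendsto_compose[of "x - 0" F])
    qed
    ultimately have "measure G {x} \<le> F x - F (x - 0)"
      by (intro tendsto_lowerbound) auto
    then show ?thesis using measure_nonneg[of G "{x}"] by simp
  next
    case False
    then show ?thesis by (intro measure_notin_sets) (auto simp: sets sets_restrict_space)
  qed
  then show ?thesis using sets by unfold_locales
qed

section \<open>Linear objectives of lotteries, and a rule with positive surplus\<close>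

context bilateral_trade
begin

definition trade_value ::
  "(real \<Rightarrow> real) \<Rightarrow> (real \<Rightarrow> real) \<Rightarrow> (real \<Rightarrow> real) \<Rightarrow> (real \<Rightarrow> real) \<Rightarrow> (real \<Rightarrow> real \<Rightarrow> real) \<Rightarrow> real" where
  "trade_value f1 f2 g1 g2 p = buyer_int f1 f2 (buyer_prob p) + seller_int g1 g2 (seller_prob p)"

lemma surplus_trade_value: "surplus p = trade_value (\<lambda>v. - GB.sdf v) (\<lambda>v. v) (\<lambda>c. - GS.cdf c) (\<lambda>c. - c) p"
  by (simp add: surplus_def trade_value_def)

lemma surplus_objective: "trade_objective GB GS vl vh cl ch (\<lambda>v. - GB.sdf v) (\<lambda>v. v) (\<lambda>c. - GS.cdf c) (\<lambda>c. - c)"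
proof
  show "integrable LB (\<lambda>v. - GB.sdf v)"
    using GB.sdf_nonneg sdf_le_1
    by (intro LB.integrable_bounded[where B=1] LB.borel_measurableI borel_measurable_uminus
      borel_measurable_continuous_onI GB.continuous_sdf) auto
  show "integrable LS (\<lambda>c. - GS.cdf c)"
    using GS.cdf_nonneg GS.cdf_le_1
    by (intro LS.integrable_bounded[where B=1] LS.borel_measurableI borel_measurable_uminus
      borel_measurable_continuous_onI GS.continuous_cdf) auto
  show "integrable GB (\<lambda>v. v)"
    by (rule GB.integrable_bounded[where B="max \<bar>vl\<bar> \<bar>vh\<bar>"]) (auto intro!: GB.borel_measurableI)
  show "integrable GS (\<lambda>c. - c)"
    by (rule GS.integrable_bounded[where B="max \<bar>cl\<bar> \<bar>ch\<bar>"]) (auto intro!: GS.borel_measurableI)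
qed

lemma trade_value_add:
  assumes F: "trade_objective GB GS vl vh cl ch f1 f2 g1 g2" and H: "trade_objective GB GS vl vh cl ch h1 h2 k1 k2"
  shows "trade_objective GB GS vl vh cl ch (\<lambda>v. f1 v + l * h1 v) (\<lambda>v. f2 v + l * h2 v) (\<lambda>v. g1 v + l * k1 v) (\<lambda>v. g2 v + l * k2 v)"
    and "implementable p \<Longrightarrow> trade_value (\<lambda>v. f1 v + l * h1 v) (\<lambda>v. f2 v + l * h2 v) (\<lambda>v. g1 v + l * k1 v) (\<lambda>v. g2 v + l * k2 v) p
      = trade_value f1 f2 g1 g2 p + l * trade_value h1 h2 k1 k2 p"
proof -
  interpret F: trade_objective GB GS vl vh cl ch f1 f2 g1 g2 by fact
  interpret H: trade_objective GB GS vl vh cl ch h1 h2 k1 k2 by fact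
  show "trade_objective GB GS vl vh cl ch (\<lambda>v. f1 v + l * h1 v) (\<lambda>v. f2 v + l * h2 v) (\<lambda>v. g1 v + l * k1 v) (\<lambda>v. g2 v + l * k2 v)"
    using F.f1 F.f2 F.g1 F.g2 H.f1 H.f2 H.g1 H.g2 by unfold_locales auto
  assume p: "implementable p"
  note w = F.integrable_weighted
  note m = implementable_measurable[OF p] and b = implementable_bounds[OF p]
  have "integrable LB (\<lambda>v. buyer_prob p v * f1 v)" "integrable GB (\<lambda>v. buyer_prob p v * f2 v)"
    "integrable LS (\<lambda>v. seller_prob p v * g1 v)" "integrable GS (\<lambda>v. seller_prob p v * g2 v)"
    "integrable LB (\<lambda>v. buyer_prob p v * h1 v)" "integrable GB (\<lambda>v. buyer_prob p v * h2 v)"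
    "integrable LS (\<lambda>v. seller_prob p v * k1 v)" "integrable GS (\<lambda>v. seller_prob p v * k2 v)"
    using m b by (auto intro!: w F.f1 F.f2 F.g1 F.g2 H.f1 H.f2 H.g1 H.g2
      simp: LB.space_M GB.space_M LS.space_M GS.space_M)
  then show "trade_value (\<lambda>v. f1 v + l * h1 v) (\<lambda>v. f2 v + l * h2 v) (\<lambda>v. g1 v + l * k1 v) (\<lambda>v. g2 v + l * k2 v) p
      = trade_value f1 f2 g1 g2 p + l * trade_value h1 h2 k1 k2 p"
    by (simp add: trade_value_def buyer_int_def seller_int_def distrib_left mult.left_commute algebra_simps)
qed

lemma implementable_cutoff: "\<phi> \<in> cutoffs \<Longrightarrow> implementable (lottery 1 \<phi> \<phi>)"
  by (rule implementable_lottery) auto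

lemma payoff_trade_value:
  assumes "trade_objective GB GS vl vh cl ch f1 f2 g1 g2" "\<phi> \<in> cutoffs"
  shows "payoff f1 f2 g1 g2 \<phi> = trade_value f1 f2 g1 g2 (lottery 1 \<phi> \<phi>)"
  using trade_objective.lottery_payoff[OF assms(1,2,2), of 1] by (simp add: trade_value_def)

lemma payoff_add:
  assumes F: "trade_objective GB GS vl vh cl ch f1 f2 g1 g2" and H: "trade_objective GB GS vl vh cl ch h1 h2 k1 k2"
    and \<phi>: "\<phi> \<in> cutoffs"
  shows "payoff (\<lambda>v. f1 v + l * h1 v) (\<lambda>v. f2 v + l * h2 v) (\<lambda>v. g1 v + l * k1 v) (\<lambda>v. g2 v + l * k2 v) \<phi>
    = payoff f1 f2 g1 g2 \<phi> + l * payoff h1 h2 k1 k2 \<phi>"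
  using trade_value_add(2)[OF F H implementable_cutoff[OF \<phi>]] payoff_trade_value[OF F \<phi>] payoff_trade_value[OF H \<phi>]
    payoff_trade_value[OF trade_value_add(1)[OF F H] \<phi>] by simp

lemma markup_pooling_lottery:
  assumes "\<phi> \<in> cutoffs" "cl \<le> u" "u \<le> w" "w \<le> ch" "0 \<le> k" "k \<le> 1"
  shows "markup_pooling vl vh cl ch (lottery k (pooled u w (\<phi> u) \<phi>) (pooled u w (\<phi> w) \<phi>))"
  unfolding markup_pooling_def
  using assms cutoffsD(1)[OF assms(1)]
  by (intro exI[of _ \<phi>] exI[of _ u] exI[of _ w] exI[of _ k]) (auto simp: lottery_def pooled_def)

lemma markup_pooling_cutoff:
  assumes "\<phi> \<in> cutoffs" shows "markup_pooling vl vh cl ch (lottery 1 \<phi> \<phi>)"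
  using markup_pooling_lottery[OF assms, of cl cl 1] GS.a_le_b by (simp add: pooled_same)

lemma buyer_rent_lipschitz:
  assumes p: "implementable p" and v: "v \<in> {vl..vh}" "v' \<in> {vl..vh}" "v \<le> v'"
  shows "buyer_rent p v \<le> buyer_rent p v'" "buyer_rent p v' \<le> buyer_rent p v + (v' - v)"
proof -
  note b = implementable_bounds(1)[OF p]
  have "0 \<le> buyer_prob p v * (v' - v)" using b[OF v(1)] v by simp
  also have "\<dots> \<le> buyer_rent p v' - buyer_rent p v" by (rule buyer_rent_le[OF p v(1,2)])
  finally show "buyer_rent p v \<le> buyer_rent p v'" by simp
  have "buyer_prob p v' * (v' - v) \<le> 1 * (v' - v)" using b[OF v(2)] v by (intro mult_right_mono) auto
  then show "buyer_rent p v' \<le> buyer_rent p v + (v' - v)"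
    using buyer_rent_le[OF p v(2,1)] by (simp add: algebra_simps)
qed

lemma seller_rent_lipschitz:
  assumes p: "implementable p" and c: "c \<in> {cl..ch}" "c' \<in> {cl..ch}" "c \<le> c'"
  shows "seller_rent p c' \<le> seller_rent p c" "seller_rent p c \<le> seller_rent p c' + (c' - c)"
proof -
  note b = implementable_bounds(2)[OF p]
  have "0 \<le> seller_prob p c' * (c' - c)" using b[OF c(2)] c by simp
  also have "\<dots> \<le> seller_rent p c - seller_rent p c'" by (rule seller_rent_le[OF p c(2,1)])
  finally show "seller_rent p c' \<le> seller_rent p c" by simp
  have "seller_prob p c * (c' - c) \<le> 1 * (c' - c)" using b[OF c(1)] c by (intro mult_right_mono) auto
  then show "seller_rent p c \<le> seller_rent p c' + (c' - c)"
    using seller_rent_le[OF p c(1,2)] by (simp add: algebra_simps)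
qed

lemma integral_buyer_seller_prob:
  assumes p: "implementable p"
  shows "(\<integral>v. buyer_prob p v \<partial>GB) = (\<integral>c. seller_prob p c \<partial>GS)"
proof -
  have "(\<integral>v. (\<integral>c. p v c \<partial>GS) * 1 \<partial>GB) = (\<integral>c. (\<integral>v. p v c * 1 \<partial>GB) \<partial>GS)"
    using implementableD(2)[OF p]
    by (intro Fubini_weight(2) GB.finite_measure_axioms GS.finite_measure_axioms implementableD(1)[OF p])
      (force simp: GB.space_M GS.space_M)+
  then show ?thesis by (simp add: buyer_prob_def seller_prob_def)
qed

text \<open>Posted prices: upon trade the buyer pays \<open>rB\<close> and the seller receives
  \<open>rS\<close>, and the spread is the surplus.\<close>

lemma two_price_surplus:
  assumes r: "rB \<in> {vl..vh}" "rS \<in> {cl..ch}"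
  defines "\<phi> \<equiv> (\<lambda>c. if c \<le> rS then rB else vh)"
  shows "\<phi> \<in> cutoffs" "surplus (lottery 1 \<phi> \<phi>) = (rB - rS) * GS.cdf rS * GB.sdf rB"
proof -
  show \<phi>: "\<phi> \<in> cutoffs" using r by (auto simp: cutoffs_def \<phi>_def intro!: mono_onI)
  let ?p = "lottery 1 \<phi> \<phi>" and ?s = "GS.cdf rS" and ?d = "GB.sdf rB"
  note impl = implementable_cutoff[OF \<phi>]
  note iA = implementable_measurable[OF impl]
  \<comment> \<open>\<open>vh\<close> is excluded because it meets the cutoff \<open>vh\<close> and
    hence trades even with costs above \<open>rS\<close>.\<close>
  have x: "buyer_prob ?p v = ?s * indicator {rB..} v" if "v < vh" for v
  proof -
    have "(\<integral>c. of_bool (\<phi> c \<le> v) \<partial>GS) = (\<integral>c. indicator {..rS} c * indicator {rB..} v \<partial>GS :: real)"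
      using that by (intro Bochner_Integration.integral_cong refl) (auto simp: \<phi>_def split: split_indicator)
    then show ?thesis unfolding lottery_probs[OF \<phi> \<phi>] by (simp add: GS.cdf_def)
  qed
  have q: "seller_prob ?p c = ?d * indicator {..rS} c" for c
    unfolding lottery_probs[OF \<phi> \<phi>] by (simp add: \<phi>_def sdf_vh)
  have rentB: "buyer_rent ?p v = ?s * max 0 (v - rB)" if v: "v \<in> {vl..vh}" for v
  proof -
    have "buyer_rent ?p v = (\<integral>u. indicator {rB<..max rB v} u * ?s \<partial>LB)" unfolding buyer_rent_def
    proof (rule integral_cong_AE)
      show "AE u in LB. indicator {..v} u * buyer_prob ?p u = indicator {rB<..max rB v} u * ?s"
        using LB.AE_neq[of vh] LB.AE_neq[of rB] AE_space
        by eventually_elim (auto simp: LB.space_M x split: split_indicator)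
    qed (use iA in \<open>auto intro!: borel_measurable_times LB.borel_measurableI\<close>)
    also have "\<dots> = ?s * (max rB v - rB)" using r v by (intro integral_lborel_Ioc) auto
    finally show ?thesis by (simp add: max_def)
  qed
  have rentS: "seller_rent ?p c = ?d * max 0 (rS - c)" if c: "c \<in> {cl..ch}" for c
  proof -
    have "seller_rent ?p c = (\<integral>u. indicator {min c rS<..rS} u * ?d \<partial>LS)" unfolding seller_rent_def
    proof (rule integral_cong_AE)
      show "AE u in LS. indicator {c..} u * seller_prob ?p u = indicator {min c rS<..rS} u * ?d"
        using LS.AE_neq[of c] LS.AE_neq[of rS] by eventually_elim (auto simp: q split: split_indicator)
    qed (use iA in \<open>auto intro!: borel_measurable_times LS.borel_measurableI\<close>)
    also have "\<dots> = ?d * (rS - min c rS)" using r c by (intro integral_lborel_Ioc) auto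
    finally show ?thesis by (simp add: max_def min_def)
  qed
  have "(\<integral>v. buyer_prob ?p v * v - buyer_rent ?p v \<partial>GB) = (\<integral>v. indicator {rB..} v * (?s * rB) \<partial>GB)"
  proof (rule integral_cong_AE)
    show "AE v in GB. buyer_prob ?p v * v - buyer_rent ?p v = indicator {rB..} v * (?s * rB)"
      using GB.AE_neq[of vh] AE_space
      by eventually_elim (auto simp: GB.space_M x rentB algebra_simps split: split_indicator)
  qed (use integrable_rents[OF impl] in \<open>auto intro!: GB.borel_measurableI\<close>)
  moreover have "(\<integral>c. seller_prob ?p c * c + seller_rent ?p c \<partial>GS) = (\<integral>c. indicator {..rS} c * (?d * rS) \<partial>GS)"
    by (intro Bochner_Integration.integral_cong refl)
      (auto simp: GS.space_M q rentS algebra_simps split: split_indicator)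
  ultimately show "surplus ?p = (rB - rS) * GS.cdf rS * GB.sdf rB"
    unfolding surplus_eq[OF impl] by (simp add: GB.sdf_def GS.cdf_def algebra_simps)
qed

text \<open>Continuity of \<open>GS.cdf\<close> lets the seller's price move strictly below
  \<open>r\<close> and still be accepted with positive probability, which opens a spread. The
  \<open>max\<close> and \<open>min\<close> only bring the prices into the type intervals.\<close>

lemma positive_surplus:
  assumes "0 < GB.sdf r" "0 < GS.cdf r"
  obtains \<phi> where "\<phi> \<in> cutoffs" "0 < surplus (lottery 1 \<phi> \<phi>)"
proof -
  have "isCont GS.cdf r" using GS.continuous_cdf[of UNIV] by (simp add: continuous_on_eq_continuous_at)
  then have "(GS.cdf \<longlongrightarrow> GS.cdf r) (at_left r)" by (simp add: isCont_def filterlim_at_split)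
  then have "\<forall>\<^sub>F x in at_left r. 0 < GS.cdf x" using assms(2) by (rule order_tendstoD(1))
  then obtain b where b: "b < r" "\<And>y. b < y \<Longrightarrow> y < r \<Longrightarrow> 0 < GS.cdf y" by (auto simp: eventually_at_left_field)
  obtain s where s: "b < s" "s < r" using dense[OF b(1)] by blast
  have s_pos: "0 < GS.cdf s" using b s by blast
  define rB rS where "rB = max r vl" and "rS = min s ch"
  have "0 < GB.sdf rB" using assms(1) sdf_vl by (auto simp: rB_def max_def)
  have "0 < GS.cdf rS" using s_pos GS.cdf_b by (auto simp: rS_def min_def)
  have "rB < vh" using GB.sdf_upper[of rB] \<open>0 < GB.sdf rB\<close> by (cases "rB < vh") auto
  have "cl < rS" using GS.cdf_lower[of rS] \<open>0 < GS.cdf rS\<close> by (cases "cl < rS") auto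
  have r: "rB \<in> {vl..vh}" "rS \<in> {cl..ch}" using \<open>rB < vh\<close> \<open>cl < rS\<close> by (auto simp: rB_def rS_def)
  have "rS < rB" using s by (auto simp: rB_def rS_def)
  then have "0 < (rB - rS) * GS.cdf rS * GB.sdf rB" using \<open>0 < GB.sdf rB\<close> \<open>0 < GS.cdf rS\<close> by simp
  then show ?thesis using two_price_surplus[OF r] that by metis
qed

end


section \<open>No gains from trade\<close>

context bilateral_trade
begin

text \<open>\<open>vs\<close> is the top of the buyer's support and \<open>cs\<close> the bottom of
  the seller's; a point \<open>r\<close> strictly between \<open>cs\<close> and \<open>vs\<close>
  would violate the assumption.\<close>

lemma no_trade_region:
  assumes "\<And>r. GB.sdf r = 0 \<or> GS.cdf r = 0"
  obtains vs cs where "vl < vs" "vs \<le> vh" "cl \<le> cs" "cs < ch" "vs \<le> cs" "GB.sdf vs = 0" "GS.cdf cs = 0"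
    "\<And>v. v < vs \<Longrightarrow> 0 < GB.sdf v" "\<And>c. cs < c \<Longrightarrow> 0 < GS.cdf c"
proof -
  obtain vs where vs: "vl \<le> vs" "vs \<le> vh" "GB.cdf vs = 1" "\<And>x. x \<in> {vl..vh} \<Longrightarrow> x < vs \<Longrightarrow> GB.cdf x < 1"
    using GB.cdf_level[of 1] by (metis order_trans zero_le_one order_refl)
  obtain cs where cs: "cl \<le> cs" "cs \<le> ch" "GS.cdf cs = 0" "\<And>x. x \<in> {cl..ch} \<Longrightarrow> cs < x \<Longrightarrow> 0 < GS.cdf x"
    using GS.cdf_level[of 0] by (metis order_trans zero_le_one order_refl)
  have sdf: "0 < GB.sdf v" if "v < vs" for v
  proof (cases "vl \<le> v")
    case True
    then show ?thesis using vs(2) vs(4)[of v] that by (simp add: GB.sdf_conv_cdf)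
  next
    case False
    then show ?thesis using GB.sdf_antimono[of v vl] sdf_vl by simp
  qed
  have cdf: "0 < GS.cdf c" if "cs < c" for c
  proof (cases "c \<le> ch")
    case True
    then show ?thesis using cs(1) cs(4)[of c] that by simp
  next
    case False
    then show ?thesis using GS.cdf_mono[of ch c] GS.cdf_b by simp
  qed
  have "vs \<le> cs"
  proof (rule ccontr)
    assume "\<not> vs \<le> cs"
    then obtain r where "cs < r" "r < vs" using dense[of cs vs] by auto
    then show False using assms[of r] sdf[of r] cdf[of r] by auto
  qed
  moreover have "vl < vs" using vs GB.cdf_a by (cases "vs = vl") auto
  moreover have "cs < ch" using cs GS.cdf_b by (cases "cs = ch") auto
  ultimately show ?thesis using vs cs sdf cdf by (intro that[of vs cs]) (auto simp: GB.sdf_conv_cdf)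
qed

lemma AE_below: "GB.sdf vs = 0 \<Longrightarrow> AE v in GB. v < vs"
proof -
  assume "GB.sdf vs = 0"
  then have "AE v in GB. indicator {vs..} v = (0::real)"
    using integral_nonneg_eq_0_iff_AE[of GB "indicator {vs..} :: real \<Rightarrow> real"] by (simp add: GB.sdf_def)
  then show ?thesis by eventually_elim (auto simp: indicator_def split: if_splits)
qed

lemma AE_above: "GS.cdf cs = 0 \<Longrightarrow> AE c in GS. cs < c"
proof -
  assume "GS.cdf cs = 0"
  then have "AE c in GS. indicator {..cs} c = (0::real)"
    using integral_nonneg_eq_0_iff_AE[of GS "indicator {..cs} :: real \<Rightarrow> real"] by (simp add: GS.cdf_def)
  then show ?thesis by eventually_elim (auto simp: indicator_def split: if_splits)
qed

text \<open>Without gains from trade only types outside the supports can earn rents, and the bounds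
  below are attained simultaneously by letting the boundary types of the supports set the prices.\<close>

lemma no_gains_rents_le:
  assumes vs: "vl < vs" "vs \<le> vh" "GB.sdf vs = 0" "\<And>v. v < vs \<Longrightarrow> 0 < GB.sdf v"
    and cs: "cl \<le> cs" "cs < ch" "GS.cdf cs = 0" "\<And>c. cs < c \<Longrightarrow> 0 < GS.cdf c" and "vs \<le> cs"
    and mech: "mechanism vl vh cl ch GB GS p t"
  shows "\<And>v. v \<in> {vl..vh} \<Longrightarrow> buyer_utility GS p t v \<le> max 0 (v - vs)"
    "\<And>c. c \<in> {cl..ch} \<Longrightarrow> seller_utility GB p t c \<le> max 0 (cs - c)"
proof -
  note I = mechanism_implementable[OF mech]
  note p = I(1)
  note r = integrable_rents[OF p] and i = implementable_integrable[OF p] and b = implementable_bounds[OF p]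
  \<comment> \<open>Almost surely the value is below \<open>vs\<close> and the cost above
    \<open>cs\<close>, so expected gains from trade are nonpositive. Since the worst types'
    utilities and the rents are nonnegative, all of them must vanish.\<close>
  have "(\<integral>v. buyer_prob p v * v \<partial>GB) \<le> (\<integral>v. buyer_prob p v * vs \<partial>GB)"
    using AE_below[OF vs(3)] AE_space[of GB] b(1) i(2) r(3)
    by (intro integral_mono_AE) (auto elim!: eventually_elim2 simp: GB.space_M intro!: mult_left_mono)
  also have "\<dots> = vs * (\<integral>c. seller_prob p c \<partial>GS)" by (simp add: integral_buyer_seller_prob[OF p])
  also have "\<dots> \<le> cs * (\<integral>c. seller_prob p c \<partial>GS)"
    using b(2) \<open>vs \<le> cs\<close> by (intro mult_right_mono integral_nonneg_AE AE_I2) (auto simp: GS.space_M)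
  also have "\<dots> = (\<integral>c. seller_prob p c * cs \<partial>GS)" by simp
  also have "\<dots> \<le> (\<integral>c. seller_prob p c * c \<partial>GS)"
    using AE_above[OF cs(3)] AE_space[of GS] b(2) i(4) r(4)
    by (intro integral_mono_AE) (auto elim!: eventually_elim2 simp: GS.space_M intro!: mult_left_mono)
  finally have gains: "(\<integral>v. buyer_prob p v * v \<partial>GB) \<le> (\<integral>c. seller_prob p c * c \<partial>GS)" .
  have nonneg: "0 \<le> (\<integral>v. buyer_rent p v \<partial>GB)" "0 \<le> (\<integral>c. seller_rent p c \<partial>GS)"
    using rents_nonneg[OF p] by (auto intro: integral_nonneg_AE)
  have "surplus p = (\<integral>v. buyer_prob p v * v \<partial>GB) - (\<integral>v. buyer_rent p v \<partial>GB)
      - (\<integral>c. seller_prob p c * c \<partial>GS) - (\<integral>c. seller_rent p c \<partial>GS)"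
    unfolding surplus_eq[OF p] using r by simp
  then have zero: "buyer_utility GS p t vl = 0" "seller_utility GB p t ch = 0"
      "(\<integral>v. buyer_rent p v \<partial>GB) = 0" "(\<integral>c. seller_rent p c \<partial>GS) = 0"
    using gains nonneg I(4-6) by linarith+
  have rentB0: "buyer_rent p v = 0" if v: "v \<in> {vl..vh}" "v < vs" for v
  proof -
    have "buyer_rent p v * GB.sdf v = (\<integral>u. indicator {v..} u * buyer_rent p v \<partial>GB)" by (simp add: GB.sdf_def)
    also have "\<dots> \<le> (\<integral>u. buyer_rent p u \<partial>GB)"
      using v r(1) buyer_rent_lipschitz(1)[OF p] rents_nonneg[OF p]
      by (intro integral_mono GB.integrable_indicator_mult) (auto simp: GB.space_M split: split_indicator)
    finally have "buyer_rent p v * GB.sdf v \<le> 0" using zero by simp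
    then show ?thesis using vs(4)[OF v(2)] rents_nonneg(1)[OF p, of v] by (simp add: mult_le_0_iff)
  qed
  have rentS0: "seller_rent p c = 0" if c: "c \<in> {cl..ch}" "cs < c" for c
  proof -
    have "seller_rent p c * GS.cdf c = (\<integral>u. indicator {..c} u * seller_rent p c \<partial>GS)" by (simp add: GS.cdf_def)
    also have "\<dots> \<le> (\<integral>u. seller_rent p u \<partial>GS)"
      using c r(2) seller_rent_lipschitz(1)[OF p] rents_nonneg[OF p]
      by (intro integral_mono GS.integrable_indicator_mult) (auto simp: GS.space_M split: split_indicator)
    finally have "seller_rent p c * GS.cdf c \<le> 0" using zero by simp
    then show ?thesis using cs(4)[OF c(2)] rents_nonneg(2)[OF p, of c] by (simp add: mult_le_0_iff)
  qed
  show "buyer_utility GS p t v \<le> max 0 (v - vs)" if v: "v \<in> {vl..vh}" for v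
  proof (cases "v < vs")
    case True
    then show ?thesis using I(2)[OF v] rentB0[OF v] zero by simp
  next
    case False
    \<comment> \<open>The rent is zero just below \<open>vs\<close> and grows with slope at most
      1.\<close>
    have "buyer_rent p v \<le> (v - vs) + e" if "0 < e" for e
    proof -
      define v' where "v' = max vl (vs - e)"
      have v': "v' \<in> {vl..vh}" "v' < vs" "v' \<le> v" "vs - e \<le> v'" using that vs False by (auto simp: v'_def)
      show ?thesis using buyer_rent_lipschitz(2)[OF p v'(1) v v'(3)] rentB0[OF v'(1,2)] v'(4) by simp
    qed
    then have "buyer_rent p v \<le> v - vs" by (rule field_le_epsilon)
    then show ?thesis using I(2)[OF v] zero by simp
  qed
  show "seller_utility GB p t c \<le> max 0 (cs - c)" if c: "c \<in> {cl..ch}" for c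
  proof (cases "cs < c")
    case True
    then show ?thesis using I(3)[OF c] rentS0[OF c] zero by simp
  next
    case False
    have "seller_rent p c \<le> (cs - c) + e" if "0 < e" for e
    proof -
      define c' where "c' = min ch (cs + e)"
      have c': "c' \<in> {cl..ch}" "cs < c'" "c \<le> c'" "c' \<le> cs + e" using that cs False by (auto simp: c'_def)
      show ?thesis using seller_rent_lipschitz(2)[OF p c c'(1,3)] rentS0[OF c'(1,2)] c'(4) by simp
    qed
    then have "seller_rent p c \<le> cs - c" by (rule field_le_epsilon)
    then show ?thesis using I(3)[OF c] zero by simp
  qed
qed

text \<open>Values from \<open>vs\<close> on trade with almost every cost and costs below
  \<open>cs\<close> with every value. Such types have probability zero, so trade costs no surplus,
  yet their interim probability is 1 and their rents rise with the maximal slope.\<close>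

lemma no_gains_mechanism:
  assumes vs: "vl < vs" "vs \<le> vh" "GB.sdf vs = 0" and cs: "cl \<le> cs" "cs < ch" "GS.cdf cs = 0"
  defines "\<phi> \<equiv> (\<lambda>c. if c < cs then vl else vs)"
  obtains t where "\<phi> \<in> cutoffs" "mechanism vl vh cl ch GB GS (lottery 1 \<phi> \<phi>) t"
    "\<And>v. v \<in> {vl..vh} \<Longrightarrow> buyer_utility GS (lottery 1 \<phi> \<phi>) t v = max 0 (v - vs)"
    "\<And>c. c \<in> {cl..ch} \<Longrightarrow> seller_utility GB (lottery 1 \<phi> \<phi>) t c = max 0 (cs - c)"
proof -
  have \<phi>: "\<phi> \<in> cutoffs" using vs by (auto simp: cutoffs_def \<phi>_def intro!: mono_onI)
  let ?p = "lottery 1 \<phi> \<phi>"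
  note impl = implementable_cutoff[OF \<phi>]
  note iA = implementable_measurable[OF impl]
  have x: "buyer_prob ?p v = indicator {vs..} v" for v
  proof -
    have "(\<integral>c. of_bool (\<phi> c \<le> v) \<partial>GS) = (\<integral>c. indicator {vs..} v \<partial>GS :: real)"
    proof (rule integral_cong_AE)
      show "AE c in GS. of_bool (\<phi> c \<le> v) = (indicator {vs..} v :: real)"
        using AE_above[OF cs(3)] by eventually_elim (auto simp: \<phi>_def)
    qed (use cutoff_probs(1)[OF \<phi>] in auto)
    then show ?thesis unfolding lottery_probs[OF \<phi> \<phi>] by (simp add: GS.prob_space)
  qed
  have q: "seller_prob ?p c = indicator {..<cs} c" for c
    unfolding lottery_probs[OF \<phi> \<phi>] using vs(3) by (simp add: \<phi>_def sdf_vl)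
  have rentB: "buyer_rent ?p v = max 0 (v - vs)" if v: "v \<in> {vl..vh}" for v
  proof -
    have "buyer_rent ?p v = (\<integral>u. indicator {vs<..max vs v} u * 1 \<partial>LB)" unfolding buyer_rent_def
    proof (rule integral_cong_AE)
      show "AE u in LB. indicator {..v} u * buyer_prob ?p u = indicator {vs<..max vs v} u * 1"
        using LB.AE_neq[of vs] by eventually_elim (auto simp: x split: split_indicator)
    qed (use iA in \<open>auto intro!: borel_measurable_times LB.borel_measurableI\<close>)
    also have "\<dots> = 1 * (max vs v - vs)" using vs v by (intro integral_lborel_Ioc) auto
    finally show ?thesis by (simp add: max_def)
  qed
  have rentS: "seller_rent ?p c = max 0 (cs - c)" if c: "c \<in> {cl..ch}" for c
  proof -
    have "seller_rent ?p c = (\<integral>u. indicator {min c cs<..cs} u * 1 \<partial>LS)" unfolding seller_rent_def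
    proof (rule integral_cong_AE)
      show "AE u in LS. indicator {c..} u * seller_prob ?p u = indicator {min c cs<..cs} u * 1"
        using LS.AE_neq[of c] LS.AE_neq[of cs] by eventually_elim (auto simp: q split: split_indicator)
    qed (use iA in \<open>auto intro!: borel_measurable_times LS.borel_measurableI\<close>)
    also have "\<dots> = 1 * (cs - min c cs)" using cs c by (intro integral_lborel_Ioc) auto
    finally show ?thesis by (simp add: max_def min_def)
  qed
  have "(\<integral>v. buyer_prob ?p v * v - buyer_rent ?p v \<partial>GB) = (\<integral>v. 0 \<partial>GB)"
  proof (rule integral_cong_AE)
    show "AE v in GB. buyer_prob ?p v * v - buyer_rent ?p v = 0"
      using AE_below[OF vs(3)] AE_space by eventually_elim (auto simp: GB.space_M x rentB)
  qed (use integrable_rents[OF impl] in auto)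
  moreover have "(\<integral>c. seller_prob ?p c * c + seller_rent ?p c \<partial>GS) = (\<integral>c. 0 \<partial>GS)"
  proof (rule integral_cong_AE)
    show "AE c in GS. seller_prob ?p c * c + seller_rent ?p c = 0"
      using AE_above[OF cs(3)] AE_space by eventually_elim (auto simp: GS.space_M q rentS)
  qed (use integrable_rents[OF impl] in auto)
  ultimately have "0 + 0 = surplus ?p" unfolding surplus_eq[OF impl] by simp
  from implementable_mechanism[OF impl order_refl order_refl this]
  obtain t where "mechanism vl vh cl ch GB GS ?p t"
    "\<And>v. v \<in> {vl..vh} \<Longrightarrow> buyer_utility GS ?p t v = 0 + buyer_rent ?p v"
    "\<And>c. c \<in> {cl..ch} \<Longrightarrow> seller_utility GB ?p t c = 0 + seller_rent ?p c" by metis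
  then show ?thesis using \<phi> rentB rentS by (intro that[of t]) auto
qed

end


section \<open>Welfare\<close>

lemma integrable_continuous_borel_measure_on:
  assumes "finite_measure M" "borel_measure_on a b M" "continuous_on UNIV (f :: real \<Rightarrow> real)"
  shows "integrable M f"
proof -
  interpret finite_measure M by fact
  have sets: "sets M = sets (restrict_space borel {a..b})" using assms(2) by (simp add: borel_measure_on_def)
  have space: "space M = {a..b}" using sets_eq_imp_space_eq[OF sets] by (simp add: space_restrict_space)
  have "f \<in> borel_measurable (restrict_space borel {a..b})"
    by (intro measurable_restrict_space1 borel_measurable_continuous_onI assms(3))
  then have meas: "f \<in> borel_measurable M" using measurable_cong_sets[OF sets refl] by blast
  have "bounded (f ` {a..b})"
    by (intro compact_imp_bounded compact_continuous_image continuous_on_subset[OF assms(3)]) auto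
  then obtain K where "\<forall>x\<in>f ` {a..b}. norm x \<le> K" unfolding bounded_iff by blast
  then show ?thesis using meas by (intro integrable_const_bound[where B=K]) (auto simp: space)
qed

context bilateral_trade
begin

definition buyer_weight :: "real measure \<Rightarrow> real \<Rightarrow> real" where
  "buyer_weight \<Lambda> v = measure \<Lambda> ({v..} \<inter> {vl..vh})"

definition seller_weight :: "real measure \<Rightarrow> real \<Rightarrow> real" where
  "seller_weight \<Lambda> c = measure \<Lambda> ({..c} \<inter> {cl..ch})"

lemma weights_objective:
  assumes B: "finite_measure \<Lambda>B" "borel_measure_on vl vh \<Lambda>B" and S: "finite_measure \<Lambda>S" "borel_measure_on cl ch \<Lambda>S"
  shows "trade_objective GB GS vl vh cl ch (buyer_weight \<Lambda>B) (\<lambda>_. 0) (seller_weight \<Lambda>S) (\<lambda>_. 0)"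
proof
  interpret B: finite_measure \<Lambda>B by fact
  interpret S: finite_measure \<Lambda>S by fact
  have sB: "A \<inter> {vl..vh} \<in> sets \<Lambda>B" and sS: "A \<inter> {cl..ch} \<in> sets \<Lambda>S" if "A \<in> sets borel" for A
    using B(2) S(2) that by (auto simp: borel_measure_on_def sets_restrict_space)
  have anti: "buyer_weight \<Lambda>B w \<le> buyer_weight \<Lambda>B v" if "v \<le> w" for v w
    unfolding buyer_weight_def using that by (intro B.finite_measure_mono sB) auto
  have mono: "seller_weight \<Lambda>S v \<le> seller_weight \<Lambda>S w" if "v \<le> w" for v w
    unfolding seller_weight_def using that by (intro S.finite_measure_mono sS) auto
  show "integrable LB (buyer_weight \<Lambda>B)"
    by (intro LB.integrable_bounded[where B="measure \<Lambda>B (space \<Lambda>B)"] LB.measurable_antimono anti)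
      (simp_all add: buyer_weight_def B.bounded_measure)
  show "integrable LS (seller_weight \<Lambda>S)"
    by (intro LS.integrable_bounded[where B="measure \<Lambda>S (space \<Lambda>S)"] LS.measurable_mono mono_onI mono)
      (simp_all add: seller_weight_def S.bounded_measure)
qed auto

lemma welfare_finite:
  assumes B: "finite_measure \<Lambda>B" "borel_measure_on vl vh \<Lambda>B" and S: "finite_measure \<Lambda>S" "borel_measure_on cl ch \<Lambda>S"
    and p: "implementable p" and base: "0 \<le> u0" "0 \<le> w0"
    and U: "\<And>v. v \<in> {vl..vh} \<Longrightarrow> buyer_utility GS p t v = u0 + buyer_rent p v"
    and V: "\<And>c. c \<in> {cl..ch} \<Longrightarrow> seller_utility GB p t c = w0 + seller_rent p c"
  shows "welfare GB GS \<Lambda>B \<Lambda>S p t = ennreal (u0 * measure \<Lambda>B (space \<Lambda>B) + w0 * measure \<Lambda>S (space \<Lambda>S)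
    + trade_value (buyer_weight \<Lambda>B) (\<lambda>_. 0) (seller_weight \<Lambda>S) (\<lambda>_. 0) p)"
proof -
  interpret B: finite_measure \<Lambda>B by fact
  interpret S: finite_measure \<Lambda>S by fact
  have space: "space \<Lambda>B = {vl..vh}" "space \<Lambda>S = {cl..ch}"
    using B(2) S(2) by (auto simp: borel_measure_on_def space_restrict_space dest: sets_eq_imp_space_eq)
  note iB = integrable_continuous_borel_measure_on[OF B continuous_rents(1)[OF p]]
    and iS = integrable_continuous_borel_measure_on[OF S continuous_rents(2)[OF p]]
  let ?B = "u0 * measure \<Lambda>B (space \<Lambda>B) + (\<integral>v. buyer_prob p v * buyer_weight \<Lambda>B v \<partial>LB)"
    and ?S = "w0 * measure \<Lambda>S (space \<Lambda>S) + (\<integral>c. seller_prob p c * seller_weight \<Lambda>S c \<partial>LS)"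
  have "(\<integral>\<^sup>+v. ennreal (buyer_utility GS p t v) \<partial>\<Lambda>B) = (\<integral>\<^sup>+v. ennreal (u0 + buyer_rent p v) \<partial>\<Lambda>B)"
    using U by (intro nn_integral_cong) (simp add: space)
  also have "\<dots> = ennreal (\<integral>v. u0 + buyer_rent p v \<partial>\<Lambda>B)"
    using iB base rents_nonneg[OF p] by (intro nn_integral_eq_integral) auto
  also have "(\<integral>v. u0 + buyer_rent p v \<partial>\<Lambda>B) = ?B"
    using iB integral_rents(1)[OF p B] by (simp add: buyer_weight_def)
  finally have eB: "(\<integral>\<^sup>+v. ennreal (buyer_utility GS p t v) \<partial>\<Lambda>B) = ennreal ?B" .
  have "(\<integral>\<^sup>+c. ennreal (seller_utility GB p t c) \<partial>\<Lambda>S) = (\<integral>\<^sup>+c. ennreal (w0 + seller_rent p c) \<partial>\<Lambda>S)"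
    using V by (intro nn_integral_cong) (simp add: space)
  also have "\<dots> = ennreal (\<integral>c. w0 + seller_rent p c \<partial>\<Lambda>S)"
    using iS base rents_nonneg[OF p] by (intro nn_integral_eq_integral) auto
  also have "(\<integral>c. w0 + seller_rent p c \<partial>\<Lambda>S) = ?S"
    using iS integral_rents(2)[OF p S] by (simp add: seller_weight_def)
  finally have eS: "(\<integral>\<^sup>+c. ennreal (seller_utility GB p t c) \<partial>\<Lambda>S) = ennreal ?S" .
  have "0 \<le> (\<integral>v. buyer_prob p v * buyer_weight \<Lambda>B v \<partial>LB)" "0 \<le> (\<integral>c. seller_prob p c * seller_weight \<Lambda>S c \<partial>LS)"
    using implementable_bounds[OF p]
    by (auto intro!: integral_nonneg_AE AE_I2 simp: LB.space_M LS.space_M buyer_weight_def seller_weight_def)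
  then have "ennreal ?B + ennreal ?S = ennreal (?B + ?S)" using base by (intro ennreal_plus[symmetric]) auto
  then show ?thesis
    unfolding welfare_def eB eS by (simp add: trade_value_def buyer_int_def seller_int_def algebra_simps)
qed

lemma welfare_le:
  assumes B: "finite_measure \<Lambda>B" "borel_measure_on vl vh \<Lambda>B" and S: "finite_measure \<Lambda>S" "borel_measure_on cl ch \<Lambda>S"
    and mech: "mechanism vl vh cl ch GB GS p t"
  defines "m \<equiv> max (measure \<Lambda>B (space \<Lambda>B)) (measure \<Lambda>S (space \<Lambda>S))"
  shows "welfare GB GS \<Lambda>B \<Lambda>S p t \<le> ennreal (trade_value (buyer_weight \<Lambda>B) (\<lambda>_. 0) (seller_weight \<Lambda>S) (\<lambda>_. 0) p + m * surplus p)"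
proof -
  note I = mechanism_implementable[OF mech]
  let ?u = "buyer_utility GS p t vl" and ?w = "seller_utility GB p t ch"
  have "?u * measure \<Lambda>B (space \<Lambda>B) + ?w * measure \<Lambda>S (space \<Lambda>S) \<le> ?u * m + ?w * m"
    using I(4,5) by (intro add_mono mult_left_mono) (auto simp: m_def)
  also have "\<dots> = m * surplus p" by (simp add: I(6)[symmetric] algebra_simps)
  finally show ?thesis unfolding welfare_finite[OF B S I(1,4,5,2,3), simplified] by (intro ennreal_leI) simp
qed

lemma mechanism_attaining_bound:
  assumes B: "finite_measure \<Lambda>B" "borel_measure_on vl vh \<Lambda>B" and S: "finite_measure \<Lambda>S" "borel_measure_on cl ch \<Lambda>S"
    and p: "implementable p" "0 \<le> surplus p"
  defines "m \<equiv> max (measure \<Lambda>B (space \<Lambda>B)) (measure \<Lambda>S (space \<Lambda>S))"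
  obtains t where "mechanism vl vh cl ch GB GS p t"
    "welfare GB GS \<Lambda>B \<Lambda>S p t = ennreal (trade_value (buyer_weight \<Lambda>B) (\<lambda>_. 0) (seller_weight \<Lambda>S) (\<lambda>_. 0) p + m * surplus p)"
proof -
  define u0 w0 where "u0 = (if measure \<Lambda>S (space \<Lambda>S) \<le> measure \<Lambda>B (space \<Lambda>B) then surplus p else 0)" and "w0 = surplus p - u0"
  have base: "0 \<le> u0" "0 \<le> w0" "u0 + w0 = surplus p" using p(2) by (auto simp: u0_def w0_def)
  have *: "u0 * measure \<Lambda>B (space \<Lambda>B) + w0 * measure \<Lambda>S (space \<Lambda>S) = m * surplus p"
    by (auto simp: u0_def w0_def m_def max_def)
  obtain t where t: "mechanism vl vh cl ch GB GS p t"
    "\<And>v. v \<in> {vl..vh} \<Longrightarrow> buyer_utility GS p t v = u0 + buyer_rent p v"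
    "\<And>c. c \<in> {cl..ch} \<Longrightarrow> seller_utility GB p t c = w0 + seller_rent p c"
    using implementable_mechanism[OF p(1) base] by metis
  have "welfare GB GS \<Lambda>B \<Lambda>S p t = ennreal (u0 * measure \<Lambda>B (space \<Lambda>B) + w0 * measure \<Lambda>S (space \<Lambda>S)
    + trade_value (buyer_weight \<Lambda>B) (\<lambda>_. 0) (seller_weight \<Lambda>S) (\<lambda>_. 0) p)"
    by (rule welfare_finite[OF B S p(1) base(1,2)]) (simp_all add: t(2,3))
  then show ?thesis using t(1) unfolding * by (intro that[of t]) (simp_all add: add.commute)
qed

text \<open>\<open>m\<close> is the welfare value of a unit of lump sum, so the multiplier
  \<open>l\<close> is sought from \<open>m\<close> upwards. If \<open>l = m\<close>, the Lagrangian
  is the objective itself and one optimal cutoff rule suffices. If \<open>l > m\<close>,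
  complementary slackness demands zero surplus, which the pooled mixture provides.\<close>

lemma optimal_lottery:
  assumes W: "trade_objective GB GS vl vh cl ch f1 f2 g1 g2"
    and slater: "\<phi>0 \<in> cutoffs" "0 < surplus (lottery 1 \<phi>0 \<phi>0)" and m: "0 \<le> m"
  obtains p where "implementable p" "markup_pooling vl vh cl ch p" "0 \<le> surplus p"
    "\<And>p'. implementable p' \<Longrightarrow> 0 \<le> surplus p' \<Longrightarrow>
      trade_value f1 f2 g1 g2 p' + m * surplus p' \<le> trade_value f1 f2 g1 g2 p + m * surplus p"
proof -
  note C = surplus_objective
  let ?W = "payoff f1 f2 g1 g2" and ?C = "payoff (\<lambda>v. - GB.sdf v) (\<lambda>v. v) (\<lambda>c. - GS.cdf c) (\<lambda>c. - c)"
  let ?P = "\<lambda>\<phi>. (?W \<phi>, ?C \<phi>)"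
  interpret C: trade_objective GB GS vl vh cl ch "\<lambda>v. - GB.sdf v" "\<lambda>v. v" "\<lambda>c. - GS.cdf c" "\<lambda>c. - c" by (rule C)
  interpret W: trade_objective GB GS vl vh cl ch f1 f2 g1 g2 by (rule W)
  have C_surplus: "surplus (lottery 1 \<phi> \<phi>) = ?C \<phi>" if "\<phi> \<in> cutoffs" for \<phi>
    using payoff_trade_value[OF C that] by (simp add: surplus_trade_value)
  have image0: "(?W \<phi>0, ?C \<phi>0) \<in> ?P ` cutoffs" and pos0: "0 < ?C \<phi>0" using slater C_surplus by auto
  obtain l z where lz: "m \<le> l" "maximises (?P ` cutoffs) l z" "0 \<le> snd z"
    "l = m \<or> (\<exists>z. maximises (?P ` cutoffs) l z \<and> snd z \<le> 0)"
    by (rule compact_multiplier[OF compact_payoffs[OF W C] image0 pos0, of m])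
  define L1 L2 L3 L4 where "L1 = (\<lambda>v. f1 v + l * - GB.sdf v)" and "L2 = (\<lambda>v. f2 v + l * v)"
    and "L3 = (\<lambda>c. g1 c + l * - GS.cdf c)" and "L4 = (\<lambda>c. g2 c + l * - c)"
  interpret L: trade_objective GB GS vl vh cl ch L1 L2 L3 L4
    unfolding L1_def L2_def L3_def L4_def by (rule trade_value_add(1)[OF W C])
  have L_payoff: "payoff L1 L2 L3 L4 \<phi> = ?W \<phi> + l * ?C \<phi>" if "\<phi> \<in> cutoffs" for \<phi>
    unfolding L1_def L2_def L3_def L4_def by (rule payoff_add[OF W C that])
  have L_value: "trade_value L1 L2 L3 L4 p = trade_value f1 f2 g1 g2 p + l * surplus p" if "implementable p" for p
    unfolding L1_def L2_def L3_def L4_def surplus_trade_value by (rule trade_value_add(2)[OF W C that])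
  \<comment> \<open>\<open>best_cutoff\<close> attains the bound within the same set, so maximisers
    among the payoff pairs come from rules that attain it as well.\<close>
  have opt: "\<exists>\<phi>\<in>cutoffs. snd z = ?C \<phi> \<and> payoff L1 L2 L3 L4 \<phi> = L.bound" if z: "maximises (?P ` cutoffs) l z" for z
  proof -
    obtain \<phi> where \<phi>: "\<phi> \<in> cutoffs" "z = ?P \<phi>" using z unfolding maximises_def by blast
    have "?P L.best_cutoff \<in> ?P ` cutoffs" using L.best_cutoff_in by (rule imageI)
    then have "fst (?P L.best_cutoff) + l * snd (?P L.best_cutoff) \<le> fst z + l * snd z"
      using z unfolding maximises_def by (elim conjE) (rule bspec)
    then have "?W L.best_cutoff + l * ?C L.best_cutoff \<le> ?W \<phi> + l * ?C \<phi>" by (simp add: \<phi>(2))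
    then have "L.bound \<le> payoff L1 L2 L3 L4 \<phi>"
      using L.payoff_best_cutoff L_payoff[OF L.best_cutoff_in] L_payoff[OF \<phi>(1)] by simp
    then have "payoff L1 L2 L3 L4 \<phi> = L.bound" using L.payoff_le_bound[OF \<phi>(1)] by simp
    then show ?thesis using \<phi> by (intro bexI[of _ \<phi>]) simp_all
  qed
  obtain \<phi>1 where \<phi>1: "\<phi>1 \<in> cutoffs" "0 \<le> ?C \<phi>1" "payoff L1 L2 L3 L4 \<phi>1 = L.bound"
    using opt[OF lz(2)] lz(3) by metis
  have "\<exists>p. implementable p \<and> markup_pooling vl vh cl ch p \<and> 0 \<le> surplus p \<and>
    trade_value L1 L2 L3 L4 p = L.bound \<and> (l = m \<or> surplus p = 0)"
  proof (cases "l = m")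
    case True
    have "trade_value L1 L2 L3 L4 (lottery 1 \<phi>1 \<phi>1) = L.bound"
      using \<phi>1 payoff_trade_value[OF L.trade_objective_axioms \<phi>1(1)] by simp
    then show ?thesis using True \<phi>1 implementable_cutoff[OF \<phi>1(1)] markup_pooling_cutoff[OF \<phi>1(1)] C_surplus[OF \<phi>1(1)]
      by (intro exI[of _ "lottery 1 \<phi>1 \<phi>1"]) auto
  next
    case False
    then obtain z2 where z2: "maximises (?P ` cutoffs) l z2" "snd z2 \<le> 0" using lz(4) by blast
    obtain \<phi>2 where \<phi>2: "\<phi>2 \<in> cutoffs" "?C \<phi>2 \<le> 0" "payoff L1 L2 L3 L4 \<phi>2 = L.bound"
      using opt[OF z2(1)] z2(2) by metis
    obtain \<phi> u w k where \<phi>: "\<phi> \<in> cutoffs" "cl \<le> u" "u \<le> w" "w \<le> ch" "0 \<le> k" "k \<le> 1"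
      and \<psi>: "pooled u w (\<phi> u) \<phi> \<in> cutoffs" "pooled u w (\<phi> w) \<phi> \<in> cutoffs"
      "payoff L1 L2 L3 L4 (pooled u w (\<phi> u) \<phi>) = L.bound" "payoff L1 L2 L3 L4 (pooled u w (\<phi> w) \<phi>) = L.bound"
      and zero: "k * ?C (pooled u w (\<phi> u) \<phi>) + (1 - k) * ?C (pooled u w (\<phi> w) \<phi>) = 0"
      using L.optimal_pooled_mixture[OF C \<phi>1(1) \<phi>2(1) \<phi>1(3) \<phi>2(3) \<phi>1(2) \<phi>2(2)] by blast
    let ?p = "lottery k (pooled u w (\<phi> u) \<phi>) (pooled u w (\<phi> w) \<phi>)"
    have "surplus ?p = 0"
      using C.lottery_payoff[OF \<psi>(1,2), of k] zero by (simp add: surplus_def)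
    moreover have "trade_value L1 L2 L3 L4 ?p = L.bound"
      using L.lottery_payoff[OF \<psi>(1,2), of k] \<psi>(3,4) by (simp add: trade_value_def algebra_simps)
    ultimately show ?thesis
      using implementable_lottery[OF \<psi>(1,2) \<phi>(5,6)] markup_pooling_lottery[OF \<phi>] by (intro exI[of _ ?p]) auto
  qed
  then obtain p where p: "implementable p" "markup_pooling vl vh cl ch p" "0 \<le> surplus p"
    "trade_value L1 L2 L3 L4 p = L.bound" "l = m \<or> surplus p = 0" by blast
  show ?thesis
  proof (rule that[OF p(1-3)])
    fix p' assume p': "implementable p'" "0 \<le> surplus p'"
    have "trade_value f1 f2 g1 g2 p' + m * surplus p' \<le> trade_value f1 f2 g1 g2 p' + l * surplus p'"
      using lz(1) p'(2) by (intro add_left_mono mult_right_mono)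
    also have "\<dots> \<le> L.bound"
      using L.implementable_le_bound[OF p'(1)] L_value[OF p'(1)] by (simp add: trade_value_def)
    also have "\<dots> = trade_value f1 f2 g1 g2 p + m * surplus p"
      using p(4,5) L_value[OF p(1)] by auto
    finally show "trade_value f1 f2 g1 g2 p' + m * surplus p' \<le> trade_value f1 f2 g1 g2 p + m * surplus p" .
  qed
qed

end

lemma nn_integral_infinite:
  assumes "emeasure M (space M) = \<infinity>" "0 < d" "\<And>x. x \<in> space M \<Longrightarrow> d \<le> f x"
  shows "(\<integral>\<^sup>+x. ennreal (f x) \<partial>M) = \<infinity>"
proof -
  have "(\<integral>\<^sup>+x. ennreal d \<partial>M) = \<infinity>" using assms(1,2) by (simp add: ennreal_mult_top)
  moreover have "(\<integral>\<^sup>+x. ennreal d \<partial>M) \<le> (\<integral>\<^sup>+x. ennreal (f x) \<partial>M)"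
    using assms(3) by (intro nn_integral_mono ennreal_leI) auto
  ultimately show ?thesis by (simp add: top_unique)
qed

theorem proposition10:
  fixes vl vh cl ch :: real and GB GS \<Lambda>B \<Lambda>S :: "real measure"
  assumes "continuous_distribution_on vl vh GB"
    and "continuous_distribution_on cl ch GS"
    and "borel_measure_on vl vh \<Lambda>B"
    and "borel_measure_on cl ch \<Lambda>S"
  shows "\<exists>p t. mechanism vl vh cl ch GB GS p t \<and> markup_pooling vl vh cl ch p \<and>
           (\<forall>p' t'. mechanism vl vh cl ch GB GS p' t' \<longrightarrow>
              welfare GB GS \<Lambda>B \<Lambda>S p' t' \<le> welfare GB GS \<Lambda>B \<Lambda>S p t)"
proof -
  interpret GB: atomless_prob_on GB vl vh using assms(1) by (rule continuous_distribution_atomless)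
  interpret GS: atomless_prob_on GS cl ch using assms(2) by (rule continuous_distribution_atomless)
  interpret bilateral_trade GB GS vl vh cl ch ..
  have space: "space \<Lambda>B = {vl..vh}" "space \<Lambda>S = {cl..ch}"
    using assms(3,4) by (auto simp: borel_measure_on_def space_restrict_space dest: sets_eq_imp_space_eq)
  show ?thesis
  \<comment> \<open>Such an \<open>r\<close> is a price that both sides accept with positive
    probability; it supplies the Slater point.\<close>
  proof (cases "\<exists>r. 0 < GB.sdf r \<and> 0 < GS.cdf r")
    case False
    then have "GB.sdf r = 0 \<or> GS.cdf r = 0" for r
      using GB.sdf_nonneg[of r] GS.cdf_nonneg[of r] by (auto simp: less_le)
    then obtain vs cs where vs: "vl < vs" "vs \<le> vh" "GB.sdf vs = 0" "\<And>v. v < vs \<Longrightarrow> 0 < GB.sdf v"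
      and cs: "cl \<le> cs" "cs < ch" "GS.cdf cs = 0" "\<And>c. cs < c \<Longrightarrow> 0 < GS.cdf c" and "vs \<le> cs"
      using no_trade_region by metis
    define \<phi> where "\<phi> = (\<lambda>c. if c < cs then vl else vs)"
    obtain t where \<phi>: "\<phi> \<in> cutoffs" and t: "mechanism vl vh cl ch GB GS (lottery 1 \<phi> \<phi>) t"
      "\<And>v. v \<in> {vl..vh} \<Longrightarrow> buyer_utility GS (lottery 1 \<phi> \<phi>) t v = max 0 (v - vs)"
      "\<And>c. c \<in> {cl..ch} \<Longrightarrow> seller_utility GB (lottery 1 \<phi> \<phi>) t c = max 0 (cs - c)"
      using no_gains_mechanism[OF vs(1-3) cs(1-3)] unfolding \<phi>_def by metis
    have "welfare GB GS \<Lambda>B \<Lambda>S p' t' \<le> welfare GB GS \<Lambda>B \<Lambda>S (lottery 1 \<phi> \<phi>) t"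
      if m: "mechanism vl vh cl ch GB GS p' t'" for p' t'
      unfolding welfare_def using no_gains_rents_le[OF vs cs \<open>vs \<le> cs\<close> m]
      by (intro add_mono nn_integral_mono ennreal_leI) (auto simp: space t(2,3))
    then show ?thesis using t(1) markup_pooling_cutoff[OF \<phi>] by blast
  next
    case True
    then obtain \<phi>0 where slater: "\<phi>0 \<in> cutoffs" "0 < surplus (lottery 1 \<phi>0 \<phi>0)" using positive_surplus by metis
    let ?p0 = "lottery 1 \<phi>0 \<phi>0"
    note impl = implementable_cutoff[OF slater(1)] and markup = markup_pooling_cutoff[OF slater(1)]
    consider "emeasure \<Lambda>B (space \<Lambda>B) = \<infinity>" | "emeasure \<Lambda>S (space \<Lambda>S) = \<infinity>" | "finite_measure \<Lambda>B" "finite_measure \<Lambda>S"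
      using finite_measureI by blast
    then show ?thesis
    proof cases
      case 1
      have "0 \<le> surplus ?p0" "surplus ?p0 + 0 = surplus ?p0" using slater by auto
      from implementable_mechanism[OF impl this(1) order_refl this(2)]
      obtain t where t: "mechanism vl vh cl ch GB GS ?p0 t"
        "\<And>v. v \<in> {vl..vh} \<Longrightarrow> buyer_utility GS ?p0 t v = surplus ?p0 + buyer_rent ?p0 v" by metis
      have "(\<integral>\<^sup>+v. ennreal (buyer_utility GS ?p0 t v) \<partial>\<Lambda>B) = \<infinity>"
        using 1 slater(2) by (rule nn_integral_infinite) (simp add: space t(2) rents_nonneg[OF impl])
      then have "welfare GB GS \<Lambda>B \<Lambda>S ?p0 t = \<infinity>" by (simp add: welfare_def)
      then show ?thesis using t(1) markup by (intro exI[of _ ?p0] exI[of _ t]) auto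
    next
      case 2
      have "0 \<le> surplus ?p0" "0 + surplus ?p0 = surplus ?p0" using slater by auto
      from implementable_mechanism[OF impl order_refl this(1,2)]
      obtain t where t: "mechanism vl vh cl ch GB GS ?p0 t"
        "\<And>c. c \<in> {cl..ch} \<Longrightarrow> seller_utility GB ?p0 t c = surplus ?p0 + seller_rent ?p0 c" by metis
      have "(\<integral>\<^sup>+c. ennreal (seller_utility GB ?p0 t c) \<partial>\<Lambda>S) = \<infinity>"
        using 2 slater(2) by (rule nn_integral_infinite) (simp add: space t(2) rents_nonneg[OF impl])
      then have "welfare GB GS \<Lambda>B \<Lambda>S ?p0 t = \<infinity>" by (simp add: welfare_def)
      then show ?thesis using t(1) markup by (intro exI[of _ ?p0] exI[of _ t]) auto
    next
      case 3
      note BS = 3(1) assms(3) 3(2) assms(4)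
      let ?m = "max (measure \<Lambda>B (space \<Lambda>B)) (measure \<Lambda>S (space \<Lambda>S))"
      let ?W = "trade_value (buyer_weight \<Lambda>B) (\<lambda>_. 0) (seller_weight \<Lambda>S) (\<lambda>_. 0)"
      have "0 \<le> ?m" by (simp add: le_max_iff_disj)
      from optimal_lottery[OF weights_objective[OF BS] slater this]
      obtain p where p: "implementable p" "markup_pooling vl vh cl ch p" "0 \<le> surplus p"
        "\<And>p'. implementable p' \<Longrightarrow> 0 \<le> surplus p' \<Longrightarrow> ?W p' + ?m * surplus p' \<le> ?W p + ?m * surplus p" by metis
      obtain t where t: "mechanism vl vh cl ch GB GS p t"
        "welfare GB GS \<Lambda>B \<Lambda>S p t = ennreal (?W p + ?m * surplus p)"
        using mechanism_attaining_bound[OF BS p(1,3)] by metis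
      have "welfare GB GS \<Lambda>B \<Lambda>S p' t' \<le> welfare GB GS \<Lambda>B \<Lambda>S p t" if m: "mechanism vl vh cl ch GB GS p' t'" for p' t'
      proof -
        note I = mechanism_implementable[OF m]
        have "welfare GB GS \<Lambda>B \<Lambda>S p' t' \<le> ennreal (?W p' + ?m * surplus p')" by (rule welfare_le[OF BS m])
        also have "\<dots> \<le> ennreal (?W p + ?m * surplus p)"
          using I(4-6) by (intro ennreal_leI p(4) I(1)) simp
        finally show ?thesis by (simp add: t(2))
      qed
      then show ?thesis using t(1) p(2) by blast
    qed
  qed
qed

end
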